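(* Let $(X,\phi)$ be a non-compact strictly $\phi$-convex calibrated manifold, $p=\deg\phi$, and suppose that $\phi$ is exact. Given $S\in\mathcal E'_{p-1}(X)$, there exists a $\Lambda_+(\phi)$-positive current $T\in\mathcal E'_p(X)$ with $S=\partial T$ if and only if $$\int_S\alpha\ \ge\ 0\qquad\text{for all }\alpha\in\mathcal E^{p-1}(X)\text{ such that } d\alpha\text{ is }\Lambda^+(\phi)\text{-positive}.$$
   Context: A calibrated manifold $(X,\phi)$ is an oriented Riemannian manifold $X$ with a smooth $d$-closed $p$-form $\phi$ of comass one, i.e. $\phi(\xi)\le 1$ for every unit simple $p$-vector $\xi$. A $\phi$-plane is a unit simple $p$-vector $\xi$ with $\phi(\xi)=1$; $G(\phi)$ denotes the set of all $\phi$-planes. For $f\in C^\infty(X)$ the $\phi$-Hessian $\mathcal H^\phi(f)$ is the $p$-form $\mathcal H^\phi(f)(v_1,\dots,v_p)=\sum_i\phi(v_1,\dots,Av_i,\dots,v_p)$, where $A=\mathrm{Hess} f$ is the Riemannian Hessian viewed as a symmetric endomorphism of $TX$. For a $\phi$-plane $\xi$ one has $\mathcal H^\phi(f)(\xi)=\mathrm{trace}\{\mathrm{Hess} f|_{\mathrm{span}\,\xi}\}$. $f$ is strictly $\phi$-plurisubharmonic if $\mathcal H^\phi(f)(\xi)>0$ for all $\xi\in G(\phi)$. $X$ is strictly $\phi$-convex if it admits a smooth strictly $\phi$-plurisubharmonic proper exhaustion function $f:X\to\mathbb R$ (all sublevel sets $\{f\le c\}$ compact). $\mathcal E^k(X)$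 is the space of smooth $k$-forms on $X$ and $\mathcal E'_k(X)$ is its topological dual, the space of $k$-dimensional currents with compact support. For $S\in\mathcal E'_{p-1}(X)$, $\int_S\alpha$ denotes $S(\alpha)$; the boundary is $(\partial T)(\alpha)=T(d\alpha)$. A smooth $p$-form $\beta$ is $\Lambda^+(\phi)$-positive if $\beta(\xi)\ge0$ for all $\xi\in G(\phi)$. A $p$-dimensional current $T$ is $\Lambda_+(\phi)$-positive if $T(\beta)\ge 0$ for all compactly supported $\Lambda^+(\phi)$-positive $p$-forms $\beta$. *)

theory Defs
  imports "HOL-Analysis.Analysis"
begin

section \<open>Smooth maps between Euclidean spaces\<close>

text \<open>On an open set \<open>U\<close>: \<open>f\<close> is of class \<open>C^k\<close>, by recursion on \<open>k\<close> through the directional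
  derivatives.\<close>

fun Ck_on :: "nat \<Rightarrow> ('e::real_normed_vector \<Rightarrow> 'f::real_normed_vector) \<Rightarrow> 'e set \<Rightarrow> bool" where
  "Ck_on 0 f U \<longleftrightarrow> continuous_on U f"
| "Ck_on (Suc k) f U \<longleftrightarrow>
     (\<forall>y\<in>U. f differentiable (at y)) \<and> (\<forall>v. Ck_on k (\<lambda>y. frechet_derivative f (at y) v) U)"

definition smooth_on :: "('e::real_normed_vector \<Rightarrow> 'f::real_normed_vector) \<Rightarrow> 'e set \<Rightarrow> bool" where
  "smooth_on f U \<longleftrightarrow> (\<forall>k. Ck_on k f U)"

fun iter_deriv :: "'e list \<Rightarrow> ('e::real_normed_vector \<Rightarrow> real) \<Rightarrow> 'e \<Rightarrow> real" where
  "iter_deriv [] f = f"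
| "iter_deriv (u # us) f = iter_deriv us (\<lambda>y. frechet_derivative f (at y) u)"

section \<open>Oriented smooth manifolds\<close>

text \<open>The manifold is the whole type \<open>'a\<close>; its smooth structure and its orientation are given by an
  oriented atlas (not necessarily maximal) with charts into \<open>real^'n\<close>, so that the dimension is
  \<open>CARD('n)\<close>. A chart is a pair of its domain and its coordinate map; the values of the
  coordinate map outside the domain are irrelevant.\<close>

type_synonym ('a, 'n) chart = "'a set \<times> ('a \<Rightarrow> real^'n)"

abbreviation chart_dom :: "('a, 'n::finite) chart \<Rightarrow> 'a set" where
  "chart_dom c \<equiv> fst c"

abbreviation chart_map :: "('a, 'n::finite) chart \<Rightarrow> 'a \<Rightarrow> real^'n" where
  "chart_map c \<equiv> snd c"

definition chart_img :: "('a, 'n::finite) chart \<Rightarrow> (real^'n) set" where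
  "chart_img c = chart_map c ` chart_dom c"

definition chart_inv :: "('a, 'n::finite) chart \<Rightarrow> real^'n \<Rightarrow> 'a" where
  "chart_inv c = inv_into (chart_dom c) (chart_map c)"

definition is_chart :: "('a::topological_space, 'n::finite) chart \<Rightarrow> bool" where
  "is_chart c \<longleftrightarrow> open (chart_dom c) \<and> open (chart_img c) \<and>
     homeomorphism (chart_dom c) (chart_img c) (chart_map c) (chart_inv c)"

definition transition :: "('a, 'n::finite) chart \<Rightarrow> ('a, 'n) chart \<Rightarrow> real^'n \<Rightarrow> real^'n" where
  "transition c d = (\<lambda>y. chart_map d (chart_inv c y))"

text \<open>The differential, at the point \<open>x\<close>, of the transition map from \<open>c\<close> to \<open>d\<close>: it turns the
  components of a tangent vector at \<open>x\<close> in the chart \<open>c\<close> into its components in the chart \<open>d\<close>.\<close>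

definition transition_deriv ::
    "('a, 'n::finite) chart \<Rightarrow> ('a, 'n) chart \<Rightarrow> 'a \<Rightarrow> real^'n \<Rightarrow> real^'n" where
  "transition_deriv c d x = frechet_derivative (transition c d) (at (chart_map c x))"

definition oriented_atlas :: "('a::topological_space, 'n::finite) chart set \<Rightarrow> bool" where
  "oriented_atlas A \<longleftrightarrow>
     (\<forall>c\<in>A. is_chart c) \<and> (\<Union>c\<in>A. chart_dom c) = UNIV \<and>
     (\<forall>c\<in>A. \<forall>d\<in>A.
        smooth_on (transition c d) (chart_map c ` (chart_dom c \<inter> chart_dom d)) \<and>
        (\<forall>x\<in>chart_dom c \<inter> chart_dom d. det (matrix (transition_deriv c d x)) > 0))"

definition smooth_function :: "('a, 'n::finite) chart set \<Rightarrow> ('a \<Rightarrow> real) \<Rightarrow> bool" where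
  "smooth_function A f \<longleftrightarrow> (\<forall>c\<in>A. smooth_on (\<lambda>y. f (chart_inv c y)) (chart_img c))"

section \<open>Differential forms\<close>

text \<open>A form is the compatible family of its local expressions: \<open>\<omega> c y [v1, ..., vk]\<close> is its value, at
  the point with coordinates \<open>y\<close> in the chart \<open>c\<close>, on the tangent vectors with components
  \<open>v1, ..., vk\<close> in \<open>c\<close>. Local expressions are set to zero wherever this makes no sense, so that equal
  forms are equal as functions.\<close>

type_synonym ('a, 'n) form = "('a, 'n) chart \<Rightarrow> real^'n \<Rightarrow> (real^'n) list \<Rightarrow> real"

definition multilinear :: "nat \<Rightarrow> ((real^'n::finite) list \<Rightarrow> real) \<Rightarrow> bool" where
  "multilinear k \<theta> \<longleftrightarrow> (\<forall>vs i. length vs = k \<and> i < k \<longrightarrow> linear (\<lambda>v. \<theta> (vs[i := v])))"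

definition alternating :: "nat \<Rightarrow> ((real^'n::finite) list \<Rightarrow> real) \<Rightarrow> bool" where
  "alternating k \<theta> \<longleftrightarrow>
     (\<forall>vs i j. length vs = k \<and> i < j \<and> j < k \<and> vs ! i = vs ! j \<longrightarrow> \<theta> vs = 0)"

text \<open>The space of smooth \<open>k\<close>-forms.\<close>

definition forms :: "('a, 'n::finite) chart set \<Rightarrow> nat \<Rightarrow> ('a, 'n) form set" where
  "forms A k = {\<omega>.
     (\<forall>c y vs. \<not> (c \<in> A \<and> y \<in> chart_img c \<and> length vs = k) \<longrightarrow> \<omega> c y vs = 0) \<and>
     (\<forall>c\<in>A. \<forall>y\<in>chart_img c. multilinear k (\<omega> c y) \<and> alternating k (\<omega> c y)) \<and>
     (\<forall>c\<in>A. \<forall>vs. length vs = k \<longrightarrow> smooth_on (\<lambda>y. \<omega> c y vs) (chart_img c)) \<and>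
     (\<forall>c\<in>A. \<forall>d\<in>A. \<forall>x\<in>chart_dom c \<inter> chart_dom d. \<forall>vs. length vs = k \<longrightarrow>
        \<omega> c (chart_map c x) vs = \<omega> d (chart_map d x) (map (transition_deriv c d x) vs))}"

definition zero_form :: "('a, 'n::finite) form" where
  "zero_form = (\<lambda>c y vs. 0)"

text \<open>Exterior derivative of a \<open>k\<close>-form, by the invariant formula applied to the vector fields with
  constant components in the chart, whose Lie brackets vanish.\<close>

definition ext_d :: "('a, 'n::finite) chart set \<Rightarrow> nat \<Rightarrow> ('a, 'n) form \<Rightarrow> ('a, 'n) form" where
  "ext_d A k \<omega> = (\<lambda>c y vs.
     if c \<in> A \<and> y \<in> chart_img c \<and> length vs = Suc k
     then \<Sum>i\<le>k. (-1) ^ i *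
            frechet_derivative (\<lambda>z. \<omega> c z (take i vs @ drop (Suc i) vs)) (at y) (vs ! i)
     else 0)"

definition closed_form :: "('a, 'n::finite) chart set \<Rightarrow> nat \<Rightarrow> ('a, 'n) form \<Rightarrow> bool" where
  "closed_form A k \<omega> \<longleftrightarrow> \<omega> \<in> forms A k \<and> ext_d A k \<omega> = zero_form"

definition exact_form :: "('a, 'n::finite) chart set \<Rightarrow> nat \<Rightarrow> ('a, 'n) form \<Rightarrow> bool" where
  "exact_form A k \<omega> \<longleftrightarrow> 1 \<le> k \<and> (\<exists>\<gamma>\<in>forms A (k - 1). \<omega> = ext_d A (k - 1) \<gamma>)"

definition form_support :: "('a::topological_space, 'n::finite) chart set \<Rightarrow> ('a, 'n) form \<Rightarrow> 'a set" where
  "form_support A \<omega> = closure {x. \<exists>c\<in>A. x \<in> chart_dom c \<and> (\<exists>vs. \<omega> c (chart_map c x) vs \<noteq> 0)}"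

section \<open>Riemannian metrics\<close>

text \<open>\<open>g c y v w\<close> is the inner product, at the point with coordinates \<open>y\<close>, of the tangent vectors with
  components \<open>v\<close> and \<open>w\<close> in the chart \<open>c\<close>.\<close>

type_synonym ('a, 'n) metric = "('a, 'n) chart \<Rightarrow> real^'n \<Rightarrow> real^'n \<Rightarrow> real^'n \<Rightarrow> real"

definition riemannian_metric :: "('a, 'n::finite) chart set \<Rightarrow> ('a, 'n) metric \<Rightarrow> bool" where
  "riemannian_metric A g \<longleftrightarrow>
     (\<forall>c\<in>A. \<forall>y\<in>chart_img c.
        (\<forall>v. linear (g c y v)) \<and> (\<forall>v w. g c y v w = g c y w v) \<and> (\<forall>v. v \<noteq> 0 \<longrightarrow> g c y v v > 0)) \<and>
     (\<forall>c\<in>A. \<forall>v w. smooth_on (\<lambda>y. g c y v w) (chart_img c)) \<and>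
     (\<forall>c\<in>A. \<forall>d\<in>A. \<forall>x\<in>chart_dom c \<inter> chart_dom d. \<forall>v w.
        g c (chart_map c x) v w =
        g d (chart_map d x) (transition_deriv c d x v) (transition_deriv c d x w))"

text \<open>The Levi-Civita derivative of the vector field with constant components \<open>w\<close> in the direction
  \<open>v\<close>, i.e. the contraction of the Christoffel symbols with \<open>v\<close> and \<open>w\<close>, from the Koszul formula.\<close>

definition christoffel ::
    "('a, 'n::finite) metric \<Rightarrow> ('a, 'n) chart \<Rightarrow> real^'n \<Rightarrow> real^'n \<Rightarrow> real^'n \<Rightarrow> real^'n" where
  "christoffel g c y v w = (THE z. \<forall>u. 2 * g c y z u =
       frechet_derivative (\<lambda>y. g c y w u) (at y) v
     + frechet_derivative (\<lambda>y. g c y v u) (at y) w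
     - frechet_derivative (\<lambda>y. g c y v w) (at y) u)"

text \<open>The Riemannian Hessian \<open>v (w f) - (\<nabla>\<^sub>v w) f\<close>, for \<open>v\<close> and \<open>w\<close> with constant components.\<close>

definition hessian ::
    "('a, 'n::finite) metric \<Rightarrow> ('a \<Rightarrow> real) \<Rightarrow> ('a, 'n) chart \<Rightarrow> real^'n \<Rightarrow> real^'n \<Rightarrow> real^'n \<Rightarrow> real" where
  "hessian g f c y v w =
     (let F = (\<lambda>z. f (chart_inv c z)) in
        frechet_derivative (\<lambda>z. frechet_derivative F (at z) w) (at y) v
      - frechet_derivative F (at y) (christoffel g c y v w))"

text \<open>The Hessian as an endomorphism of the tangent space.\<close>

definition hessian_endo ::
    "('a, 'n::finite) metric \<Rightarrow> ('a \<Rightarrow> real) \<Rightarrow> ('a, 'n) chart \<Rightarrow> real^'n \<Rightarrow> real^'n \<Rightarrow> real^'n" where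
  "hessian_endo g f c y v = (THE z. \<forall>w. g c y z w = hessian g f c y v w)"

section \<open>Calibrations\<close>

text \<open>The norm of the simple vector \<open>v1 \<and> ... \<and> vp\<close> for the inner product on the exterior power
  induced by the metric: the square root of the Gram determinant.\<close>

definition simple_norm ::
    "('a, 'n::finite) metric \<Rightarrow> ('a, 'n) chart \<Rightarrow> real^'n \<Rightarrow> (real^'n) list \<Rightarrow> real" where
  "simple_norm g c y vs =
     sqrt (\<Sum>\<sigma> | \<sigma> permutes {..<length vs}.
             of_int (sign \<sigma>) * (\<Prod>i<length vs. g c y (vs ! i) (vs ! \<sigma> i)))"

text \<open>A simple \<open>p\<close>-vector is represented by a chart, the coordinates of its base point and the
  components of its \<open>p\<close> factors. Distinct triples may represent the same \<open>p\<close>-vector; all predicates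
  below only involve the values of \<open>p\<close>-forms on it.\<close>

definition unit_simple ::
    "('a, 'n::finite) chart set \<Rightarrow> ('a, 'n) metric \<Rightarrow> nat \<Rightarrow> (('a, 'n) chart \<times> (real^'n) \<times> (real^'n) list) set" where
  "unit_simple A g p =
     {(c, y, vs). c \<in> A \<and> y \<in> chart_img c \<and> length vs = p \<and> simple_norm g c y vs = 1}"

definition calibrated_manifold ::
    "('a::{t2_space,second_countable_topology}, 'n::finite) chart set \<Rightarrow> ('a, 'n) metric \<Rightarrow>
     nat \<Rightarrow> ('a, 'n) form \<Rightarrow> bool" where
  "calibrated_manifold A g p \<phi> \<longleftrightarrow>
     oriented_atlas A \<and> riemannian_metric A g \<and> closed_form A p \<phi> \<and>
     (\<forall>(c, y, vs)\<in>unit_simple A g p. \<phi> c y vs \<le> 1)"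

definition phi_planes ::
    "('a, 'n::finite) chart set \<Rightarrow> ('a, 'n) metric \<Rightarrow> nat \<Rightarrow> ('a, 'n) form \<Rightarrow>
     (('a, 'n) chart \<times> (real^'n) \<times> (real^'n) list) set" where
  "phi_planes A g p \<phi> = {(c, y, vs)\<in>unit_simple A g p. \<phi> c y vs = 1}"

definition phi_hessian ::
    "('a, 'n::finite) metric \<Rightarrow> ('a, 'n) form \<Rightarrow> ('a \<Rightarrow> real) \<Rightarrow> ('a, 'n) form" where
  "phi_hessian g \<phi> f =
     (\<lambda>c y vs. \<Sum>i<length vs. \<phi> c y (vs[i := hessian_endo g f c y (vs ! i)]))"

definition strictly_phi_psh ::
    "('a, 'n::finite) chart set \<Rightarrow> ('a, 'n) metric \<Rightarrow> nat \<Rightarrow> ('a, 'n) form \<Rightarrow> ('a \<Rightarrow> real) \<Rightarrow> bool" where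
  "strictly_phi_psh A g p \<phi> f \<longleftrightarrow>
     (\<forall>(c, y, vs)\<in>phi_planes A g p \<phi>. phi_hessian g \<phi> f c y vs > 0)"

definition strictly_phi_convex ::
    "('a::topological_space, 'n::finite) chart set \<Rightarrow> ('a, 'n) metric \<Rightarrow> nat \<Rightarrow> ('a, 'n) form \<Rightarrow> bool" where
  "strictly_phi_convex A g p \<phi> \<longleftrightarrow>
     (\<exists>f. smooth_function A f \<and> strictly_phi_psh A g p \<phi> f \<and> (\<forall>r. compact {x. f x \<le> r}))"

definition positive_form ::
    "('a, 'n::finite) chart set \<Rightarrow> ('a, 'n) metric \<Rightarrow> nat \<Rightarrow> ('a, 'n) form \<Rightarrow> ('a, 'n) form \<Rightarrow> bool" where
  "positive_form A g p \<phi> \<beta> \<longleftrightarrow> (\<forall>(c, y, vs)\<in>phi_planes A g p \<phi>. \<beta> c y vs \<ge> 0)"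

section \<open>Currents with compact support\<close>

text \<open>Subbasic neighbourhoods of \<open>\<omega>\<close> in the usual Frechet topology of the space of \<open>k\<close>-forms, uniform
  convergence on compact sets of all partial derivatives of all components in all charts: one partial
  derivative (along \<open>us\<close>) of one component (given by \<open>vs\<close>) is controlled on the compact set \<open>K\<close>.\<close>

definition form_nbhd ::
    "('a, 'n::finite) chart set \<Rightarrow> nat \<Rightarrow> ('a, 'n) chart \<Rightarrow> (real^'n) set \<Rightarrow> (real^'n) list \<Rightarrow>
     (real^'n) list \<Rightarrow> ('a, 'n) form \<Rightarrow> real \<Rightarrow> ('a, 'n) form set" where
  "form_nbhd A k c K us vs \<omega> e =
     {\<eta>\<in>forms A k. \<forall>y\<in>K. \<bar>iter_deriv us (\<lambda>z. \<eta> c z vs - \<omega> c z vs) y\<bar> < e}"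

definition form_topology :: "('a, 'n::finite) chart set \<Rightarrow> nat \<Rightarrow> ('a, 'n) form topology" where
  "form_topology A k = topology_generated_by
     {form_nbhd A k c K us vs \<omega> e | c K us vs \<omega> e.
        c \<in> A \<and> compact K \<and> K \<subseteq> chart_img c \<and> set us \<subseteq> Basis \<and> set vs \<subseteq> Basis \<and> length vs = k \<and>
        \<omega> \<in> forms A k \<and> e > 0}"

type_synonym ('a, 'n) current = "('a, 'n) form \<Rightarrow> real"

text \<open>The topological dual of the space of smooth \<open>k\<close>-forms. Functionals are \<open>undefined\<close> outside that
  space (\<open>extensional\<close>), so that equal currents are equal as functions.\<close>

definition currents :: "('a, 'n::finite) chart set \<Rightarrow> nat \<Rightarrow> ('a, 'n) current set" where
  "currents A k = {T \<in> extensional (forms A k).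
     (\<forall>\<omega>\<in>forms A k. \<forall>\<eta>\<in>forms A k. \<forall>a b.
        T (\<lambda>c y vs. a * \<omega> c y vs + b * \<eta> c y vs) = a * T \<omega> + b * T \<eta>) \<and>
     continuous_map (form_topology A k) euclideanreal T}"

text \<open>The boundary of a \<open>k\<close>-dimensional current, \<open>k \<ge> 1\<close>.\<close>

definition boundary :: "('a, 'n::finite) chart set \<Rightarrow> nat \<Rightarrow> ('a, 'n) current \<Rightarrow> ('a, 'n) current" where
  "boundary A k T = (\<lambda>\<alpha>\<in>forms A (k - 1). T (ext_d A (k - 1) \<alpha>))"

definition positive_current ::
    "('a::topological_space, 'n::finite) chart set \<Rightarrow> ('a, 'n) metric \<Rightarrow> nat \<Rightarrow> ('a, 'n) form \<Rightarrow>
     ('a, 'n) current \<Rightarrow> bool" where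
  "positive_current A g p \<phi> T \<longleftrightarrow>
     (\<forall>\<beta>\<in>forms A p. compact (form_support A \<beta>) \<and> positive_form A g p \<phi> \<beta> \<longrightarrow> T \<beta> \<ge> 0)"

end

theory Submission
  imports Defs "HOL-Library.Function_Algebras"
begin

text \<open>
  Testing a filling \<open>T\<close> of \<open>S\<close> against a form \<open>\<alpha>\<close> with positive \<open>d \<alpha>\<close> gives \<open>S \<alpha> = T (d \<alpha>) \<ge> 0\<close>. The
  only point is that positivity of \<open>T\<close> is demanded for compactly supported forms; since \<open>T\<close> only sees
  a compact part of the manifold, \<open>d \<alpha>\<close> may first be multiplied by a cutoff function of the exhaustion
  function \<open>f\<close> (\<open>positive_current_nonneg\<close>).

  Conversely, the condition says that \<open>d \<alpha> \<mapsto> S \<alpha>\<close> is a well defined positive functional on the exact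
  forms, and a filling of \<open>S\<close> is the same thing as an extension of it to a positive continuous functional
  on all \<open>p\<close>-forms. M. Riesz' extension theorem (\<open>positive_extension\<close>) produces a positive extension as
  soon as every \<open>p\<close>-form is bounded on the \<open>\<phi>\<close>-planes by some exact form, and this is where convexity enters
  (\<open>exact_domination\<close>). Contract \<open>\<phi>\<close> with the gradient of \<open>f\<close> to obtain a \<open>(p - 1)\<close>-form \<open>\<alpha>\<close>. As
  \<open>\<phi>\<close> is closed, \<open>d \<alpha>\<close> is the Lie derivative of \<open>\<phi>\<close> along the gradient, which is the \<open>\<phi>\<close>-Hessian of
  \<open>f\<close> plus the covariant derivative of \<open>\<phi>\<close> along the gradient. On a \<open>\<phi>\<close>-plane the latter vanishes,
  because \<open>\<phi>\<close> attains there its maximum over the unit simple vectors (\<open>first_variation\<close>). So \<open>d \<alpha>\<close> is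
  strictly positive on \<open>\<phi>\<close>-planes, and over a compact set it is bounded below by a positive constant.
  For an increasing function \<open>h\<close>,
  \<open>d (h(f) \<alpha>) = h(f) d \<alpha> + h'(f) df \<and> \<alpha>\<close>, whose last term is nonnegative on \<open>\<phi>\<close>-planes for the same
  variational reason. Hence letting \<open>h\<close> grow fast enough beats any given form.

  Continuity of the extension \<open>T\<close> comes for free. If no compact set controlled \<open>T\<close>, there would be forms
  \<open>\<gamma>\<^sub>m\<close> of size at most \<open>1/2^m\<close> on the planes over \<open>{f \<le> m}\<close> with \<open>T \<gamma>\<^sub>m \<ge> 1\<close>; one exact form dominates
  all their partial sums, so \<open>T\<close> of it would be infinite (\<open>positive_functional_bounded_above\<close>).
\<close>

section \<open>Calculus of smooth functions\<close>

lemma frechet_derivative_cong_open: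
  assumes "open U" "y \<in> U" "\<And>x. x \<in> U \<Longrightarrow> f x = g x"
  shows "frechet_derivative f (at y) = frechet_derivative g (at y)"
proof -
  have "(f has_derivative D) (at y) \<longleftrightarrow> (g has_derivative D) (at y)" for D
    using has_derivative_transform_within_open[of f D y UNIV U g]
      has_derivative_transform_within_open[of g D y UNIV U f] assms by auto
  then show ?thesis unfolding frechet_derivative_def by simp
qed

lemma differentiable_cong_open:
  assumes "open U" "y \<in> U" "\<And>x. x \<in> U \<Longrightarrow> f x = g x" "f differentiable (at y)"
  shows "g differentiable (at y)"
  using assms has_derivative_transform_within_open[of f _ y UNIV U g]
  unfolding differentiable_def by blast

lemma Ck_on_cong:
  assumes "open U" "\<And>x. x \<in> U \<Longrightarrow> f x = g x" "Ck_on k f U"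
  shows "Ck_on k g U"
  using assms(2,3)
proof (induction k arbitrary: f g)
  case 0
  then show ?case using continuous_on_cong[of U U f g] by simp
next
  case (Suc k)
  have "g differentiable (at y)" if "y \<in> U" for y
    by (rule differentiable_cong_open[OF assms(1) that, of f]) (use Suc.prems that in auto)
  moreover have "Ck_on k (\<lambda>y. frechet_derivative g (at y) v) U" for v
  proof (rule Suc.IH)
    show "Ck_on k (\<lambda>y. frechet_derivative f (at y) v) U" using Suc.prems by simp
    show "frechet_derivative f (at x) v = frechet_derivative g (at x) v" if "x \<in> U" for x
      using frechet_derivative_cong_open[OF assms(1) that, of f g] Suc.prems by simp
  qed
  ultimately show ?case by simp
qed

lemma Ck_on_mono: "Ck_on k f U \<Longrightarrow> V \<subseteq> U \<Longrightarrow> Ck_on k f V"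
  by (induction k arbitrary: f) (auto intro: continuous_on_subset)

text \<open>Needed for locally finite sums, which near each point agree with a finite one.\<close>

lemma Ck_on_local:
  assumes "\<And>x. x \<in> U \<Longrightarrow> \<exists>V. open V \<and> x \<in> V \<and> Ck_on k f V"
  shows "Ck_on k f U"
  using assms
proof (induction k arbitrary: f)
  case 0
  have "continuous (at x) f" if x: "x \<in> U" for x
  proof -
    from 0[OF x] obtain V where "open V" "x \<in> V" "continuous_on V f" by auto
    then show ?thesis by (simp add: continuous_on_eq_continuous_at)
  qed
  then show ?case by (simp add: continuous_at_imp_continuous_on)
next
  case (Suc k)
  have "f differentiable (at y)" if "y \<in> U" for y
    using Suc.prems[OF that] by auto
  moreover have "Ck_on k (\<lambda>y. frechet_derivative f (at y) v) U" for v
  proof (rule Suc.IH)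
    fix x assume "x \<in> U"
    with Suc.prems show "\<exists>V. open V \<and> x \<in> V \<and> Ck_on k (\<lambda>y. frechet_derivative f (at y) v) V"
      by (metis Ck_on.simps(2))
  qed
  ultimately show ?case by simp
qed

lemma Ck_on_Suc_imp: "Ck_on (Suc k) f U \<Longrightarrow> Ck_on k f U"
proof (induction k arbitrary: f)
  case 0
  then show ?case
    by (auto intro!: continuous_at_imp_continuous_on differentiable_imp_continuous_within)
next
  case (Suc k)
  then show ?case by (metis Ck_on.simps(2))
qed

lemma Ck_on_SucI:
  assumes "open U" "\<And>y. y \<in> U \<Longrightarrow> (f has_derivative D y) (at y)" "\<And>v. Ck_on k (\<lambda>y. D y v) U"
  shows "Ck_on (Suc k) f U"
proof -
  have "D y = frechet_derivative f (at y)" if "y \<in> U" for y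
    using frechet_derivative_at assms(2) that by blast
  then have "Ck_on k (\<lambda>y. frechet_derivative f (at y) v) U" for v
    using Ck_on_cong[OF assms(1) _ assms(3)] by simp
  then show ?thesis using assms(2) by (auto simp: differentiable_def)
qed

lemma Ck_on_SucD:
  assumes "Ck_on (Suc k) f U" "y \<in> U"
  shows "(f has_derivative frechet_derivative f (at y)) (at y)"
  using assms by (simp add: frechet_derivative_works)

lemma Ck_on_const [simp]: "open U \<Longrightarrow> Ck_on k (\<lambda>x. c) U"
proof (induction k arbitrary: c)
  case (Suc k)
  then show ?case by (intro Ck_on_SucI[where D="\<lambda>y v. 0"]) auto
qed simp

lemma Ck_on_id: "open U \<Longrightarrow> Ck_on k (\<lambda>x. x) U"
proof (cases k)
  case (Suc j)
  assume "open U" then show ?thesis unfolding Suc by (intro Ck_on_SucI[where D="\<lambda>y v. v"]) auto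
qed simp

lemma Ck_on_add:
  assumes "open U"
  shows "Ck_on k f U \<Longrightarrow> Ck_on k g U \<Longrightarrow> Ck_on k (\<lambda>x. f x + g x) U"
proof (induction k arbitrary: f g)
  case 0
  then show ?case by (simp add: continuous_on_add)
next
  case (Suc k)
  show ?case
    by (rule Ck_on_SucI[OF assms has_derivative_add[OF Ck_on_SucD[OF Suc.prems(1)] Ck_on_SucD[OF Suc.prems(2)]]])
      (use Suc in auto)
qed

lemma Ck_on_mult:
  fixes f g :: "_ \<Rightarrow> real"
  assumes "open U"
  shows "Ck_on k f U \<Longrightarrow> Ck_on k g U \<Longrightarrow> Ck_on k (\<lambda>x. f x * g x) U"
proof (induction k arbitrary: f g)
  case 0
  then show ?case by (simp add: continuous_on_mult)
next
  case (Suc k)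
  show ?case
  proof (rule Ck_on_SucI[OF assms has_derivative_mult[OF Ck_on_SucD[OF Suc.prems(1)] Ck_on_SucD[OF Suc.prems(2)]]])
    fix v
    note f = Ck_on_Suc_imp[OF Suc.prems(1)] and g = Ck_on_Suc_imp[OF Suc.prems(2)]
    show "Ck_on k (\<lambda>y. f y * frechet_derivative g (at y) v + frechet_derivative f (at y) v * g y) U"
      using Suc.prems by (intro Ck_on_add[OF assms] Suc.IH f g) auto
  qed
qed

lemma Ck_on_inverse:
  fixes f :: "_ \<Rightarrow> real"
  assumes "open U" "\<And>x. x \<in> U \<Longrightarrow> f x \<noteq> 0"
  shows "Ck_on k f U \<Longrightarrow> Ck_on k (\<lambda>x. inverse (f x)) U"
proof (induction k)
  case 0
  then show ?case using assms by (simp add: continuous_on_inverse)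
next
  case (Suc k)
  show ?case
  proof (rule Ck_on_SucI[OF assms(1) Deriv.has_derivative_inverse[OF assms(2) Ck_on_SucD[OF Suc.prems(1)]]])
    fix v
    have i: "Ck_on k (\<lambda>x. inverse (f x)) U" using Suc Ck_on_Suc_imp by blast
    have "Ck_on k (\<lambda>y. (- 1) * (inverse (f y) * frechet_derivative f (at y) v * inverse (f y))) U"
      using Suc.prems by (intro Ck_on_mult[OF assms(1)] i Ck_on_const assms) auto
    then show "Ck_on k (\<lambda>y. - (inverse (f y) * frechet_derivative f (at y) v * inverse (f y))) U"
      by simp
  qed auto
qed

lemma Ck_on_inner:
  assumes "open U" shows "Ck_on k f U \<Longrightarrow> Ck_on k (\<lambda>x. f x \<bullet> b) U"
proof (induction k arbitrary: f)
  case 0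
  then show ?case by (simp add: continuous_on_inner)
next
  case (Suc k)
  show ?case
    by (rule Ck_on_SucI[OF assms has_derivative_inner_left[OF Ck_on_SucD[OF Suc.prems(1)]]])
      (use Suc in auto)
qed

lemma Ck_on_compose_real:
  fixes h :: "real \<Rightarrow> real" and f :: "'e::real_normed_vector \<Rightarrow> real"
  assumes "open U"
  shows "Ck_on k h UNIV \<Longrightarrow> Ck_on k f U \<Longrightarrow> Ck_on k (\<lambda>x. h (f x)) U"
proof (induction k arbitrary: h)
  case 0
  then show ?case using continuous_on_compose2[of UNIV h U f] by simp
next
  case (Suc k)
  show ?case
  proof (rule Ck_on_SucI[OF assms])
    fix y assume y: "y \<in> U"
    note dh = Ck_on_SucD[OF Suc.prems(1), of "f y", simplified]
    have lin: "frechet_derivative h (at (f y)) x = x * frechet_derivative h (at (f y)) 1" for x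
      using linear_cmul[OF has_derivative_linear[OF dh], of x 1] by simp
    show "((\<lambda>x. h (f x)) has_derivative
        (\<lambda>v. frechet_derivative f (at y) v * frechet_derivative h (at (f y)) 1)) (at y)"
      using has_derivative_compose[OF Ck_on_SucD[OF Suc.prems(2) y] dh]
      by (subst (asm) lin) simp
  next
    fix v
    show "Ck_on k (\<lambda>y. frechet_derivative f (at y) v * frechet_derivative h (at (f y)) 1) U"
      using Suc.prems Ck_on_Suc_imp[OF Suc.prems(2)]
      by (intro Ck_on_mult[OF assms] Suc.IH[where h="\<lambda>t. frechet_derivative h (at t) 1"]) auto
  qed
qed

lemma smooth_on_frechet: "smooth_on f U \<Longrightarrow> smooth_on (\<lambda>y. frechet_derivative f (at y) v) U"
  unfolding smooth_on_def by (metis Ck_on.simps(2))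

lemma smooth_on_differentiable: "smooth_on f U \<Longrightarrow> y \<in> U \<Longrightarrow> f differentiable (at y)"
  unfolding smooth_on_def by (metis Ck_on.simps(2))

lemma smooth_on_has_derivative:
  "smooth_on f U \<Longrightarrow> y \<in> U \<Longrightarrow> (f has_derivative frechet_derivative f (at y)) (at y)"
  using smooth_on_differentiable frechet_derivative_works by blast

lemma smooth_on_continuous: "smooth_on f U \<Longrightarrow> continuous_on U f"
  unfolding smooth_on_def by (metis Ck_on.simps(1))

lemma smooth_on_cong:
  "open U \<Longrightarrow> (\<And>x. x \<in> U \<Longrightarrow> f x = g x) \<Longrightarrow> smooth_on f U \<Longrightarrow> smooth_on g U"
  unfolding smooth_on_def using Ck_on_cong by blast

lemma smooth_on_const [simp]: "open U \<Longrightarrow> smooth_on (\<lambda>x. c) U"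
  by (simp add: smooth_on_def)

lemma smooth_on_add:
  "open U \<Longrightarrow> smooth_on f U \<Longrightarrow> smooth_on g U \<Longrightarrow> smooth_on (\<lambda>x. f x + g x) U"
  by (simp add: smooth_on_def Ck_on_add)

lemma smooth_on_mult:
  fixes f g :: "_ \<Rightarrow> real"
  shows "open U \<Longrightarrow> smooth_on f U \<Longrightarrow> smooth_on g U \<Longrightarrow> smooth_on (\<lambda>x. f x * g x) U"
  by (simp add: smooth_on_def Ck_on_mult)

lemma smooth_on_inverse:
  fixes f :: "_ \<Rightarrow> real"
  shows "open U \<Longrightarrow> (\<And>x. x \<in> U \<Longrightarrow> f x \<noteq> 0) \<Longrightarrow> smooth_on f U \<Longrightarrow> smooth_on (\<lambda>x. inverse (f x)) U"
  by (simp add: smooth_on_def Ck_on_inverse)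

lemma smooth_on_inner: "open U \<Longrightarrow> smooth_on f U \<Longrightarrow> smooth_on (\<lambda>x. f x \<bullet> b) U"
  by (simp add: smooth_on_def Ck_on_inner)

lemma smooth_on_sum:
  assumes "open U" "\<And>i. i \<in> I \<Longrightarrow> smooth_on (f i) U"
  shows "smooth_on (\<lambda>x. \<Sum>i\<in>I. f i x) U"
  using assms(2) by (induction I rule: infinite_finite_induct) (auto simp: assms(1) intro!: smooth_on_add)

lemma smooth_on_prod:
  fixes f :: "_ \<Rightarrow> _ \<Rightarrow> real"
  assumes "open U" "\<And>i. i \<in> I \<Longrightarrow> smooth_on (f i) U"
  shows "smooth_on (\<lambda>x. \<Prod>i\<in>I. f i x) U"
  using assms(2) by (induction I rule: infinite_finite_induct) (auto simp: assms(1) intro!: smooth_on_mult)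

lemma smooth_on_compose_real:
  fixes h :: "real \<Rightarrow> real"
  shows "open U \<Longrightarrow> smooth_on h UNIV \<Longrightarrow> smooth_on f U \<Longrightarrow> smooth_on (\<lambda>x. h (f x)) U"
  by (simp add: smooth_on_def Ck_on_compose_real)

lemma smooth_on_scaleR_const:
  assumes "open U" "smooth_on u U"
  shows "smooth_on (\<lambda>x. u x *\<^sub>R b) U"
proof -
  have "Ck_on k u U \<Longrightarrow> Ck_on k (\<lambda>x. u x *\<^sub>R b) U" for k
  proof (induction k arbitrary: u)
    case 0
    then show ?case by (simp add: continuous_on_scaleR)
  next
    case (Suc k)
    show ?case
      by (rule Ck_on_SucI[OF assms(1) has_derivative_scaleR_left[OF Ck_on_SucD[OF Suc.prems]]])
        (use Suc in auto)
  qed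
  then show ?thesis using assms(2) by (simp add: smooth_on_def)
qed

lemmas smooth_on_intros = smooth_on_const smooth_on_add smooth_on_mult smooth_on_sum smooth_on_prod

text \<open>Lets tensors be differentiated slot by slot: the derivative of their components is again linear in
  each slot.\<close>

lemma linear_frechet_derivative_parameter:
  fixes B :: "'e::real_normed_vector \<Rightarrow> 'b::real_vector \<Rightarrow> real"
  assumes U: "open U" "y \<in> U" and lin: "\<And>z. z \<in> U \<Longrightarrow> linear (B z)"
    and "\<And>u. (\<lambda>z. B z u) differentiable (at y)"
  shows "linear (\<lambda>u. frechet_derivative (\<lambda>z. B z u) (at y) h)"
proof -
  have D: "((\<lambda>z. B z u) has_derivative frechet_derivative (\<lambda>z. B z u) (at y)) (at y)" for u
    using assms(4) frechet_derivative_works by blast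
  have "((\<lambda>z. B z (a *\<^sub>R v + b *\<^sub>R w)) has_derivative (\<lambda>h. a * frechet_derivative (\<lambda>z. B z v) (at y) h +
          b * frechet_derivative (\<lambda>z. B z w) (at y) h)) (at y)" for a b v w
  proof (rule has_derivative_transform_within_open[OF _ U])
    show "((\<lambda>z. a * B z v + b * B z w) has_derivative (\<lambda>h. a * frechet_derivative (\<lambda>z. B z v) (at y) h +
          b * frechet_derivative (\<lambda>z. B z w) (at y) h)) (at y)"
      by (intro has_derivative_add has_derivative_mult_right D)
    fix z assume "z \<in> U"
    then show "a * B z v + b * B z w = B z (a *\<^sub>R v + b *\<^sub>R w)"
      using linear_add[OF lin, of z "a *\<^sub>R v" "b *\<^sub>R w"] linear_cmul[OF lin] by simp
  qed
  from fun_cong[OF frechet_derivative_at[OF this]]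
  have *: "frechet_derivative (\<lambda>z. B z (a *\<^sub>R v + b *\<^sub>R w)) (at y) h =
      a * frechet_derivative (\<lambda>z. B z v) (at y) h + b * frechet_derivative (\<lambda>z. B z w) (at y) h" for a b v w
    by (rule sym)
  show ?thesis
    using *[of 1 _ 1] *[of _ _ 0] by (auto simp: linear_iff)
qed

section \<open>Smooth cutoff functions and fast growing functions\<close>

text \<open>The family is closed under differentiation up to linear combinations, which makes smoothness an
  induction over the order; only the member with \<open>n = 0\<close>, the flat function
  \<open>exp (- 1 / x)\<close>, is used afterwards.\<close>

definition flat_fun :: "nat \<Rightarrow> real \<Rightarrow> real" where
  "flat_fun n x = (if x \<le> 0 then 0 else (1 / x) ^ n * exp (- 1 / x))"

text \<open>After the substitution \<open>y = 1 / x\<close> this says that exponentials beat powers.\<close>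

lemma flat_fun_tendsto_0: "(flat_fun n \<longlongrightarrow> 0) (at 0)"
proof (rule filterlim_split_at)
  show "(flat_fun n \<longlongrightarrow> 0) (at_left 0)"
    by (rule tendsto_eventually) (auto simp: flat_fun_def eventually_at_left_field intro!: exI[of _ "-1"])
  have "((\<lambda>y. flat_fun n (inverse y)) \<longlongrightarrow> 0) at_top"
  proof (rule Lim_transform_eventually)
    show "((\<lambda>y::real. y ^ n / exp y) \<longlongrightarrow> 0) at_top"
      using tendsto_power_div_exp_0 by simp
    show "\<forall>\<^sub>F y::real in at_top. y ^ n / exp y = flat_fun n (inverse y)"
      using eventually_gt_at_top[of 0]
      by eventually_elim (auto simp: flat_fun_def field_simps exp_minus)
  qed
  then show "(flat_fun n \<longlongrightarrow> 0) (at_right 0)"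
    by (simp add: filterlim_at_right_to_top)
qed

lemma flat_fun_has_derivative:
  "(flat_fun n has_derivative (\<lambda>v. v * (flat_fun (n + 2) x - real n * flat_fun (n + 1) x))) (at x)"
proof -
  consider "x < 0" | "x = 0" | "x > 0" by linarith
  then have "(flat_fun n has_field_derivative (flat_fun (n + 2) x - real n * flat_fun (n + 1) x)) (at x)"
  proof cases
    case 1
    have "((\<lambda>x::real. 0::real) has_field_derivative 0) (at x)" by simp
    then have "(flat_fun n has_field_derivative 0) (at x)"
      by (rule has_field_derivative_transform_within_open[where S="{..<0}"]) (use 1 in \<open>auto simp: flat_fun_def\<close>)
    then show ?thesis using 1 by (simp add: flat_fun_def)
  next
    case 2
    \<comment> \<open>the difference quotient at zero is the next member of the family\<close>
    have "(\<lambda>h. (flat_fun n (0 + h) - flat_fun n 0) / h) = flat_fun (Suc n)"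
      by (auto simp: flat_fun_def fun_eq_iff)
    then have "(flat_fun n has_field_derivative 0) (at 0)"
      using flat_fun_tendsto_0[of "Suc n"] by (simp add: DERIV_def)
    then show ?thesis using 2 by (simp add: flat_fun_def)
  next
    case 3
    let ?u = "1 / x"
    have "((\<lambda>u. u ^ n * exp (- u)) has_field_derivative
        (real n * ?u ^ (n - 1) * exp (- ?u) - ?u ^ n * exp (- ?u))) (at ?u)"
      by (auto intro!: derivative_eq_intros)
    moreover have "((\<lambda>x. 1 / x) has_field_derivative - (?u * ?u)) (at x)"
      using 3 by (auto intro!: derivative_eq_intros simp: field_simps)
    ultimately have "((\<lambda>x. (1 / x) ^ n * exp (- (1 / x))) has_field_derivative
        (real n * ?u ^ (n - 1) * exp (- ?u) - ?u ^ n * exp (- ?u)) * - (?u * ?u)) (at x)"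
      by (rule DERIV_chain2)
    moreover have "(real n * ?u ^ (n - 1) * exp (- ?u) - ?u ^ n * exp (- ?u)) * - (?u * ?u) =
        flat_fun (n + 2) x - real n * flat_fun (n + 1) x"
      using 3 by (cases n) (auto simp: flat_fun_def algebra_simps add_divide_distrib simp del: power_one_over)
    ultimately have "((\<lambda>x. (1 / x) ^ n * exp (- 1 / x)) has_field_derivative
        (flat_fun (n + 2) x - real n * flat_fun (n + 1) x)) (at x)" by simp
    then show ?thesis
      by (rule has_field_derivative_transform_within_open[where S="{0<..}"]) (use 3 in \<open>auto simp: flat_fun_def\<close>)
  qed
  then show ?thesis by (simp add: has_field_derivative_def mult_commute_abs)
qed

lemma smooth_flat_fun: "smooth_on (flat_fun n) UNIV"
proof -
  have "Ck_on k (flat_fun n) UNIV" for k n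
  proof (induction k arbitrary: n)
    case 0
    have "isCont (flat_fun n) x" for x
      using flat_fun_has_derivative[of n x] has_derivative_continuous by blast
    then show ?case by (auto intro!: continuous_at_imp_continuous_on)
  next
    case (Suc k)
    show ?case
    proof (rule Ck_on_SucI[OF open_UNIV flat_fun_has_derivative])
      fix v
      have "Ck_on k (\<lambda>y. v * (flat_fun (n + 2) y + (- real n) * flat_fun (n + 1) y)) UNIV"
        by (intro Ck_on_mult Ck_on_add Suc.IH Ck_on_const) auto
      then show "Ck_on k (\<lambda>y. v * (flat_fun (n + 2) y - real n * flat_fun (n + 1) y)) UNIV"
        by simp
    qed
  qed
  then show ?thesis by (simp add: smooth_on_def)
qed

lemma flat_fun_mono: "x \<le> y \<Longrightarrow> flat_fun 0 x \<le> flat_fun 0 y"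
  by (auto simp: flat_fun_def field_simps)

text \<open>The usual quotient: the two flat functions vanish on opposite half-lines that do not overlap, so
  the denominator is positive.\<close>

lemma smooth_cutoff:
  obtains s :: "real \<Rightarrow> real"
  where "smooth_on s UNIV" "\<And>x. 0 \<le> s x" "\<And>x. x \<le> r \<Longrightarrow> s x = 1" "\<And>x. r + 1 \<le> x \<Longrightarrow> s x = 0"
proof
  let ?a = "\<lambda>x. flat_fun 0 (r + 1 - x)" and ?b = "\<lambda>x. flat_fun 0 (x - r)"
  have id: "smooth_on (\<lambda>x::real. x) UNIV" by (simp add: smooth_on_def Ck_on_id)
  have sa: "smooth_on ?a UNIV"
    using smooth_on_compose_real[OF open_UNIV smooth_flat_fun smooth_on_add[OF open_UNIV smooth_on_const[OF open_UNIV] smooth_on_mult[OF open_UNIV smooth_on_const[OF open_UNIV] id]], of 0 "r+1" "-1"]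
    by (simp add: algebra_simps)
  have sb: "smooth_on ?b UNIV"
    using smooth_on_compose_real[OF open_UNIV smooth_flat_fun smooth_on_add[OF open_UNIV smooth_on_const[OF open_UNIV] smooth_on_mult[OF open_UNIV smooth_on_const[OF open_UNIV] id]], of 0 "-r" "1"]
    by (simp add: algebra_simps)
  have pos: "?a x + ?b x > 0" for x
    by (auto simp: flat_fun_def add_pos_nonneg add_nonneg_pos)
  show "smooth_on (\<lambda>x. ?a x * inverse (?a x + ?b x)) UNIV"
    using pos by (intro smooth_on_mult smooth_on_inverse smooth_on_add sa sb open_UNIV) (metis less_irrefl)
  show "0 \<le> ?a x * inverse (?a x + ?b x)" for x
    using pos[of x] by (auto simp: flat_fun_def)
  show "x \<le> r \<Longrightarrow> ?a x * inverse (?a x + ?b x) = 1" for x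
    by (auto simp: flat_fun_def)
  show "r + 1 \<le> x \<Longrightarrow> ?a x * inverse (?a x + ?b x) = 0" for x
    by (auto simp: flat_fun_def)
qed

text \<open>A locally finite sum of translated flat functions, each of them monotone and bounded below by a
  positive constant from its threshold on.\<close>

lemma smooth_fast_increasing:
  fixes a :: "nat \<Rightarrow> real"
  obtains h :: "real \<Rightarrow> real"
  where "smooth_on h UNIV" "\<And>x. 0 \<le> h x" "mono h" "\<And>m x. real m \<le> x \<Longrightarrow> a m \<le> h x"
proof
  \<comment> \<open>the factor \<open>exp 1\<close> compensates for \<open>flat_fun 0 1 = exp (- 1)\<close>,
    the least value from the threshold on\<close>
  define b where "b m = \<bar>a m\<bar> * exp 1" for m
  define T where "T m x = b m * flat_fun 0 (x + 1 - real m)" for m x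
  define h where "h x = (\<Sum>m\<le>nat \<lceil>x + 1\<rceil>. T m x)" for x
  have T0: "T m x = 0" if "x + 1 \<le> real m" for m x
    using that by (auto simp: T_def flat_fun_def)
  have Tpos: "0 \<le> T m x" for m x
    by (auto simp: T_def flat_fun_def b_def)
  have hN: "h x = (\<Sum>m\<le>N. T m x)" if "x + 1 \<le> real N" for N x
    unfolding h_def
  proof (rule sum.mono_neutral_left)
    show "{..nat \<lceil>x + 1\<rceil>} \<subseteq> {..N}" using that by (auto simp: nat_le_iff) linarith
    show "\<forall>i\<in>{..N} - {..nat \<lceil>x + 1\<rceil>}. T i x = 0"
    proof
      fix i assume "i \<in> {..N} - {..nat \<lceil>x + 1\<rceil>}"
      then have "x + 1 \<le> real i" by simp linarith
      then show "T i x = 0" by (rule T0)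
    qed
  qed auto
  have id: "smooth_on (\<lambda>x::real. x) UNIV" by (simp add: smooth_on_def Ck_on_id)
  have sT: "smooth_on (T m) UNIV" for m
  proof -
    have "smooth_on (\<lambda>x. b m * flat_fun 0 ((1 - real m) + x)) UNIV"
      by (intro smooth_on_mult smooth_on_const open_UNIV smooth_on_compose_real[OF open_UNIV smooth_flat_fun] smooth_on_add id)
    then show ?thesis by (simp add: T_def[abs_def] algebra_simps)
  qed
  show "smooth_on h UNIV"
    unfolding smooth_on_def
  proof (intro allI Ck_on_local)
    fix k and x :: real
    obtain N where N: "x + 2 \<le> real N" using real_arch_simple by blast
    have "Ck_on k (\<lambda>x. \<Sum>m\<le>N. T m x) {..<x + 1}"
      by (rule Ck_on_mono[OF smooth_on_sum[OF open_UNIV sT, unfolded smooth_on_def, rule_format]]) simp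
    then have "Ck_on k h {..<x + 1}"
    proof (rule Ck_on_cong[OF open_lessThan, rotated])
      fix z assume "z \<in> {..<x + 1}"
      then have "z + 1 \<le> real N" using N by simp
      then show "(\<Sum>m\<le>N. T m z) = h z" by (rule hN[symmetric])
    qed
    then show "\<exists>V. open V \<and> x \<in> V \<and> Ck_on k h V" by (intro exI[of _ "{..<x+1}"]) auto
  qed
  show "0 \<le> h x" for x unfolding h_def by (intro sum_nonneg Tpos)
  show "mono h"
  proof
    fix x y :: real assume xy: "x \<le> y"
    obtain N where N: "y + 1 \<le> real N" using real_arch_simple by blast
    have "T m x \<le> T m y" for m
      unfolding T_def using xy by (intro mult_left_mono flat_fun_mono) (auto simp: b_def)
    then show "h x \<le> h y" using hN[of x N] hN[of y N] xy N by (simp add: sum_mono)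
  qed
  show "a m \<le> h x" if "real m \<le> x" for m x
  proof -
    obtain N where N: "x + 1 \<le> real N" using real_arch_simple by blast
    have "a m \<le> \<bar>a m\<bar> * (exp 1 * exp (-1))" by (simp flip: exp_add)
    also have "\<dots> = b m * flat_fun 0 1" by (simp add: b_def flat_fun_def)
    also have "\<dots> \<le> T m x"
      unfolding T_def using that by (intro mult_left_mono flat_fun_mono) (auto simp: b_def)
    also have "\<dots> \<le> h x"
      unfolding hN[OF N] using that N by (intro member_le_sum) (auto simp: Tpos)
    finally show ?thesis .
  qed
qed

section \<open>Symmetry of second derivatives\<close>

text \<open>The mean value theorem applied twice, once in each direction: the mixed second difference is a
  mixed second derivative at a nearby point.\<close>

lemma mixed_difference_mvt:
  fixes f :: "'e::real_normed_vector \<Rightarrow> real"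
  assumes "open U" "smooth_on f U" "t > 0"
    and sub: "\<And>s r. 0 \<le> s \<Longrightarrow> s \<le> t \<Longrightarrow> 0 \<le> r \<Longrightarrow> r \<le> t \<Longrightarrow> y + s *\<^sub>R u + r *\<^sub>R v \<in> U"
  shows "\<exists>s r. 0 \<le> s \<and> s \<le> t \<and> 0 \<le> r \<and> r \<le> t \<and>
     f (y + t *\<^sub>R u + t *\<^sub>R v) - f (y + t *\<^sub>R u) - f (y + t *\<^sub>R v) + f y =
     t * t * frechet_derivative (\<lambda>z. frechet_derivative f (at z) u) (at (y + s *\<^sub>R u + r *\<^sub>R v)) v"
proof -
  have d1: "((\<lambda>s. f (y + s *\<^sub>R u + r *\<^sub>R v)) has_derivative
      (\<lambda>h. h * frechet_derivative f (at (y + s *\<^sub>R u + r *\<^sub>R v)) u)) (at s)"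
    if "0 \<le> s" "s \<le> t" "0 \<le> r" "r \<le> t" for s r
  proof -
    note D = smooth_on_has_derivative[OF assms(2) sub[OF that]]
    have "((\<lambda>s. y + s *\<^sub>R u + r *\<^sub>R v) has_derivative (\<lambda>h. h *\<^sub>R u)) (at s)"
      by (auto intro!: derivative_eq_intros)
    from has_derivative_compose[OF this D] show ?thesis
      by (simp add: linear_cmul[OF has_derivative_linear[OF D]])
  qed
  have "\<exists>s\<in>{0<..<t}. (\<lambda>s. f (y + s *\<^sub>R u + t *\<^sub>R v) - f (y + s *\<^sub>R u + 0 *\<^sub>R v)) t -
      (\<lambda>s. f (y + s *\<^sub>R u + t *\<^sub>R v) - f (y + s *\<^sub>R u + 0 *\<^sub>R v)) 0 =
      (\<lambda>h. h * frechet_derivative f (at (y + s *\<^sub>R u + t *\<^sub>R v)) u - h * frechet_derivative f (at (y + s *\<^sub>R u + 0 *\<^sub>R v)) u) (t - 0)"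
    using assms(3)
    by (intro mvt_simple has_derivative_at_withinI[OF has_derivative_diff] d1) auto
  then obtain s where s: "0 < s" "s < t" "f (y + t *\<^sub>R u + t *\<^sub>R v) - f (y + t *\<^sub>R u) - f (y + t *\<^sub>R v) + f y
     = t * (frechet_derivative f (at (y + s *\<^sub>R u + t *\<^sub>R v)) u - frechet_derivative f (at (y + s *\<^sub>R u + 0 *\<^sub>R v)) u)"
    by (auto simp: algebra_simps)
  let ?g = "\<lambda>z. frechet_derivative f (at z) u"
  have d2: "((\<lambda>r. ?g (y + s *\<^sub>R u + r *\<^sub>R v)) has_derivative
      (\<lambda>h. h * frechet_derivative ?g (at (y + s *\<^sub>R u + r *\<^sub>R v)) v)) (at r)"
    if "0 \<le> r" "r \<le> t" for r
  proof -
    note D = smooth_on_has_derivative[OF smooth_on_frechet[OF assms(2)] sub[OF _ _ that, of s], of u]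
    have "((\<lambda>r. y + s *\<^sub>R u + r *\<^sub>R v) has_derivative (\<lambda>h. h *\<^sub>R v)) (at r)"
      by (auto intro!: derivative_eq_intros)
    from has_derivative_compose[OF this D] s show ?thesis
      by (simp add: linear_cmul[OF has_derivative_linear[OF D]])
  qed
  have "\<exists>r\<in>{0<..<t}. ?g (y + s *\<^sub>R u + t *\<^sub>R v) - ?g (y + s *\<^sub>R u + 0 *\<^sub>R v) =
      (\<lambda>h. h * frechet_derivative ?g (at (y + s *\<^sub>R u + r *\<^sub>R v)) v) (t - 0)"
    using assms(3)
    by (intro mvt_simple[where f="\<lambda>r. ?g (y + s *\<^sub>R u + r *\<^sub>R v)"] has_derivative_at_withinI[OF d2]) auto
  then obtain r where "0 < r" "r < t" "?g (y + s *\<^sub>R u + t *\<^sub>R v) - ?g (y + s *\<^sub>R u + 0 *\<^sub>R v) =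
      t * frechet_derivative ?g (at (y + s *\<^sub>R u + r *\<^sub>R v)) v" by auto
  with s show ?thesis by (intro exI[of _ s] exI[of _ r]) (simp add: algebra_simps)
qed

text \<open>The mixed second difference is symmetric in \<open>u\<close> and \<open>v\<close>, and divided by
  \<open>t\<^sup>2\<close> it tends to either of the two mixed derivatives because these are
  continuous.\<close>

lemma second_derivative_symmetric_real:
  fixes f :: "'e::real_normed_vector \<Rightarrow> real"
  assumes U: "open U" "smooth_on f U" "y \<in> U"
  shows "frechet_derivative (\<lambda>z. frechet_derivative f (at z) u) (at y) v =
    frechet_derivative (\<lambda>z. frechet_derivative f (at z) v) (at y) u"
proof -
  define G where "G u v z = frechet_derivative (\<lambda>z. frechet_derivative f (at z) u) (at z) v" for u v z
  define \<Delta> where "\<Delta> t u v = f (y + t *\<^sub>R u + t *\<^sub>R v) - f (y + t *\<^sub>R u) - f (y + t *\<^sub>R v) + f y" for t u v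
  define t where "t n = 1 / real (Suc n)" for n
  have t0: "t \<longlonglongrightarrow> 0" unfolding t_def by (rule LIMSEQ_Suc[OF lim_1_over_n])
  have tpos: "t n > 0" for n by (simp add: t_def)
  have lim: "(\<lambda>n. \<Delta> (t n) u v / (t n * t n)) \<longlonglongrightarrow> G u v y" for u v
  proof -
    obtain e where e: "e > 0" "ball y e \<subseteq> U" using U openE by blast
    have norm0: "(\<lambda>n. (norm u + norm v) * t n) \<longlonglongrightarrow> 0"
      using tendsto_mult_right_zero[OF t0] .
    have near: "norm (s *\<^sub>R u + r *\<^sub>R v) \<le> (norm u + norm v) * t"
      if "0 \<le> s" "s \<le> t" "0 \<le> r" "r \<le> t" for s r t
    proof -
      have "norm (s *\<^sub>R u + r *\<^sub>R v) \<le> s * norm u + r * norm v"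
        using norm_triangle_ineq[of "s *\<^sub>R u" "r *\<^sub>R v"] that by simp
      also have "\<dots> \<le> t * norm u + t * norm v"
        using that by (intro add_mono mult_right_mono) auto
      finally show ?thesis by (simp add: algebra_simps)
    qed
    define P where "P n z \<longleftrightarrow> norm (z - y) \<le> (norm u + norm v) * t n \<and>
      ((norm u + norm v) * t n < e \<longrightarrow> \<Delta> (t n) u v = t n * t n * G u v z)" for n z
    have "\<exists>z. P n z" for n
    proof (cases "(norm u + norm v) * t n < e")
      case True
      have sub: "y + s *\<^sub>R u + r *\<^sub>R v \<in> U" if "0 \<le> s" "s \<le> t n" "0 \<le> r" "r \<le> t n" for s r
      proof -
        have "dist y (y + s *\<^sub>R u + r *\<^sub>R v) = norm (s *\<^sub>R u + r *\<^sub>R v)"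
          by (simp add: dist_norm norm_minus_commute algebra_simps flip: norm_minus_cancel[of "s *\<^sub>R u + r *\<^sub>R v"])
        then show ?thesis using near[OF that] True e by auto
      qed
      from mixed_difference_mvt[OF U(1,2) tpos sub] obtain s r where
        sr: "0 \<le> s" "s \<le> t n" "0 \<le> r" "r \<le> t n" and
        eq: "\<Delta> (t n) u v = t n * t n * G u v (y + s *\<^sub>R u + r *\<^sub>R v)" unfolding G_def \<Delta>_def by blast
      then show ?thesis using near[OF sr] unfolding P_def
        by (intro exI[of _ "y + s *\<^sub>R u + r *\<^sub>R v"]) (simp add: add.assoc)
    next
      case False
      then show ?thesis using tpos[of n] unfolding P_def by (intro exI[of _ y]) simp
    qed
    then obtain z where z: "\<And>n. P n (z n)" by metis
    have "z \<longlonglongrightarrow> y"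
    proof (rule Lim_null[THEN iffD2], rule Lim_null_comparison[OF _ norm0])
      show "\<forall>\<^sub>F n in sequentially. norm (z n - y) \<le> (norm u + norm v) * t n"
        using z by (simp add: P_def)
    qed
    moreover have "isCont (G u v) y"
      using smooth_on_continuous[OF smooth_on_frechet[OF smooth_on_frechet[OF U(2), of u], of v]] U
      by (simp add: G_def[abs_def] continuous_on_eq_continuous_at)
    ultimately have "(\<lambda>n. G u v (z n)) \<longlonglongrightarrow> G u v y"
      using isCont_tendsto_compose[of y "G u v" z sequentially] by blast
    moreover have "\<forall>\<^sub>F n in sequentially. (norm u + norm v) * t n < e"
      by (rule order_tendstoD(2)[OF norm0 e(1)])
    then have "\<forall>\<^sub>F n in sequentially. G u v (z n) = \<Delta> (t n) u v / (t n * t n)"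
    proof eventually_elim
      case (elim n)
      then show ?case using z[of n] tpos[of n] by (simp add: P_def)
    qed
    ultimately show ?thesis by (rule Lim_transform_eventually)
  qed
  have "\<Delta> s u v = \<Delta> s v u" for s by (simp add: \<Delta>_def algebra_simps)
  then show ?thesis
    using LIMSEQ_unique[OF lim[of u v]] lim[of v u] by (simp add: G_def)
qed

lemma second_derivative_symmetric:
  fixes f :: "'e::real_normed_vector \<Rightarrow> 'f::euclidean_space"
  assumes U: "open U" "smooth_on f U" "y \<in> U"
  shows "frechet_derivative (\<lambda>z. frechet_derivative f (at z) u) (at y) v =
    frechet_derivative (\<lambda>z. frechet_derivative f (at z) v) (at y) u"
proof (rule euclidean_eqI)
  fix b :: 'f assume "b \<in> Basis"
  have *: "frechet_derivative (\<lambda>z. frechet_derivative (\<lambda>z. f z \<bullet> b) (at z) u) (at y) v =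
    frechet_derivative (\<lambda>z. frechet_derivative f (at z) u) (at y) v \<bullet> b" for u v
  proof -
    have 1: "frechet_derivative (\<lambda>z. f z \<bullet> b) (at z) u = frechet_derivative f (at z) u \<bullet> b" if "z \<in> U" for z
      using frechet_derivative_at[OF has_derivative_inner_left[OF smooth_on_has_derivative[OF U(2) that]]]
      by metis
    have "frechet_derivative (\<lambda>z. frechet_derivative (\<lambda>z. f z \<bullet> b) (at z) u) (at y) v =
       frechet_derivative (\<lambda>z. frechet_derivative f (at z) u \<bullet> b) (at y) v"
      by (subst frechet_derivative_cong_open[OF U(1,3) 1]) auto
    also have "\<dots> = frechet_derivative (\<lambda>z. frechet_derivative f (at z) u) (at y) v \<bullet> b"
      using frechet_derivative_at[OF has_derivative_inner_left[OF smooth_on_has_derivative[OF smooth_on_frechet[OF U(2)] U(3)]]]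
      by metis
    finally show ?thesis .
  qed
  show "frechet_derivative (\<lambda>z. frechet_derivative f (at z) u) (at y) v \<bullet> b =
    frechet_derivative (\<lambda>z. frechet_derivative f (at z) v) (at y) u \<bullet> b"
    using second_derivative_symmetric_real[OF U(1) smooth_on_inner[OF U(1,2)] U(3), of b u v]
    unfolding * .
qed

section \<open>Alternating multilinear maps\<close>

abbreviation del :: "nat \<Rightarrow> 'e list \<Rightarrow> 'e list" where
  "del i vs \<equiv> take i vs @ drop (Suc i) vs"

lemma length_del: "i \<le> k \<Longrightarrow> length vs = Suc k \<Longrightarrow> length (del i vs) = k"
  by auto

lemma nth_del:
  "i \<le> k \<Longrightarrow> length vs = Suc k \<Longrightarrow> m < k \<Longrightarrow> del i vs ! m = (if m < i then vs ! m else vs ! Suc m)"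
  by (auto simp: nth_append)

lemma del_update:
  assumes "i \<le> k" "l \<le> k" "length vs = Suc k"
  shows "del i (vs[l := v]) =
    (if l = i then del i vs else if l < i then (del i vs)[l := v] else (del i vs)[l - 1 := v])"
  using assms by (intro nth_equalityI) (auto simp: nth_append nth_list_update)

lemma map_del: "map f (del i vs) = del i (map f vs)"
  by (simp add: take_map drop_map)

lemma split_at_two:
  assumes "i < j" "j < length vs"
  obtains xs ys zs where "vs = xs @ vs ! i # ys @ vs ! j # zs" "length xs = i" "length ys = j - i - 1"
proof -
  have a: "vs = take i vs @ vs ! i # drop (Suc i) vs"
    using assms by (simp add: id_take_nth_drop)
  let ?d = "drop (Suc i) vs"
  have "?d = take (j - i - 1) ?d @ ?d ! (j - i - 1) # drop (Suc (j - i - 1)) ?d"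
    using assms by (intro id_take_nth_drop) auto
  moreover have "?d ! (j - i - 1) = vs ! j" using assms by simp
  ultimately show thesis using a assms
    by (intro that[of "take i vs" "take (j - i - 1) ?d" "drop (Suc (j - i - 1)) ?d"]) (auto simp: min_def)
qed

lemma multilinearD:
  "multilinear k \<theta> \<Longrightarrow> length vs = k \<Longrightarrow> i < k \<Longrightarrow> linear (\<lambda>v. \<theta> (vs[i := v]))"
  by (simp add: multilinear_def)

lemma multilinear_append:
  assumes "multilinear k \<theta>" "length xs + length zs + 1 = k"
  shows "linear (\<lambda>v. \<theta> (xs @ v # zs))"
  using multilinearD[OF assms(1), of "xs @ 0 # zs" "length xs"] assms(2)
  by (simp add: list_update_append)

lemma multilinear_head: "multilinear (Suc k) \<theta> \<Longrightarrow> length vs = k \<Longrightarrow> linear (\<lambda>v. \<theta> (v # vs))"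
  using multilinear_append[of "Suc k" \<theta> "[]" vs] by simp

lemma multilinear_tail:
  fixes \<theta> :: "(real^'n::finite) list \<Rightarrow> real"
  shows "multilinear (Suc k) \<theta> \<Longrightarrow> multilinear k (\<lambda>vs. \<theta> (v # vs))"
  unfolding multilinear_def
proof (intro allI impI)
  fix vs :: "(real^'n) list" and i
  assume a: "\<forall>vs i. length vs = Suc k \<and> i < Suc k \<longrightarrow> linear (\<lambda>v. \<theta> (vs[i := v]))" and b: "length vs = k \<and> i < k"
  from a[rule_format, of "v # vs" "Suc i"] b show "linear (\<lambda>va. \<theta> (v # vs[i := va]))" by simp
qed

lemma alternating_tail:
  fixes \<theta> :: "(real^'n::finite) list \<Rightarrow> real"
  shows "alternating (Suc k) \<theta> \<Longrightarrow> alternating k (\<lambda>vs. \<theta> (v # vs))"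
  unfolding alternating_def
proof (intro allI impI)
  fix vs :: "(real^'n) list" and i j
  assume a: "\<forall>vs i j. length vs = Suc k \<and> i < j \<and> j < Suc k \<and> vs ! i = vs ! j \<longrightarrow> \<theta> vs = 0"
    and b: "length vs = k \<and> i < j \<and> j < k \<and> vs ! i = vs ! j"
  from a[rule_format, of "v # vs" "Suc i" "Suc j"] b show "\<theta> (v # vs) = 0" by simp
qed

lemma alternatingD:
  "alternating k \<theta> \<Longrightarrow> length vs = k \<Longrightarrow> i < j \<Longrightarrow> j < k \<Longrightarrow> vs ! i = vs ! j \<Longrightarrow> \<theta> vs = 0"
  by (auto simp: alternating_def)

lemma alternating_swap:
  assumes "multilinear k \<theta>" "alternating k \<theta>" "length xs + length zs + 2 = k"
  shows "\<theta> (xs @ a # b # zs) = - \<theta> (xs @ b # a # zs)"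
proof -
  have z: "\<theta> (xs @ c # c # zs) = 0" for c
    using assms(3) by (intro alternatingD[OF assms(2), of _ "length xs" "Suc (length xs)"]) (auto simp: nth_append)
  have 1: "\<theta> (xs @ (u + v) # w # zs) = \<theta> (xs @ u # w # zs) + \<theta> (xs @ v # w # zs)" for u v w
    using linear_add[OF multilinear_append[OF assms(1), of xs "w # zs"]] assms(3) by simp
  have 2: "\<theta> (xs @ w # (u + v) # zs) = \<theta> (xs @ w # u # zs) + \<theta> (xs @ w # v # zs)" for u v w
    using linear_add[OF multilinear_append[OF assms(1), of "xs @ [w]" "zs"]] assms(3) by simp
  show ?thesis using z[of "a + b"] z[of a] z[of b] by (simp add: 1 2)
qed

text \<open>Moving an entry past \<open>length ys\<close> others costs one transposition for each of them.\<close>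

lemma alternating_move:
  assumes "multilinear k \<theta>" "alternating k \<theta>" "length xs + length ys + length zs + 1 = k"
  shows "\<theta> (xs @ a # ys @ zs) = (-1) ^ length ys * \<theta> (xs @ ys @ a # zs)"
  using assms(3)
proof (induction ys arbitrary: xs)
  case (Cons y ys)
  have "\<theta> (xs @ a # (y # ys) @ zs) = - \<theta> ((xs @ [y]) @ a # ys @ zs)"
    using alternating_swap[OF assms(1,2), of xs "ys @ zs" a y] Cons.prems by simp
  also have "\<dots> = - ((-1) ^ length ys * \<theta> ((xs @ [y]) @ ys @ a # zs))"
    using Cons.IH[of "xs @ [y]"] Cons.prems by simp
  finally show ?case by simp
qed simp

lemma alternating_head_to_slot:
  assumes "multilinear k \<theta>" "alternating k \<theta>" "length vs = k" "i < k"
  shows "\<theta> (u # del i vs) = (-1) ^ i * \<theta> (vs[i := u])"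
  using alternating_move[OF assms(1,2), of "[]" "take i vs" "drop (Suc i) vs" u] assms(3,4)
  by (simp add: upd_conv_take_nth_drop min_def)

text \<open>The mechanism behind the exterior derivative being alternating. When two arguments coincide, all
  terms that keep both of them vanish, and the two terms that omit one of them differ by the sign of
  moving the other one into its place.\<close>

lemma alternating_antisym:
  assumes "\<And>u. multilinear k (Q u)" "\<And>u. alternating k (Q u)"
    "length vs = Suc k" "i < j" "j \<le> k" "vs ! i = vs ! j"
  shows "(\<Sum>l\<le>k. (-1) ^ l * Q (vs ! l) (del l vs)) = (0::real)"
proof -
  let ?t = "\<lambda>l. (-1) ^ l * Q (vs ! l) (del l vs)"
  have z: "?t l = 0" if "l \<le> k" "l \<noteq> i" "l \<noteq> j" for l
  proof -
    have "Q (vs ! l) (del l vs) = 0"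
    proof (rule alternatingD[OF assms(2)])
      show "length (del l vs) = k" using that assms by auto
      show "(if i < l then i else i - 1) < (if j < l then j else j - 1)" using that assms by auto
      show "(if j < l then j else j - 1) < k" using that assms by auto
      show "del l vs ! (if i < l then i else i - 1) = del l vs ! (if j < l then j else j - 1)"
        using that assms by (subst (1 2) nth_del[of l k]) auto
    qed
    then show ?thesis by simp
  qed
  have "(\<Sum>l\<le>k. ?t l) = (\<Sum>l\<in>{i, j}. ?t l)"
    using assms z by (intro sum.mono_neutral_right) auto
  also have "\<dots> = ?t i + ?t j" using assms by simp
  also have "\<dots> = 0"
  proof -
    obtain xs ys zs where s: "vs = xs @ vs ! i # ys @ vs ! j # zs" "length xs = i" "length ys = j - i - 1"
      using split_at_two[of i j vs] assms by auto
    define a where "a = vs ! j"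
    have vs: "vs = xs @ a # ys @ a # zs" using s(1) assms(6) by (simp add: a_def)
    have len: "length xs + length ys + length zs + 1 = k" using arg_cong[OF s(1), of length] assms(3) by simp
    have di: "del i vs = xs @ ys @ a # zs" unfolding vs using s(2) by simp
    have dj: "del j vs = xs @ a # ys @ zs" unfolding vs using s(2,3) assms(4) by (cases "j - i") (auto simp: Suc_diff_le)
    have j: "j = Suc (i + length ys)" using s assms by simp
    show ?thesis
      unfolding di dj assms(6) alternating_move[OF assms(1,2) len] by (simp add: j power_add)
  qed
  finally show ?thesis .
qed

text \<open>This is why the exterior derivative is independent of the chart: the second derivative of a
  coordinate change enters as a symmetric \<open>S\<close>, and its contributions cancel in pairs.
  Here \<open>vs\<close> are the components in one chart, in which \<open>S\<close> is computed, and
  \<open>us\<close> those in the other.\<close>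

lemma symmetric_substitution_sum:
  fixes \<theta> :: "(real^'n::finite) list \<Rightarrow> real" and us :: "(real^'n) list" and vs :: "'b list"
  assumes "multilinear k \<theta>" "alternating k \<theta>" "length us = Suc k" "length vs = Suc k" and S: "\<And>u v. S u v = S v u"
  shows "(\<Sum>i\<le>k. (-1) ^ i * (\<Sum>j<k. \<theta> ((del i us)[j := S (vs ! i) (del i vs ! j)]))) = 0"
proof -
  define a where "a i j = (-1) ^ i * \<theta> ((del i us)[j := S (vs ! i) (del i vs ! j)])" for i j
  let ?A = "{(i, j). i \<le> k \<and> j < k \<and> i \<le> j}" and ?B = "{(i, j). i \<le> k \<and> j < k \<and> j < i}"
  have fin: "finite ?A" "finite ?B"
    by (rule finite_subset[of _ "{..k} \<times> {..<k}"]; auto)+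
  have "(\<Sum>i\<le>k. (-1) ^ i * (\<Sum>j<k. \<theta> ((del i us)[j := S (vs ! i) (del i vs ! j)]))) =
      (\<Sum>i\<le>k. \<Sum>j<k. a i j)" by (simp add: a_def sum_distrib_left)
  also have "\<dots> = (\<Sum>(i, j)\<in>{..k} \<times> {..<k}. a i j)" by (simp add: sum.cartesian_product)
  also have "{..k} \<times> {..<k} = ?A \<union> ?B" by auto
  also have "(\<Sum>(i, j)\<in>?A \<union> ?B. a i j) = (\<Sum>(i, j)\<in>?A. a i j) + (\<Sum>(i, j)\<in>?B. a i j)"
    by (rule sum.union_disjoint[OF fin]) auto
  \<comment> \<open>the two orders in which a pair of arguments enters \<open>S\<close> are the index pairs
    \<open>(i, j)\<close> and \<open>(Suc j, i)\<close>\<close>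
  also have "(\<Sum>(i, j)\<in>?B. a i j) = (\<Sum>(i, j)\<in>?A. a (Suc j) i)"
    by (rule sum.reindex_bij_witness[where i="\<lambda>(i, j). (Suc j, i)" and j="\<lambda>(i, j). (j, i - 1)"]) auto
  also have "(\<Sum>(i, j)\<in>?A. a i j) + (\<Sum>(i, j)\<in>?A. a (Suc j) i) = (\<Sum>(i, j)\<in>?A. a i j + a (Suc j) i)"
    by (simp add: sum.distrib split_def)
  also have "\<dots> = 0"
  proof (intro sum.neutral ballI, clarify)
    fix i j assume ij: "i \<le> k" "j < k" "i \<le> j"
    obtain xs ys zs where s: "us = xs @ us ! i # ys @ us ! Suc j # zs" "length xs = i" "length ys = Suc j - i - 1"
      using split_at_two[of i "Suc j" us] assms ij by auto
    define u v where "u = us ! i" and "v = us ! Suc j"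
    have us: "us = xs @ u # ys @ v # zs" using s(1) by (simp add: u_def v_def)
    have len: "length xs + length ys + length zs + 1 = k" using arg_cong[OF s(1), of length] assms(3) by simp
    have d1: "del i us = xs @ ys @ v # zs" unfolding us using s(2) by simp
    have d2: "del (Suc j) us = xs @ u # ys @ zs" unfolding us using s(2,3) ij by (simp add: Suc_diff_le)
    have j: "j = i + length ys" using s ij by simp
    have e1: "del i vs ! j = vs ! Suc j" and e2: "del (Suc j) vs ! i = vs ! i"
      using nth_del[of i k vs j] nth_del[of "Suc j" k vs i] ij assms(4) by auto
    have u1: "(del i us)[j := w] = xs @ ys @ w # zs" and u2: "(del (Suc j) us)[i := w] = xs @ w # ys @ zs" for w
      unfolding d1 d2 using s(2) j by (auto simp: list_update_append)
    show "a i j + a (Suc j) i = 0"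
      unfolding a_def e1 e2 u1 u2 alternating_move[OF assms(1,2) len]
      using S[of "vs ! i" "vs ! Suc j"] by (simp add: j power_add flip: power_mult_distrib)
  qed
  finally show ?thesis .
qed

lemma linear_basis_expansion:
  fixes f :: "'e::euclidean_space \<Rightarrow> real"
  assumes "linear f" shows "f w = (\<Sum>b\<in>Basis. (w \<bullet> b) * f b)"
proof -
  have "f w = f (\<Sum>b\<in>Basis. (w \<bullet> b) *\<^sub>R b)" by (simp add: euclidean_representation)
  also have "\<dots> = (\<Sum>b\<in>Basis. (w \<bullet> b) * f b)"
    using assms by (simp add: linear_sum linear_cmul)
  finally show ?thesis .
qed

lemma multilinear_head_expansion:
  assumes "multilinear (Suc k) \<theta>" "length vs = k"
  shows "\<theta> (w # vs) = (\<Sum>b\<in>Basis. (w \<bullet> b) * \<theta> (b # vs))"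
  using linear_basis_expansion[OF multilinear_head[OF assms]] .

text \<open>The product rule for a multilinear map that depends on the base point, all slots moving at once.
  Expanding the first slot in the standard basis reduces the number of slots by one.\<close>

lemma multilinear_has_derivative:
  fixes \<Theta> :: "'e::real_normed_vector \<Rightarrow> (real^'n::finite) list \<Rightarrow> real" and Y :: "'x::real_normed_vector \<Rightarrow> 'e"
  assumes "list_all2 (\<lambda>W W'. (W has_derivative W') (at x)) Ws Ws'" "length Ws = k"
    and U: "open U" "Y x \<in> U" and Y: "(Y has_derivative Y') (at x)"
    and "\<And>z. z \<in> U \<Longrightarrow> multilinear k (\<Theta> z)"
    and "\<And>vs. length vs = k \<Longrightarrow> (\<lambda>z. \<Theta> z vs) differentiable (at (Y x))"
  shows "((\<lambda>s. \<Theta> (Y s) (map (\<lambda>W. W s) Ws)) has_derivative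
    (\<lambda>h. frechet_derivative (\<lambda>z. \<Theta> z (map (\<lambda>W. W x) Ws)) (at (Y x)) (Y' h) +
      (\<Sum>i<k. \<Theta> (Y x) ((map (\<lambda>W. W x) Ws)[i := (Ws' ! i) h])))) (at x)"
  using assms(1,2,6,7)
proof (induction Ws Ws' arbitrary: k \<Theta> rule: list_all2_induct)
  case Nil
  then have "(\<lambda>z. \<Theta> z []) differentiable (at (Y x))" by simp
  then have "((\<lambda>z. \<Theta> z []) has_derivative frechet_derivative (\<lambda>z. \<Theta> z []) (at (Y x))) (at (Y x))"
    using frechet_derivative_works by blast
  from has_derivative_compose[OF Y this] show ?case using Nil by simp
next
  case (Cons W Ws W' Ws')
  then obtain j where k: "k = Suc j" "length Ws = j" by (cases k) auto
  let ?m = "map (\<lambda>W. W x) Ws"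
  have IH: "((\<lambda>s. \<Theta> (Y s) (b # map (\<lambda>W. W s) Ws)) has_derivative
    (\<lambda>h. frechet_derivative (\<lambda>z. \<Theta> z (b # ?m)) (at (Y x)) (Y' h) +
      (\<Sum>i<j. \<Theta> (Y x) (b # ?m[i := (Ws' ! i) h])))) (at x)" for b
    using Cons.prems k by (intro Cons.IH[where \<Theta>="\<lambda>z vs. \<Theta> z (b # vs)"]) (auto intro: multilinear_tail)
  have "((\<lambda>s. \<Sum>b\<in>Basis. (W s \<bullet> b) * \<Theta> (Y s) (b # map (\<lambda>W. W s) Ws)) has_derivative
    (\<lambda>h. \<Sum>b\<in>Basis. (W x \<bullet> b) * (frechet_derivative (\<lambda>z. \<Theta> z (b # ?m)) (at (Y x)) (Y' h) +
      (\<Sum>i<j. \<Theta> (Y x) (b # ?m[i := (Ws' ! i) h]))) + (W' h \<bullet> b) * \<Theta> (Y x) (b # ?m))) (at x)"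
    by (intro has_derivative_sum has_derivative_mult[OF has_derivative_inner_left[OF Cons.hyps(1)] IH])
  moreover have ex: "\<Theta> (Y s) (w # vs) = (\<Sum>b\<in>Basis. (w \<bullet> b) * \<Theta> (Y s) (b # vs))"
    if "Y s \<in> U" "length vs = j" for s w vs
    using multilinear_head_expansion[OF Cons.prems(2)[OF that(1), unfolded k(1)] that(2)] .
  moreover have "\<forall>\<^sub>F s in at x. Y s \<in> U"
    using has_derivative_continuous[OF Y] U by (simp add: continuous_within topological_tendstoD)
  then have "\<forall>\<^sub>F s in at x. (\<Sum>b\<in>Basis. (W s \<bullet> b) * \<Theta> (Y s) (b # map (\<lambda>W. W s) Ws)) =
      \<Theta> (Y s) (map (\<lambda>W. W s) (W # Ws))"
  proof eventually_elim
    case (elim s)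
    show ?case using ex[OF elim, of "map (\<lambda>W. W s) Ws" "W s"] k by simp
  qed
  ultimately have D: "((\<lambda>s. \<Theta> (Y s) (map (\<lambda>W. W s) (W # Ws))) has_derivative
    (\<lambda>h. \<Sum>b\<in>Basis. (W x \<bullet> b) * (frechet_derivative (\<lambda>z. \<Theta> z (b # ?m)) (at (Y x)) (Y' h) +
      (\<Sum>i<j. \<Theta> (Y x) (b # ?m[i := (Ws' ! i) h]))) + (W' h \<bullet> b) * \<Theta> (Y x) (b # ?m))) (at x)"
    using U(2) k by (elim has_derivative_transform_eventually) auto
  have F: "(\<Sum>b\<in>Basis. (W x \<bullet> b) * frechet_derivative (\<lambda>z. \<Theta> z (b # ?m)) (at (Y x)) v) =
      frechet_derivative (\<lambda>z. \<Theta> z (W x # ?m)) (at (Y x)) v" for v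
  proof -
    have "((\<lambda>z. \<Sum>b\<in>Basis. (W x \<bullet> b) * \<Theta> z (b # ?m)) has_derivative
      (\<lambda>v. \<Sum>b\<in>Basis. (W x \<bullet> b) * frechet_derivative (\<lambda>z. \<Theta> z (b # ?m)) (at (Y x)) v)) (at (Y x))"
      using Cons.prems(3) k
      by (intro has_derivative_sum has_derivative_mult_right frechet_derivative_works[THEN iffD1]) auto
    then have "((\<lambda>z. \<Theta> z (W x # ?m)) has_derivative
      (\<lambda>v. \<Sum>b\<in>Basis. (W x \<bullet> b) * frechet_derivative (\<lambda>z. \<Theta> z (b # ?m)) (at (Y x)) v)) (at (Y x))"
      by (rule has_derivative_transform_within_open[OF _ U])
        (use multilinear_head_expansion[OF Cons.prems(2)[unfolded k(1)], of _ ?m "W x"] k in auto)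
    from frechet_derivative_at[OF this] show ?thesis by (rule fun_cong)
  qed
  have "(\<Sum>b\<in>Basis. (W x \<bullet> b) * (frechet_derivative (\<lambda>z. \<Theta> z (b # ?m)) (at (Y x)) (Y' h) +
      (\<Sum>i<j. \<Theta> (Y x) (b # ?m[i := (Ws' ! i) h]))) + (W' h \<bullet> b) * \<Theta> (Y x) (b # ?m)) =
     frechet_derivative (\<lambda>z. \<Theta> z (W x # ?m)) (at (Y x)) (Y' h) +
      (\<Sum>i<j. \<Theta> (Y x) (W x # ?m[i := (Ws' ! i) h])) + \<Theta> (Y x) (W' h # ?m)" for h
  proof -
    have "(\<Sum>i<j. \<Theta> (Y x) (W x # ?m[i := (Ws' ! i) h])) =
      (\<Sum>b\<in>Basis. (W x \<bullet> b) * (\<Sum>i<j. \<Theta> (Y x) (b # ?m[i := (Ws' ! i) h])))"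
      using ex[OF U(2), of _ "W x"] k by (simp add: sum_distrib_left sum.swap[of _ Basis])
    moreover have "\<Theta> (Y x) (W' h # ?m) = (\<Sum>b\<in>Basis. (W' h \<bullet> b) * \<Theta> (Y x) (b # ?m))"
      using ex[OF U(2), of ?m "W' h"] k by simp
    ultimately show ?thesis by (simp add: F[symmetric] sum.distrib distrib_left)
  qed
  then show ?case
    using D by (simp add: k(1) sum.lessThan_Suc_shift add.assoc add.commute[of "sum _ _"] del: sum.lessThan_Suc)
qed

lemma multilinear_tendsto:
  fixes \<Theta> :: "'e::topological_space \<Rightarrow> (real^'n::finite) list \<Rightarrow> real"
  assumes "list_all2 (\<lambda>W l. (W \<longlongrightarrow> l) F) Ws ls" "length Ws = k"
    and "\<And>z. z \<in> U \<Longrightarrow> multilinear k (\<Theta> z)"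
    and "\<And>vs. length vs = k \<Longrightarrow> ((\<lambda>s. \<Theta> (Y s) vs) \<longlongrightarrow> \<Theta> y vs) F"
    and Y: "\<And>s. Y s \<in> U" "y \<in> U"
  shows "((\<lambda>s. \<Theta> (Y s) (map (\<lambda>W. W s) Ws)) \<longlongrightarrow> \<Theta> y ls) F"
  using assms(1-4)
proof (induction Ws ls arbitrary: k \<Theta> rule: list_all2_induct)
  case Nil
  then show ?case by simp
next
  case (Cons W Ws l ls)
  then obtain j where k: "k = Suc j" "length Ws = j" "length ls = j"
    by (cases k) (auto dest: list_all2_lengthD)
  have IH: "((\<lambda>s. \<Theta> (Y s) (b # map (\<lambda>W. W s) Ws)) \<longlongrightarrow> \<Theta> y (b # ls)) F" for b
    using Cons.prems k by (intro Cons.IH[where \<Theta>="\<lambda>z vs. \<Theta> z (b # vs)"]) (auto intro: multilinear_tail)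
  have ex: "\<Theta> z (w # vs) = (\<Sum>b\<in>Basis. (w \<bullet> b) * \<Theta> z (b # vs))" if "z \<in> U" "length vs = j" for z w vs
    using multilinear_head_expansion[OF Cons.prems(2)[OF that(1), unfolded k(1)] that(2)] .
  have "((\<lambda>s. \<Sum>b\<in>Basis. (W s \<bullet> b) * \<Theta> (Y s) (b # map (\<lambda>W. W s) Ws)) \<longlongrightarrow>
     (\<Sum>b\<in>Basis. (l \<bullet> b) * \<Theta> y (b # ls))) F"
    by (intro tendsto_intros IH Cons.hyps)
  moreover have "\<Theta> (Y s) (map (\<lambda>W. W s) (W # Ws)) = (\<Sum>b\<in>Basis. (W s \<bullet> b) * \<Theta> (Y s) (b # map (\<lambda>W. W s) Ws))" for s
    using ex[OF Y(1), of "map (\<lambda>W. W s) Ws" s "W s"] k by simp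
  moreover have "\<Theta> y (l # ls) = (\<Sum>b\<in>Basis. (l \<bullet> b) * \<Theta> y (b # ls))"
    using ex[OF Y(2), of ls l] k by simp
  ultimately show ?case by simp
qed

text \<open>A multilinear map on bounded arguments is controlled by its values on basis vectors; this compares
  values on planes with the seminorms of the form topology.\<close>

lemma multilinear_bound:
  fixes \<theta> :: "(real^'n::finite) list \<Rightarrow> real"
  assumes "multilinear k \<theta>" "length ws = k" "\<And>w. w \<in> set ws \<Longrightarrow> norm w \<le> R" "0 \<le> R"
  shows "\<bar>\<theta> ws\<bar> \<le> R ^ k * (\<Sum>bs | set bs \<subseteq> Basis \<and> length bs = k. \<bar>\<theta> bs\<bar>)"
  using assms
proof (induction k arbitrary: ws \<theta>)
  case 0
  have "{bs::(real^'n) list. set bs \<subseteq> Basis \<and> length bs = 0} = {[]}" by auto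
  then show ?case using 0 by simp
next
  case (Suc k)
  then obtain w vs where ws: "ws = w # vs" "length vs = k" by (cases ws) auto
  let ?L = "\<lambda>k. {bs::(real^'n) list. set bs \<subseteq> Basis \<and> length bs = k}"
  have "\<bar>\<theta> ws\<bar> \<le> (\<Sum>b\<in>Basis. \<bar>(w \<bullet> b) * \<theta> (b # vs)\<bar>)"
    unfolding ws(1) multilinear_head_expansion[OF Suc.prems(1) ws(2), of w] by (rule sum_abs)
  also have "\<dots> \<le> (\<Sum>b\<in>Basis. R * (R ^ k * (\<Sum>bs\<in>?L k. \<bar>\<theta> (b # bs)\<bar>)))"
  proof (rule sum_mono)
    fix b :: "real^'n" assume b: "b \<in> Basis"
    have "\<bar>w \<bullet> b\<bar> \<le> R" using Basis_le_norm[OF b, of w] Suc.prems(3)[of w] ws by simp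
    moreover have "\<bar>\<theta> (b # vs)\<bar> \<le> R ^ k * (\<Sum>bs\<in>?L k. \<bar>\<theta> (b # bs)\<bar>)"
      using Suc.prems ws by (intro Suc.IH[where \<theta>="\<lambda>vs. \<theta> (b # vs)"]) (auto intro: multilinear_tail)
    ultimately show "\<bar>(w \<bullet> b) * \<theta> (b # vs)\<bar> \<le> R * (R ^ k * (\<Sum>bs\<in>?L k. \<bar>\<theta> (b # bs)\<bar>))"
      unfolding abs_mult using Suc.prems(4) by (intro mult_mono) auto
  qed
  also have "\<dots> = R ^ Suc k * (\<Sum>b\<in>Basis. \<Sum>bs\<in>?L k. \<bar>\<theta> (b # bs)\<bar>)"
    by (simp add: sum_distrib_left mult.assoc)
  also have "(\<Sum>b\<in>Basis. \<Sum>bs\<in>?L k. \<bar>\<theta> (b # bs)\<bar>) = (\<Sum>bs\<in>?L (Suc k). \<bar>\<theta> bs\<bar>)"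
    unfolding sum.cartesian_product
    by (rule sum.reindex_bij_witness[where i="\<lambda>bs. (hd bs, tl bs)" and j="\<lambda>(b, bs). b # bs"])
      (auto simp: length_Suc_conv)
  finally show ?case .
qed

section \<open>Gram determinants and orthonormalization\<close>

definition inner_form :: "(real^'n::finite \<Rightarrow> real^'n \<Rightarrow> real) \<Rightarrow> bool" where
  "inner_form G \<longleftrightarrow> (\<forall>v. linear (G v)) \<and> (\<forall>v w. G v w = G w v) \<and> (\<forall>v. v \<noteq> 0 \<longrightarrow> G v v > 0)"

lemma inner_form_linear_left: "inner_form G \<Longrightarrow> linear (\<lambda>v. G v w)"
proof -
  assume G: "inner_form G"
  then have "(\<lambda>v. G v w) = G w" by (auto simp: inner_form_def)
  then show ?thesis using G by (simp add: inner_form_def)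
qed

text \<open>Gram-Schmidt. Subtracting from \<open>v\<close> its projections onto the other vectors only adds
  terms with a repeated argument, so no alternating map notices.\<close>

lemma orthogonalize:
  fixes vs :: "(real^'n::finite) list"
  assumes "inner_form G"
  shows "\<exists>us. length us = length vs \<and>
    (\<forall>i<length vs. \<forall>j<length vs. i \<noteq> j \<longrightarrow> G (us ! i) (us ! j) = 0) \<and>
    (\<forall>\<theta>. multilinear (length vs) \<theta> \<and> alternating (length vs) \<theta> \<longrightarrow> \<theta> vs = \<theta> us)"
proof (induction vs)
  case (Cons v vs)
  let ?k = "length vs"
  from Cons obtain us where us: "length us = ?k"
    "\<And>i j. i < ?k \<Longrightarrow> j < ?k \<Longrightarrow> i \<noteq> j \<Longrightarrow> G (us ! i) (us ! j) = 0"
    "\<And>\<theta>. multilinear ?k \<theta> \<Longrightarrow> alternating ?k \<theta> \<Longrightarrow> \<theta> vs = \<theta> us" by metis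
  have lin: "linear (G w)" and sym: "G v w = G w v" and pos: "v \<noteq> 0 \<Longrightarrow> G v v > 0" for v w
    using assms by (auto simp: inner_form_def)
  \<comment> \<open>for \<open>us ! i = 0\<close> the quotient is zero, which is the right coefficient as well\<close>
  define c where "c i = G v (us ! i) / G (us ! i) (us ! i)" for i
  define v' where "v' = v - (\<Sum>i<?k. c i *\<^sub>R (us ! i))"
  have orth: "G (us ! j) v' = 0" if j: "j < ?k" for j
  proof -
    have "G (us ! j) v' = G (us ! j) v - (\<Sum>i<?k. c i * G (us ! j) (us ! i))"
      unfolding v'_def by (simp add: linear_diff[OF lin] linear_sum[OF lin] linear_cmul[OF lin])
    also have "(\<Sum>i<?k. c i * G (us ! j) (us ! i)) = (\<Sum>i<?k. if i = j then c j * G (us ! j) (us ! j) else 0)"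
      using us(2) j by (intro sum.cong) auto
    also have "\<dots> = c j * G (us ! j) (us ! j)" using j by simp
    also have "\<dots> = G v (us ! j)"
    proof (cases "us ! j = 0")
      case True
      then show ?thesis using linear_0[OF lin] by simp
    next
      case False
      then show ?thesis using pos[of "us ! j"] by (simp add: c_def)
    qed
    finally show ?thesis using sym[of v] by simp
  qed
  show ?case
  proof (intro exI[of _ "v' # us"] conjI allI impI)
    fix i j assume "i < length (v # vs)" "j < length (v # vs)" "i \<noteq> j"
    then show "G ((v' # us) ! i) ((v' # us) ! j) = 0"
      using us(2) orth sym[of v'] by (cases i; cases j) auto
  next
    fix \<theta> :: "(real^'n) list \<Rightarrow> real"
    assume "multilinear (length (v # vs)) \<theta> \<and> alternating (length (v # vs)) \<theta>"
    then have m: "multilinear (Suc ?k) \<theta>" and a: "alternating (Suc ?k) \<theta>" by auto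
    have l: "linear (\<lambda>v. \<theta> (v # us))" using multilinear_head[OF m] us(1) by simp
    have "\<theta> (us ! i # us) = 0" if "i < ?k" for i
      using that us(1) by (intro alternatingD[OF a, of _ 0 "Suc i"]) auto
    then have "\<theta> (v' # us) = \<theta> (v # us)"
      unfolding v'_def by (simp add: linear_diff[OF l] linear_sum[OF l] linear_cmul[OF l])
    moreover have "\<theta> (v # vs) = \<theta> (v # us)"
      using us(3) multilinear_tail[OF m] alternating_tail[OF a] by blast
    ultimately show "\<theta> (v # vs) = \<theta> (v' # us)" by simp
  qed (use us in auto)
qed simp

definition gram :: "(real^'n::finite \<Rightarrow> real^'n \<Rightarrow> real) \<Rightarrow> (real^'n) list \<Rightarrow> (real^'n) list \<Rightarrow> real" where
  "gram G vs ws = (\<Sum>\<sigma> | \<sigma> permutes {..<length vs}.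
     of_int (sign \<sigma>) * (\<Prod>i<length vs. G (vs ! i) (ws ! \<sigma> i)))"

lemma gram_sym:
  assumes "\<And>v w. G v w = G w v" "length vs = length ws"
  shows "gram G vs ws = gram G ws vs"
proof -
  have "gram G vs ws = (\<Sum>\<sigma> | \<sigma> permutes {..<length vs}.
     of_int (sign (inv \<sigma>)) * (\<Prod>i<length vs. G (vs ! i) (ws ! inv \<sigma> i)))"
    unfolding gram_def by (rule sum_permutations_inverse)
  also have "\<dots> = gram G ws vs"
    unfolding gram_def assms(2)
  proof (rule sum.cong, simp, clarify)
    fix \<sigma> assume s: "\<sigma> permutes {..<length ws}"
    have "(\<Prod>i<length ws. G (vs ! i) (ws ! inv \<sigma> i)) = (\<Prod>i<length ws. G (vs ! \<sigma> i) (ws ! inv \<sigma> (\<sigma> i)))"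
      using prod.permute[OF s, of "\<lambda>i. G (vs ! i) (ws ! inv \<sigma> i)"] by (simp add: o_def)
    also have "\<dots> = (\<Prod>i<length ws. G (ws ! i) (vs ! \<sigma> i))"
      using permutes_inverses(2)[OF s] assms(1) by simp
    finally show "of_int (sign (inv \<sigma>)) * (\<Prod>i<length ws. G (vs ! i) (ws ! inv \<sigma> i)) =
      of_int (sign \<sigma>) * (\<Prod>i<length ws. G (ws ! i) (vs ! \<sigma> i))"
      using s sign_inverse[of \<sigma>] permutes_imp_permutation[of "{..<length ws}" \<sigma>] by simp
  qed
  finally show ?thesis .
qed

lemma gram_multilinear:
  fixes ws :: "(real^'n::finite) list"
  assumes "inner_form G"
  shows "multilinear k (\<lambda>vs. gram G vs ws)"
  unfolding multilinear_def
proof (intro allI impI)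
  fix vs :: "(real^'n) list" and i assume a: "length vs = k \<and> i < k"
  have "gram G (vs[i := v]) ws = (\<Sum>\<sigma> | \<sigma> permutes {..<k}.
     (of_int (sign \<sigma>) * (\<Prod>l\<in>{..<k} - {i}. G (vs ! l) (ws ! \<sigma> l))) * G v (ws ! \<sigma> i))" for v
    unfolding gram_def using a by (auto simp: prod.remove[of "{..<k}" i] intro!: sum.cong prod.cong)
  moreover have "linear (\<lambda>v. \<Sum>\<sigma> | \<sigma> permutes {..<k}.
     (of_int (sign \<sigma>) * (\<Prod>l\<in>{..<k} - {i}. G (vs ! l) (ws ! \<sigma> l))) * G v (ws ! \<sigma> i))"
    by (intro linear_compose_sum ballI linear_compose[OF inner_form_linear_left[OF assms], unfolded o_def] linear_times)
  ultimately show "linear (\<lambda>v. gram G (vs[i := v]) ws)" by simp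
qed

text \<open>Composing with the transposition of the two equal entries permutes the summands and reverses their
  signs.\<close>

lemma gram_alternating:
  fixes ws :: "(real^'n::finite) list"
  shows "alternating k (\<lambda>vs. gram G vs ws)"
  unfolding alternating_def
proof (intro allI impI)
  fix vs :: "(real^'n) list" and i j assume a: "length vs = k \<and> i < j \<and> j < k \<and> vs ! i = vs ! j"
  let ?t = "Transposition.transpose i j" and ?f = "\<lambda>\<sigma>::nat \<Rightarrow> nat. of_int (sign \<sigma>) * (\<Prod>l<k. G (vs ! l) (ws ! \<sigma> l))"
  have t: "?t permutes {..<k}" using a by (intro permutes_swap_id) auto
  have "gram G vs ws = (\<Sum>\<sigma> | \<sigma> permutes {..<k}. ?f \<sigma>)" using a by (simp add: gram_def)
  also have "\<dots> = (\<Sum>\<sigma> | \<sigma> permutes {..<k}. ?f (\<sigma> \<circ> ?t))"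
    by (rule sum_permutations_compose_right[OF t])
  also have "\<dots> = (\<Sum>\<sigma> | \<sigma> permutes {..<k}. - ?f \<sigma>)"
  proof (rule sum.cong, simp, clarify)
    fix \<sigma> assume s: "\<sigma> permutes {..<k}"
    have "sign (\<sigma> \<circ> ?t) = - sign \<sigma>"
      using permutes_imp_permutation[OF _ s] permutes_imp_permutation[OF _ t] a
      by (simp add: sign_compose sign_swap_id)
    moreover have "(\<Prod>l<k. G (vs ! l) (ws ! (\<sigma> \<circ> ?t) l)) = (\<Prod>l<k. G (vs ! ?t l) (ws ! (\<sigma> \<circ> ?t) (?t l)))"
      using prod.permute[OF t, of "\<lambda>l. G (vs ! l) (ws ! (\<sigma> \<circ> ?t) l)"] by (simp add: o_def)
    moreover have "vs ! ?t l = vs ! l" for l using a by (auto simp: Transposition.transpose_def)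
    ultimately show "?f (\<sigma> \<circ> ?t) = - ?f \<sigma>" by simp
  qed
  also have "\<dots> = - gram G vs ws" using a by (simp add: gram_def sum_negf)
  finally show "gram G vs ws = 0" by simp
qed

lemma permutes_moves_another:
  assumes "\<sigma> permutes S" "\<sigma> \<noteq> id" "i \<in> S"
  shows "\<exists>k\<in>S - {i}. \<sigma> k \<noteq> k"
proof (rule ccontr)
  assume "\<not> ?thesis"
  then have "\<And>k. k \<noteq> i \<Longrightarrow> \<sigma> k = k" using assms(1) by (auto simp: permutes_def)
  then have "\<sigma> permutes {i}" using assms(1) by (auto simp: permutes_def)
  then show False using assms(2) by (simp add: id_def)
qed

lemma gram_orthogonal:
  assumes "\<And>i j. i < length us \<Longrightarrow> j < length us \<Longrightarrow> i \<noteq> j \<Longrightarrow> G (us ! i) (us ! j) = 0"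
  shows "gram G us us = (\<Prod>i<length us. G (us ! i) (us ! i))"
proof -
  let ?S = "{..<length us}"
  have "of_int (sign \<sigma>) * (\<Prod>i<length us. G (us ! i) (us ! \<sigma> i)) = 0" if p: "\<sigma> permutes ?S" and n: "\<sigma> \<noteq> id" for \<sigma>
  proof -
    obtain i where "\<sigma> i \<noteq> i" using n by (auto simp: fun_eq_iff)
    then have "i \<in> ?S" using p by (meson permutes_def)
    moreover have "\<sigma> i \<in> ?S" using p \<open>i \<in> ?S\<close> by (simp only: permutes_in_image)
    ultimately show ?thesis using assms[of i "\<sigma> i"] \<open>\<sigma> i \<noteq> i\<close> by auto
  qed
  then have "gram G us us = (\<Sum>\<sigma>\<in>{id}. of_int (sign \<sigma>) * (\<Prod>i<length us. G (us ! i) (us ! \<sigma> i)))"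
    unfolding gram_def by (intro sum.mono_neutral_right) (auto simp: finite_permutations permutes_id)
  then show ?thesis by simp
qed

lemma multilinear_scale_all:
  fixes c :: "real^'n::finite \<Rightarrow> real"
  assumes "multilinear k \<theta>" "length us = k"
  shows "\<theta> (map (\<lambda>u. c u *\<^sub>R u) us) = (\<Prod>i<k. c (us ! i)) * \<theta> us"
  using assms
proof (induction us arbitrary: k \<theta>)
  case (Cons u us)
  then obtain j where k: "k = Suc j" "length us = j" by auto
  have "\<theta> (map (\<lambda>u. c u *\<^sub>R u) (u # us)) = c u * \<theta> (u # map (\<lambda>u. c u *\<^sub>R u) us)"
    using linear_cmul[OF multilinear_head[of j \<theta>]] Cons.prems k by simp
  also have "\<dots> = c u * ((\<Prod>i<j. c (us ! i)) * \<theta> (u # us))"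
    using Cons.IH[OF multilinear_tail[of j \<theta> u]] Cons.prems k by simp
  finally show ?case by (simp add: k(1) prod.lessThan_Suc_shift del: prod.lessThan_Suc)
qed simp

definition orthonormal :: "(real^'n::finite \<Rightarrow> real^'n \<Rightarrow> real) \<Rightarrow> (real^'n) list \<Rightarrow> bool" where
  "orthonormal G ws \<longleftrightarrow> (\<forall>i<length ws. \<forall>j<length ws. G (ws ! i) (ws ! j) = (if i = j then 1 else 0))"

text \<open>Every unit simple vector has an orthonormal representative. Since the Gram determinant is itself
  alternating in each of its two arguments, orthogonalizing does not change it, and the squared
  lengths of the orthogonal vectors multiply to one; normalizing them then changes no alternating
  map either.\<close>

lemma orthonormalize:
  fixes vs :: "(real^'n::finite) list"
  assumes G: "inner_form G" and "gram G vs vs = 1"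
  obtains ws where "length ws = length vs" "orthonormal G ws"
    "\<And>\<theta>. multilinear (length vs) \<theta> \<Longrightarrow> alternating (length vs) \<theta> \<Longrightarrow> \<theta> vs = \<theta> ws"
proof -
  let ?k = "length vs"
  obtain us where us: "length us = ?k"
    "\<And>i j. i < ?k \<Longrightarrow> j < ?k \<Longrightarrow> i \<noteq> j \<Longrightarrow> G (us ! i) (us ! j) = 0"
    "\<And>\<theta>. multilinear ?k \<theta> \<Longrightarrow> alternating ?k \<theta> \<Longrightarrow> \<theta> vs = \<theta> us"
    using orthogonalize[OF G, of vs] by metis
  have lin1: "linear (G w)" for w using G by (simp add: inner_form_def)
  note lin = lin1 inner_form_linear_left[OF G]
  have sym: "G v w = G w v" and pos: "v \<noteq> 0 \<Longrightarrow> G v v > 0" for v w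
    using G by (auto simp: inner_form_def)
  have e: "gram G vs xs = gram G us xs" for xs
    using us(3)[OF gram_multilinear[OF G] gram_alternating] .
  have "1 = gram G us vs" using assms(2) e by simp
  also have "\<dots> = gram G vs us" using gram_sym[of G us vs] sym us(1) by simp
  also have "\<dots> = gram G us us" by (rule e)
  also have "\<dots> = (\<Prod>i<?k. G (us ! i) (us ! i))" using gram_orthogonal[of us G] us by simp
  finally have P: "(\<Prod>i<?k. G (us ! i) (us ! i)) = 1" by simp
  have nn: "G v v \<ge> 0" for v using pos[of v] linear_0[OF lin(1)] by (cases "v = 0") auto
  have p: "G (us ! i) (us ! i) > 0" if "i < ?k" for i
  proof (rule ccontr)
    assume "\<not> ?thesis"
    then have "G (us ! i) (us ! i) = 0" using nn[of "us ! i"] by simp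
    then have "(\<Prod>i<?k. G (us ! i) (us ! i)) = 0" using that by auto
    then show False using P by simp
  qed
  define c where "c u = 1 / sqrt (G u u)" for u
  show thesis
  proof
    show "length (map (\<lambda>u. c u *\<^sub>R u) us) = ?k" using us by simp
    show "orthonormal G (map (\<lambda>u. c u *\<^sub>R u) us)"
      unfolding orthonormal_def
    proof (intro allI impI)
      fix i j assume ij: "i < length (map (\<lambda>u. c u *\<^sub>R u) us)" "j < length (map (\<lambda>u. c u *\<^sub>R u) us)"
      have "G (c (us ! i) *\<^sub>R (us ! i)) (c (us ! j) *\<^sub>R (us ! j)) = c (us ! i) * (c (us ! j) * G (us ! i) (us ! j))"
        using linear_cmul[OF lin(1)] linear_cmul[OF lin(2)] by simp
      then show "G (map (\<lambda>u. c u *\<^sub>R u) us ! i) (map (\<lambda>u. c u *\<^sub>R u) us ! j) = (if i = j then 1 else 0)"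
        using ij us p[of i] by (auto simp: c_def)
    qed
    fix \<theta> :: "(real^'n) list \<Rightarrow> real"
    assume t: "multilinear ?k \<theta>" "alternating ?k \<theta>"
    have "(\<Prod>i<?k. c (us ! i)) = 1 / sqrt (\<Prod>i<?k. G (us ! i) (us ! i))"
    proof -
      have "(\<Prod>i<n. sqrt (f i)) = sqrt (\<Prod>i<n. f i)" for n and f :: "nat \<Rightarrow> real"
        by (induction n) (auto simp: real_sqrt_mult)
      then show ?thesis by (simp add: c_def prod_dividef)
    qed
    then show "\<theta> vs = \<theta> (map (\<lambda>u. c u *\<^sub>R u) us)"
      unfolding multilinear_scale_all[OF t(1) us(1)] using us(3)[OF t] P by simp
  qed
qed

text \<open>The derivative of the determinant at the identity matrix is the trace: a permutation other than
  the identity leaves at least one vanishing factor however the product is differentiated.\<close>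

lemma leibniz_derivative_at_identity:
  fixes M :: "nat \<Rightarrow> nat \<Rightarrow> real \<Rightarrow> real"
  assumes D: "\<And>i j. i < k \<Longrightarrow> j < k \<Longrightarrow> (M i j has_real_derivative m i j) (at 0)"
    and I: "\<And>i j. i < k \<Longrightarrow> j < k \<Longrightarrow> M i j 0 = (if i = j then 1 else 0)"
  shows "((\<lambda>t. \<Sum>\<sigma> | \<sigma> permutes {..<k}. of_int (sign \<sigma>) * (\<Prod>i<k. M i (\<sigma> i) t)) has_real_derivative
    (\<Sum>i<k. m i i)) (at 0)"
proof -
  let ?d = "\<lambda>\<sigma>. of_int (sign \<sigma>) * (\<Sum>i<k. m i (\<sigma> i) * (\<Prod>j\<in>{..<k} - {i}. M j (\<sigma> j) 0))"
  have lt: "\<sigma> i < k" if "\<sigma> permutes {..<k}" "i < k" for \<sigma> i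
    using permutes_in_image[OF that(1), of i] that(2) by simp
  have "((\<lambda>t. \<Sum>\<sigma> | \<sigma> permutes {..<k}. of_int (sign \<sigma>) * (\<Prod>i<k. M i (\<sigma> i) t)) has_real_derivative
    (\<Sum>\<sigma> | \<sigma> permutes {..<k}. ?d \<sigma>)) (at 0)"
  proof (intro DERIV_sum DERIV_cmult)
    fix \<sigma> assume "\<sigma> \<in> {\<sigma>. \<sigma> permutes {..<k}}"
    then have "((\<lambda>t. \<Prod>i<k. M i (\<sigma> i) t) has_derivative
      (\<lambda>y. \<Sum>i<k. (m i (\<sigma> i) * y) * (\<Prod>j\<in>{..<k} - {i}. M j (\<sigma> j) 0))) (at 0)"
      using D lt by (intro has_derivative_prod) (auto simp: has_field_derivative_def)
    then show "((\<lambda>t. \<Prod>i<k. M i (\<sigma> i) t) has_real_derivative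
      (\<Sum>i<k. m i (\<sigma> i) * (\<Prod>j\<in>{..<k} - {i}. M j (\<sigma> j) 0))) (at 0)"
      unfolding has_field_derivative_def
      by (rule has_derivative_eq_rhs) (auto simp: fun_eq_iff sum_distrib_left mult_ac)
  qed
  also have "(\<Sum>\<sigma> | \<sigma> permutes {..<k}. ?d \<sigma>) = (\<Sum>\<sigma>\<in>{id}. ?d \<sigma>)"
  proof (rule sum.mono_neutral_right)
    show "\<forall>\<sigma>\<in>{\<sigma>. \<sigma> permutes {..<k}} - {id}. ?d \<sigma> = 0"
    proof
      fix \<sigma> assume s: "\<sigma> \<in> {\<sigma>. \<sigma> permutes {..<k}} - {id}"
      have "(\<Prod>j\<in>{..<k} - {i}. M j (\<sigma> j) 0) = 0" if i: "i < k" for i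
      proof -
        obtain j where j: "j \<in> {..<k} - {i}" "\<sigma> j \<noteq> j"
          using permutes_moves_another[of \<sigma> "{..<k}" i] s i by auto
        then have "M j (\<sigma> j) 0 = 0" using I[of j "\<sigma> j"] lt[of \<sigma> j] s by simp
        then show ?thesis using j(1) by (intro prod_zero) auto
      qed
      then have "(\<Sum>i<k. m i (\<sigma> i) * (\<Prod>j\<in>{..<k} - {i}. M j (\<sigma> j) 0)) = 0"
        by (intro sum.neutral) simp
      then show "?d \<sigma> = 0" by simp
    qed
  qed (auto simp: finite_permutations permutes_id)
  also have "\<dots> = (\<Sum>i<k. m i i)" using I by simp
  finally show ?thesis .
qed

section \<open>Differential forms on an atlas\<close>

lemma formsD:
  assumes "\<omega> \<in> forms A k"
  shows "\<not> (c \<in> A \<and> y \<in> chart_img c \<and> length vs = k) \<Longrightarrow> \<omega> c y vs = 0"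
    and "c \<in> A \<Longrightarrow> y \<in> chart_img c \<Longrightarrow> multilinear k (\<omega> c y)"
    and "c \<in> A \<Longrightarrow> y \<in> chart_img c \<Longrightarrow> alternating k (\<omega> c y)"
    and "c \<in> A \<Longrightarrow> length vs = k \<Longrightarrow> smooth_on (\<lambda>y. \<omega> c y vs) (chart_img c)"
    and "c \<in> A \<Longrightarrow> d \<in> A \<Longrightarrow> x \<in> chart_dom c \<Longrightarrow> x \<in> chart_dom d \<Longrightarrow> length vs = k \<Longrightarrow>
      \<omega> c (chart_map c x) vs = \<omega> d (chart_map d x) (map (transition_deriv c d x) vs)"
  using assms unfolding forms_def by blast+

lemma formsI:
  assumes "\<And>c y vs. \<not> (c \<in> A \<and> y \<in> chart_img c \<and> length vs = k) \<Longrightarrow> \<omega> c y vs = 0"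
    and "\<And>c y. c \<in> A \<Longrightarrow> y \<in> chart_img c \<Longrightarrow> multilinear k (\<omega> c y)"
    and "\<And>c y. c \<in> A \<Longrightarrow> y \<in> chart_img c \<Longrightarrow> alternating k (\<omega> c y)"
    and "\<And>c vs. c \<in> A \<Longrightarrow> length vs = k \<Longrightarrow> smooth_on (\<lambda>y. \<omega> c y vs) (chart_img c)"
    and "\<And>c d x vs. c \<in> A \<Longrightarrow> d \<in> A \<Longrightarrow> x \<in> chart_dom c \<Longrightarrow> x \<in> chart_dom d \<Longrightarrow> length vs = k \<Longrightarrow>
      \<omega> c (chart_map c x) vs = \<omega> d (chart_map d x) (map (transition_deriv c d x) vs)"
  shows "\<omega> \<in> forms A k"
  unfolding forms_def using assms by blast

lemma multilinear_combination:
  fixes \<theta> :: "(real^'n::finite) list \<Rightarrow> real"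
  assumes "multilinear k \<theta>" "multilinear k \<eta>"
  shows "multilinear k (\<lambda>vs. a * \<theta> vs + b * \<eta> vs)"
  unfolding multilinear_def
proof (intro allI impI)
  fix vs :: "(real^'n) list" and i assume "length vs = k \<and> i < k"
  then have "linear (\<lambda>v. \<theta> (vs[i := v]))" "linear (\<lambda>v. \<eta> (vs[i := v]))"
    using assms by (simp_all add: multilinear_def)
  then show "linear (\<lambda>v. a * \<theta> (vs[i := v]) + b * \<eta> (vs[i := v]))"
    by (auto simp: linear_iff algebra_simps)
qed

locale atlas =
  fixes A :: "('a::topological_space, 'n::finite) chart set"
  assumes oriented: "oriented_atlas A"
begin

lemma charts_cover: obtains c where "c \<in> A" "x \<in> chart_dom c"
  using oriented unfolding oriented_atlas_def by blast

context
  fixes c assumes c: "c \<in> A"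
begin

lemma chart_homeo: "homeomorphism (chart_dom c) (chart_img c) (chart_map c) (chart_inv c)"
  and open_img: "open (chart_img c)"
  and open_dom: "open (chart_dom c)"
  using oriented c unfolding oriented_atlas_def is_chart_def by auto

lemma chart_inv_map [simp]: "x \<in> chart_dom c \<Longrightarrow> chart_inv c (chart_map c x) = x"
  by (rule homeomorphism_apply1[OF chart_homeo])

lemma chart_map_inv [simp]: "y \<in> chart_img c \<Longrightarrow> chart_map c (chart_inv c y) = y"
  by (rule homeomorphism_apply2[OF chart_homeo])

lemma chart_inv_dom [simp]: "y \<in> chart_img c \<Longrightarrow> chart_inv c y \<in> chart_dom c"
  using imageI[of y "chart_img c" "chart_inv c"] unfolding homeomorphism_image2[OF chart_homeo] .

lemma chart_map_img [simp]: "x \<in> chart_dom c \<Longrightarrow> chart_map c x \<in> chart_img c"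
  by (simp add: chart_img_def)

lemma cont_map: "continuous_on (chart_dom c) (chart_map c)"
  by (rule homeomorphism_cont1[OF chart_homeo])

lemma cont_inv: "continuous_on (chart_img c) (chart_inv c)"
  by (rule homeomorphism_cont2[OF chart_homeo])

end

lemma overlap_eq:
  assumes "c \<in> A" "d \<in> A"
  shows "chart_map c ` (chart_dom c \<inter> chart_dom d) = {y \<in> chart_img c. chart_inv c y \<in> chart_dom d}"
proof (intro equalityI subsetI)
  fix y assume "y \<in> chart_map c ` (chart_dom c \<inter> chart_dom d)"
  then show "y \<in> {y \<in> chart_img c. chart_inv c y \<in> chart_dom d}" using assms by auto
next
  fix y assume "y \<in> {y \<in> chart_img c. chart_inv c y \<in> chart_dom d}"
  then show "y \<in> chart_map c ` (chart_dom c \<inter> chart_dom d)"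
    using assms by (intro image_eqI[of _ _ "chart_inv c y"]) auto
qed

lemma open_overlap:
  assumes "c \<in> A" "d \<in> A"
  shows "open {y \<in> chart_img c. chart_inv c y \<in> chart_dom d}"
  using continuous_open_preimage[OF cont_inv[OF assms(1)] open_img[OF assms(1)] open_dom[OF assms(2)]]
  by (simp add: vimage_def Int_def)

lemma smooth_transition:
  assumes "c \<in> A" "d \<in> A"
  shows "smooth_on (transition c d) {y \<in> chart_img c. chart_inv c y \<in> chart_dom d}"
  using oriented assms overlap_eq[OF assms] unfolding oriented_atlas_def by metis

lemma transition_img:
  "c \<in> A \<Longrightarrow> d \<in> A \<Longrightarrow> y \<in> chart_img c \<Longrightarrow> chart_inv c y \<in> chart_dom d \<Longrightarrow>
   transition c d y \<in> chart_img d \<and> chart_inv d (transition c d y) = chart_inv c y"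
  by (simp add: transition_def)

lemma transition_deriv_has_derivative:
  assumes "c \<in> A" "d \<in> A" "x \<in> chart_dom c" "x \<in> chart_dom d"
  shows "(transition c d has_derivative transition_deriv c d x) (at (chart_map c x))"
  unfolding transition_deriv_def
  by (rule smooth_on_has_derivative[OF smooth_transition[OF assms(1,2)]]) (use assms in auto)

lemma linear_transition_deriv:
  "c \<in> A \<Longrightarrow> d \<in> A \<Longrightarrow> x \<in> chart_dom c \<Longrightarrow> x \<in> chart_dom d \<Longrightarrow> linear (transition_deriv c d x)"
  using transition_deriv_has_derivative has_derivative_linear by blast

lemma surj_transition_deriv:
  assumes "c \<in> A" "d \<in> A" "x \<in> chart_dom c" "x \<in> chart_dom d"
  shows "surj (transition_deriv c d x)"
proof -
  have "det (matrix (transition_deriv c d x)) > 0"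
    using oriented assms unfolding oriented_atlas_def by blast
  then have "invertible (matrix (transition_deriv c d x))" by (simp add: invertible_det_nz)
  then show ?thesis
    using linear_transition_deriv[OF assms] matrix_invertible[of "transition_deriv c d x"]
    by (metis surjI comp_apply id_apply invertible_def matrix_right_invertible_surjective matrix_vector_mul)
qed

lemma forms_combination:
  assumes "\<omega> \<in> forms A k" "\<eta> \<in> forms A k"
  shows "(\<lambda>c y vs. a * \<omega> c y vs + b * \<eta> c y vs) \<in> forms A k"
proof (rule formsI)
  fix c y assume cy: "c \<in> A" "y \<in> chart_img c"
  show "multilinear k (\<lambda>vs. a * \<omega> c y vs + b * \<eta> c y vs)"
    by (rule multilinear_combination[OF formsD(2)[OF assms(1) cy] formsD(2)[OF assms(2) cy]])
  show "alternating k (\<lambda>vs. a * \<omega> c y vs + b * \<eta> c y vs)"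
    using formsD(3)[OF assms(1) cy] formsD(3)[OF assms(2) cy] unfolding alternating_def by simp
next
  fix c and vs :: "(real^'n) list" assume "c \<in> A" "length vs = k"
  then show "smooth_on (\<lambda>y. a * \<omega> c y vs + b * \<eta> c y vs) (chart_img c)"
    by (intro smooth_on_intros open_img formsD(4)[OF assms(1)] formsD(4)[OF assms(2)])
next
  fix c d x and vs :: "(real^'n) list"
  assume "c \<in> A" "d \<in> A" "x \<in> chart_dom c" "x \<in> chart_dom d" "length vs = k"
  then show "a * \<omega> c (chart_map c x) vs + b * \<eta> c (chart_map c x) vs =
     a * \<omega> d (chart_map d x) (map (transition_deriv c d x) vs) + b * \<eta> d (chart_map d x) (map (transition_deriv c d x) vs)"
    using formsD(5)[OF assms(1)] formsD(5)[OF assms(2)] by metis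
qed (use formsD(1)[OF assms(1)] formsD(1)[OF assms(2)] in simp)

definition fun_times_form :: "('a \<Rightarrow> real) \<Rightarrow> ('a, 'n) form \<Rightarrow> ('a, 'n) form" where
  "fun_times_form u \<omega> = (\<lambda>c y vs. u (chart_inv c y) * \<omega> c y vs)"

lemma smooth_functionD:
  "smooth_function A u \<Longrightarrow> c \<in> A \<Longrightarrow> smooth_on (\<lambda>y. u (chart_inv c y)) (chart_img c)"
  by (simp add: smooth_function_def)

lemma smooth_function_compose:
  "smooth_on h UNIV \<Longrightarrow> smooth_function A u \<Longrightarrow> smooth_function A (\<lambda>x. h (u x))"
  unfolding smooth_function_def using smooth_on_compose_real[OF open_img] by blast

lemma fun_times_form_forms:
  assumes "smooth_function A u" "\<omega> \<in> forms A k"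
  shows "fun_times_form u \<omega> \<in> forms A k"
proof (rule formsI)
  fix c y assume cy: "c \<in> A" "y \<in> chart_img c"
  show "multilinear k (fun_times_form u \<omega> c y)"
    using multilinear_combination[OF formsD(2)[OF assms(2) cy] formsD(2)[OF assms(2) cy], of "u (chart_inv c y)" 0]
    by (simp add: fun_times_form_def)
  show "alternating k (fun_times_form u \<omega> c y)"
    using formsD(3)[OF assms(2) cy] unfolding alternating_def fun_times_form_def by simp
next
  fix c and vs :: "(real^'n) list" assume "c \<in> A" "length vs = k"
  then show "smooth_on (\<lambda>y. fun_times_form u \<omega> c y vs) (chart_img c)"
    unfolding fun_times_form_def
    by (intro smooth_on_intros open_img formsD(4)[OF assms(2)] smooth_functionD[OF assms(1)])
next
  fix c d x and vs :: "(real^'n) list"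
  assume "c \<in> A" "d \<in> A" "x \<in> chart_dom c" "x \<in> chart_dom d" "length vs = k"
  then show "fun_times_form u \<omega> c (chart_map c x) vs =
     fun_times_form u \<omega> d (chart_map d x) (map (transition_deriv c d x) vs)"
    using formsD(5)[OF assms(2)] unfolding fun_times_form_def by (metis chart_inv_map)
qed (use formsD(1)[OF assms(2)] in \<open>simp add: fun_times_form_def\<close>)

lemma form_has_derivative:
  assumes "\<omega> \<in> forms A k" "c \<in> A" "y \<in> chart_img c" "length vs = k"
  shows "((\<lambda>z. \<omega> c z vs) has_derivative frechet_derivative (\<lambda>z. \<omega> c z vs) (at y)) (at y)"
  by (rule smooth_on_has_derivative[OF formsD(4)[OF assms(1,2,4)] assms(3)])

lemma form_derivative_multilinear:
  assumes "\<omega> \<in> forms A k" "c \<in> A" "y \<in> chart_img c"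
  shows "multilinear k (\<lambda>vs. frechet_derivative (\<lambda>z. \<omega> c z vs) (at y) u)"
  unfolding multilinear_def
proof (intro allI impI)
  fix vs :: "(real^'n) list" and i assume vs: "length vs = k \<and> i < k"
  show "linear (\<lambda>v. frechet_derivative (\<lambda>z. \<omega> c z (vs[i := v])) (at y) u)"
  proof (rule linear_frechet_derivative_parameter[OF open_img[OF assms(2)] assms(3)])
    show "linear (\<lambda>v. \<omega> c z (vs[i := v]))" if "z \<in> chart_img c" for z
      using multilinearD[OF formsD(2)[OF assms(1,2) that]] vs by blast
    show "(\<lambda>z. \<omega> c z (vs[i := v])) differentiable at y" for v
      using form_has_derivative[OF assms, of "vs[i := v]"] vs by (auto simp: differentiable_def)
  qed
qed

lemma form_derivative_alternating:
  assumes "\<omega> \<in> forms A k" "c \<in> A" "y \<in> chart_img c"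
  shows "alternating k (\<lambda>vs. frechet_derivative (\<lambda>z. \<omega> c z vs) (at y) u)"
  unfolding alternating_def
proof (intro allI impI)
  fix vs :: "(real^'n) list" and i j assume "length vs = k \<and> i < j \<and> j < k \<and> vs ! i = vs ! j"
  then have "\<omega> c z vs = 0" if "z \<in> chart_img c" for z
    using alternatingD[OF formsD(3)[OF assms(1,2) that]] by blast
  then have "frechet_derivative (\<lambda>z. \<omega> c z vs) (at y) = frechet_derivative (\<lambda>z. 0) (at y)"
    by (intro frechet_derivative_cong_open[OF open_img[OF assms(2)] assms(3)])
  then show "frechet_derivative (\<lambda>z. \<omega> c z vs) (at y) u = 0" by simp
qed

lemma ext_d_eq:
  "c \<in> A \<Longrightarrow> y \<in> chart_img c \<Longrightarrow> length vs = Suc k \<Longrightarrow> ext_d A k \<omega> c y vs =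
    (\<Sum>i\<le>k. (-1) ^ i * frechet_derivative (\<lambda>z. \<omega> c z (del i vs)) (at y) (vs ! i))"
  by (simp add: ext_d_def)

lemma ext_d_multilinear:
  assumes "\<omega> \<in> forms A k" "c \<in> A" "y \<in> chart_img c"
  shows "multilinear (Suc k) (ext_d A k \<omega> c y)"
  unfolding multilinear_def
proof (intro allI impI)
  fix vs :: "(real^'n) list" and l assume vs: "length vs = Suc k \<and> l < Suc k"
  let ?D = "\<lambda>vs. frechet_derivative (\<lambda>z. \<omega> c z vs) (at y)"
  have "linear (\<lambda>v. (-1) ^ i * ?D (del i (vs[l := v])) (vs[l := v] ! i))" if i: "i \<le> k" for i
  proof -
    have "linear (\<lambda>v. ?D (del i (vs[l := v])) (vs[l := v] ! i))"
    proof (cases "i = l")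
      case True
      then have "(\<lambda>v. ?D (del i (vs[l := v])) (vs[l := v] ! i)) = ?D (del i vs)"
        using vs by (auto simp: del_update fun_eq_iff)
      then show ?thesis
        using has_derivative_linear[OF form_has_derivative[OF assms, of "del i vs"]] vs True by simp
    next
      case False
      define m where "m = (if l < i then l else l - 1)"
      have "(\<lambda>v. ?D (del i (vs[l := v])) (vs[l := v] ! i)) = (\<lambda>v. ?D ((del i vs)[m := v]) (vs ! i))"
        using vs i False by (auto simp: del_update[of i k] m_def fun_eq_iff simp del: list_update_append)
      then show ?thesis
        using multilinearD[OF form_derivative_multilinear[OF assms], of "del i vs" m "vs ! i"] vs i False
        by (auto simp: m_def)
    qed
    from linear_compose_scale_right[OF this, of "(-1) ^ i"] show ?thesis by simp
  qed
  then have "linear (\<lambda>v. \<Sum>i\<le>k. (-1) ^ i * ?D (del i (vs[l := v])) (vs[l := v] ! i))"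
    by (intro linear_compose_sum) auto
  then show "linear (\<lambda>v. ext_d A k \<omega> c y (vs[l := v]))" using vs assms by (simp add: ext_d_eq)
qed

lemma ext_d_alternating:
  assumes "\<omega> \<in> forms A k" "c \<in> A" "y \<in> chart_img c"
  shows "alternating (Suc k) (ext_d A k \<omega> c y)"
  unfolding alternating_def
proof (intro allI impI)
  fix vs :: "(real^'n) list" and i j assume vs: "length vs = Suc k \<and> i < j \<and> j < Suc k \<and> vs ! i = vs ! j"
  have "(\<Sum>l\<le>k. (-1) ^ l * frechet_derivative (\<lambda>z. \<omega> c z (del l vs)) (at y) (vs ! l)) = 0"
    using alternating_antisym[where Q="\<lambda>u vs. frechet_derivative (\<lambda>z. \<omega> c z vs) (at y) u",
      OF form_derivative_multilinear[OF assms] form_derivative_alternating[OF assms], of vs i j] vs by simp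
  then show "ext_d A k \<omega> c y vs = 0" using vs assms by (simp add: ext_d_eq)
qed

text \<open>Components of a form in two charts differ by the coordinate change and its differential, so
  differentiating them brings in the second derivative of the coordinate change.\<close>

lemma form_derivative_transition:
  assumes \<omega>: "\<omega> \<in> forms A k" and cd: "c \<in> A" "d \<in> A" and x: "x \<in> chart_dom c" "x \<in> chart_dom d"
    and vs: "length vs = k"
  shows "frechet_derivative (\<lambda>z. \<omega> c z vs) (at (chart_map c x)) h =
    frechet_derivative (\<lambda>z. \<omega> d z (map (transition_deriv c d x) vs)) (at (chart_map d x)) (transition_deriv c d x h) +
    (\<Sum>j<k. \<omega> d (chart_map d x) ((map (transition_deriv c d x) vs)
       [j := frechet_derivative (\<lambda>z. frechet_derivative (transition c d) (at z) (vs ! j)) (at (chart_map c x)) h]))"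
proof -
  let ?\<tau> = "transition c d" and ?y = "chart_map c x" and ?U = "{y \<in> chart_img c. chart_inv c y \<in> chart_dom d}"
  let ?Ws = "map (\<lambda>v z. frechet_derivative ?\<tau> (at z) v) vs"
  let ?Ws' = "map (\<lambda>v. frechet_derivative (\<lambda>z. frechet_derivative ?\<tau> (at z) v) (at ?y)) vs"
  have yU: "?y \<in> ?U" using cd x by simp
  have \<tau>y: "?\<tau> ?y = chart_map d x" using cd x by (simp add: transition_def)
  have "((\<lambda>z. \<omega> d (?\<tau> z) (map (\<lambda>W. W z) ?Ws)) has_derivative
    (\<lambda>h. frechet_derivative (\<lambda>z. \<omega> d z (map (\<lambda>W. W ?y) ?Ws)) (at (?\<tau> ?y)) (transition_deriv c d x h) +
      (\<Sum>i<k. \<omega> d (?\<tau> ?y) ((map (\<lambda>W. W ?y) ?Ws)[i := (?Ws' ! i) h])))) (at ?y)"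
  proof (rule multilinear_has_derivative[where U="chart_img d"])
    show "list_all2 (\<lambda>W W'. (W has_derivative W') (at ?y)) ?Ws ?Ws'"
      by (auto simp: list_all2_conv_all_nth intro!: smooth_on_has_derivative[OF smooth_on_frechet[OF smooth_transition[OF cd]]] yU)
    show "(?\<tau> has_derivative transition_deriv c d x) (at ?y)"
      by (rule transition_deriv_has_derivative[OF cd x])
    show "(\<lambda>z. \<omega> d z ws) differentiable at (?\<tau> ?y)" if "length ws = k" for ws
      unfolding \<tau>y using smooth_on_differentiable[OF formsD(4)[OF \<omega> cd(2) that]] cd x by simp
  qed (use vs cd x \<tau>y open_img formsD(2)[OF \<omega>] in auto)
  then have "((\<lambda>z. \<omega> c z vs) has_derivative
    (\<lambda>h. frechet_derivative (\<lambda>z. \<omega> d z (map (\<lambda>W. W ?y) ?Ws)) (at (?\<tau> ?y)) (transition_deriv c d x h) +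
      (\<Sum>i<k. \<omega> d (?\<tau> ?y) ((map (\<lambda>W. W ?y) ?Ws)[i := (?Ws' ! i) h])))) (at ?y)"
  proof (rule has_derivative_transform_within_open[OF _ open_overlap[OF cd] yU])
    fix z assume z: "z \<in> ?U"
    then have "\<omega> c (chart_map c (chart_inv c z)) vs =
        \<omega> d (chart_map d (chart_inv c z)) (map (transition_deriv c d (chart_inv c z)) vs)"
      using formsD(5)[OF \<omega> cd _ _ vs, of "chart_inv c z"] cd by simp
    then show "\<omega> d (?\<tau> z) (map (\<lambda>W. W z) ?Ws) = \<omega> c z vs"
      using z cd by (simp add: transition_def transition_deriv_def[abs_def] o_def)
  qed
  from frechet_derivative_at[OF this, symmetric]
  show ?thesis using vs unfolding \<tau>y by (simp add: transition_deriv_def[abs_def] o_def)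
qed

lemma ext_d_compat:
  assumes \<omega>: "\<omega> \<in> forms A k" and cd: "c \<in> A" "d \<in> A" and x: "x \<in> chart_dom c" "x \<in> chart_dom d"
    and vs: "length vs = Suc k"
  shows "ext_d A k \<omega> c (chart_map c x) vs = ext_d A k \<omega> d (chart_map d x) (map (transition_deriv c d x) vs)"
proof -
  let ?T = "transition_deriv c d x" and ?y = "chart_map c x" and ?y' = "chart_map d x"
  let ?S = "\<lambda>u v. frechet_derivative (\<lambda>z. frechet_derivative (transition c d) (at z) v) (at ?y) u"
  have sym: "?S u v = ?S v u" for u v
    by (rule second_derivative_symmetric[OF open_overlap[OF cd] smooth_transition[OF cd]]) (use cd x in auto)
  have "ext_d A k \<omega> c ?y vs = (\<Sum>i\<le>k. (-1) ^ i * frechet_derivative (\<lambda>z. \<omega> c z (del i vs)) (at ?y) (vs ! i))"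
    using cd x vs by (simp add: ext_d_eq)
  also have "\<dots> = (\<Sum>i\<le>k. (-1) ^ i * (frechet_derivative (\<lambda>z. \<omega> d z (del i (map ?T vs))) (at ?y') (map ?T vs ! i) +
      (\<Sum>j<k. \<omega> d ?y' ((del i (map ?T vs))[j := ?S (vs ! i) (del i vs ! j)]))))"
  proof (intro sum.cong refl)
    fix i assume "i \<in> {..k}"
    then have i: "i \<le> k" by simp
    show "(-1) ^ i * frechet_derivative (\<lambda>z. \<omega> c z (del i vs)) (at ?y) (vs ! i) =
      (-1) ^ i * (frechet_derivative (\<lambda>z. \<omega> d z (del i (map ?T vs))) (at ?y') (map ?T vs ! i) +
      (\<Sum>j<k. \<omega> d ?y' ((del i (map ?T vs))[j := ?S (vs ! i) (del i vs ! j)])))"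
      unfolding form_derivative_transition[OF \<omega> cd x length_del[OF i vs]] map_del[of ?T i vs]
      using i vs by simp
  qed
  also have "\<dots> = ext_d A k \<omega> d ?y' (map ?T vs) +
      (\<Sum>i\<le>k. (-1) ^ i * (\<Sum>j<k. \<omega> d ?y' ((del i (map ?T vs))[j := ?S (vs ! i) (del i vs ! j)])))"
    using cd x vs by (simp add: ext_d_eq distrib_left sum.distrib)
  also have "(\<Sum>i\<le>k. (-1) ^ i * (\<Sum>j<k. \<omega> d ?y' ((del i (map ?T vs))[j := ?S (vs ! i) (del i vs ! j)]))) = 0"
    using cd x vs by (intro symmetric_substitution_sum[where S="?S"] formsD(2)[OF \<omega>] formsD(3)[OF \<omega>] sym) auto
  finally show ?thesis by simp
qed

lemma ext_d_forms:
  assumes \<omega>: "\<omega> \<in> forms A k"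
  shows "ext_d A k \<omega> \<in> forms A (Suc k)"
proof (rule formsI)
  fix c and vs :: "(real^'n) list" assume c: "c \<in> A" and vs: "length vs = Suc k"
  have "smooth_on (\<lambda>y. \<Sum>i\<le>k. (-1) ^ i * frechet_derivative (\<lambda>z. \<omega> c z (del i vs)) (at y) (vs ! i)) (chart_img c)"
    by (intro smooth_on_intros open_img smooth_on_frechet formsD(4)[OF \<omega>] c length_del vs) auto
  then show "smooth_on (\<lambda>y. ext_d A k \<omega> c y vs) (chart_img c)"
    by (rule smooth_on_cong[OF open_img[OF c], rotated]) (use c vs in \<open>simp add: ext_d_eq\<close>)
qed (blast intro: ext_d_multilinear[OF \<omega>] ext_d_alternating[OF \<omega>] ext_d_compat[OF \<omega>] | force simp: ext_d_def)+

lemma ext_d_combination: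
  assumes "\<omega> \<in> forms A k" "\<eta> \<in> forms A k"
  shows "ext_d A k (\<lambda>c y vs. a * \<omega> c y vs + b * \<eta> c y vs) =
    (\<lambda>c y vs. a * ext_d A k \<omega> c y vs + b * ext_d A k \<eta> c y vs)"
proof (intro ext)
  fix c y and vs :: "(real^'n) list"
  show "ext_d A k (\<lambda>c y vs. a * \<omega> c y vs + b * \<eta> c y vs) c y vs = a * ext_d A k \<omega> c y vs + b * ext_d A k \<eta> c y vs"
  proof (cases "c \<in> A \<and> y \<in> chart_img c \<and> length vs = Suc k")
    case True
    then have cy: "c \<in> A" "y \<in> chart_img c" and vs: "length vs = Suc k" by auto
    have "frechet_derivative (\<lambda>z. a * \<omega> c z (del i vs) + b * \<eta> c z (del i vs)) (at y) =
      (\<lambda>h. a * frechet_derivative (\<lambda>z. \<omega> c z (del i vs)) (at y) h + b * frechet_derivative (\<lambda>z. \<eta> c z (del i vs)) (at y) h)"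
      if "i \<le> k" for i
      by (rule frechet_derivative_at[symmetric])
        (intro has_derivative_add has_derivative_mult_right form_has_derivative[OF assms(1) cy]
          form_has_derivative[OF assms(2) cy] length_del that vs)
    then show ?thesis using cy vs
      by (simp add: ext_d_eq sum_distrib_left sum.distrib[symmetric] algebra_simps)
  qed (auto simp: ext_d_def)
qed

lemma ext_d_fun_times_form:
  assumes "smooth_function A u" "\<omega> \<in> forms A k" and cy: "c \<in> A" "y \<in> chart_img c" and vs: "length vs = Suc k"
  shows "ext_d A k (fun_times_form u \<omega>) c y vs = u (chart_inv c y) * ext_d A k \<omega> c y vs +
    (\<Sum>i\<le>k. (-1) ^ i * (frechet_derivative (\<lambda>z. u (chart_inv c z)) (at y) (vs ! i) * \<omega> c y (del i vs)))"
proof -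
  have "frechet_derivative (\<lambda>z. u (chart_inv c z) * \<omega> c z (del i vs)) (at y) =
     (\<lambda>h. u (chart_inv c y) * frechet_derivative (\<lambda>z. \<omega> c z (del i vs)) (at y) h +
       frechet_derivative (\<lambda>z. u (chart_inv c z)) (at y) h * \<omega> c y (del i vs))" if "i \<le> k" for i
    by (rule frechet_derivative_at[symmetric])
      (intro has_derivative_mult smooth_on_has_derivative[OF smooth_functionD[OF assms(1)]] cy
        form_has_derivative[OF assms(2) cy] length_del that vs)
  then show ?thesis using cy vs
    by (simp add: ext_d_eq fun_times_form_def sum_distrib_left sum.distrib[symmetric] algebra_simps)
qed

end

section \<open>The gradient and its contraction with the calibration\<close>

lemma inner_form_unique:
  assumes "inner_form G" "\<And>w. G z w = G z' w"
  shows "z = z'"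
proof (rule ccontr)
  assume "z \<noteq> z'"
  then have "G (z - z') (z - z') > 0" using assms(1) by (simp add: inner_form_def)
  moreover have "G (z - z') (z - z') = G z (z - z') - G z' (z - z')"
    using linear_diff[OF inner_form_linear_left[OF assms(1)]] .
  ultimately show False using assms(2) by simp
qed

lemma inner_form_zero: "inner_form G \<Longrightarrow> (\<And>w. G z w = 0) \<Longrightarrow> z = 0"
  using inner_form_unique[of G z 0] linear_0[OF inner_form_linear_left[of G]] by simp

text \<open>Representation of a linear form by a vector; it makes gradient, Christoffel symbols and Hessian
  endomorphism, all defined by description, well defined.\<close>

lemma inner_form_represent:
  fixes G :: "real^'n::finite \<Rightarrow> real^'n \<Rightarrow> real"
  assumes G: "inner_form G" and l: "linear l"
  shows "\<exists>!z. \<forall>w. G z w = l w"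
proof (rule ex_ex1I)
  define T where "T z = (\<Sum>b\<in>Basis. G z b *\<^sub>R b)" for z
  have lin: "linear (G z)" for z using G by (simp add: inner_form_def)
  have T: "linear T"
    unfolding T_def using inner_form_linear_left[OF G]
    by (auto simp: linear_iff scaleR_add_left sum.distrib scaleR_sum_right)
  have Tb: "T z \<bullet> b = G z b" if "b \<in> Basis" for z b
    using that by (simp add: T_def)
  have "inj T"
  proof (rule injI)
    fix z z' assume eq: "T z = T z'"
    have "G z b = G z' b" if "b \<in> Basis" for b using Tb[OF that, of z] Tb[OF that, of z'] eq by simp
    then have "G z w = G z' w" for w
      using linear_basis_expansion[OF lin, of z w] linear_basis_expansion[OF lin, of z' w] by simp
    then show "z = z'" by (rule inner_form_unique[OF G])
  qed
  from surjD[OF linear_injective_imp_surjective[OF T this], of "\<Sum>b\<in>Basis. l b *\<^sub>R b"]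
  obtain z where z: "T z = (\<Sum>b\<in>Basis. l b *\<^sub>R b)" by auto
  have "G z b = l b" if "b \<in> Basis" for b
    using Tb[OF that, of z] that unfolding z by simp
  then have "G z w = l w" for w
    using linear_basis_expansion[OF lin, of z w] linear_basis_expansion[OF l, of w] by simp
  then show "\<exists>z. \<forall>w. G z w = l w" by blast
next
  show "\<forall>w. G z w = l w \<Longrightarrow> \<forall>w. G y w = l w \<Longrightarrow> z = y" for z y
    using inner_form_unique[OF G, of z y] by simp
qed

text \<open>The Gram matrix of the standard basis, in the form in which Cramer's rule applies to it.\<close>

lemma det_inner_form_nz:
  fixes G :: "real^'n::finite \<Rightarrow> real^'n \<Rightarrow> real"
  assumes G: "inner_form G"
  shows "det (\<chi> i j. G (axis i 1) (axis j 1)) \<noteq> 0"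
    and "(\<chi> i j. G (axis i 1) (axis j 1)) *v x = (\<chi> i. G (axis i 1) x)"
proof -
  let ?M = "(\<chi> i j. G (axis i 1) (axis j 1)) :: real^'n^'n"
  have lin: "linear (G z)" for z using G by (simp add: inner_form_def)
  have Mx: "?M *v x = (\<chi> i. G (axis i 1) x)" for x
  proof -
    have "G z x = (\<Sum>j\<in>UNIV. x $ j * G z (axis j 1))" for z
    proof -
      have "G z x = G z (\<Sum>j\<in>UNIV. x $ j *\<^sub>R axis j 1)"
        using basis_expansion[of x] by (simp add: scalar_mult_eq_scaleR)
      then show ?thesis by (simp add: linear_sum[OF lin] linear_cmul[OF lin])
    qed
    then show ?thesis by (simp add: matrix_vector_mult_def vec_eq_iff mult.commute)
  qed
  then show "?M *v x = (\<chi> i. G (axis i 1) x)" .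
  have "x = 0" if "?M *v x = 0" for x
  proof (rule inner_form_zero[OF G])
    fix w
    have b: "G (axis i 1) x = 0" for i using that unfolding Mx by (simp add: vec_eq_iff)
    have "G w x = G (\<Sum>j\<in>UNIV. w $ j *\<^sub>R axis j 1) x"
      using basis_expansion[of w] by (simp add: scalar_mult_eq_scaleR)
    also have "\<dots> = 0"
      using b by (simp add: linear_sum[OF inner_form_linear_left[OF G]] linear_cmul[OF inner_form_linear_left[OF G]])
    finally show "G x w = 0" using G by (simp add: inner_form_def)
  qed
  then have "\<exists>B. B ** ?M = mat 1" by (simp add: matrix_left_invertible_ker)
  then have "invertible ?M" by (simp add: invertible_left_inverse)
  then show "det ?M \<noteq> 0" by (simp add: invertible_det_nz)
qed

lemma smooth_on_det:
  fixes M :: "'e::real_normed_vector \<Rightarrow> real^'n::finite^'n"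
  assumes "open U" "\<And>i j. smooth_on (\<lambda>y. M y $ i $ j) U"
  shows "smooth_on (\<lambda>y. det (M y)) U"
  unfolding det_def by (intro smooth_on_intros assms)

locale calibrated = atlas A
  for A :: "('a::{t2_space,second_countable_topology}, 'n::finite) chart set" +
  fixes g :: "('a, 'n) metric" and q :: nat and \<phi> :: "('a, 'n) form"
  assumes calibrated: "calibrated_manifold A g (Suc q) \<phi>"
begin

abbreviation in_chart :: "('a, 'n) chart \<Rightarrow> real^'n \<Rightarrow> bool" where
  "in_chart c y \<equiv> c \<in> A \<and> y \<in> chart_img c"

lemma phi_form: "\<phi> \<in> forms A (Suc q)"
  and phi_closed: "ext_d A (Suc q) \<phi> = zero_form"
  and comass: "(c, y, vs) \<in> unit_simple A g (Suc q) \<Longrightarrow> \<phi> c y vs \<le> 1"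
  and metric: "riemannian_metric A g"
  using calibrated unfolding calibrated_manifold_def closed_form_def by auto

lemma metric_inner: "in_chart c y \<Longrightarrow> inner_form (g c y)"
  using metric unfolding riemannian_metric_def inner_form_def by blast

lemma metric_smooth: "c \<in> A \<Longrightarrow> smooth_on (\<lambda>y. g c y v w) (chart_img c)"
  using metric unfolding riemannian_metric_def by blast

lemma metric_compat: "c \<in> A \<Longrightarrow> d \<in> A \<Longrightarrow> x \<in> chart_dom c \<Longrightarrow> x \<in> chart_dom d \<Longrightarrow>
   g c (chart_map c x) v w = g d (chart_map d x) (transition_deriv c d x v) (transition_deriv c d x w)"
  using metric unfolding riemannian_metric_def by blast

lemma metric_sym: "in_chart c y \<Longrightarrow> g c y v w = g c y w v"
  using metric_inner unfolding inner_form_def by blast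

lemma metric_linear1: "in_chart c y \<Longrightarrow> linear (\<lambda>v. g c y v w)"
  using metric_inner inner_form_linear_left by blast

lemma metric_linear2: "in_chart c y \<Longrightarrow> linear (g c y v)"
  using metric_inner unfolding inner_form_def by blast

abbreviation metric_deriv :: "('a, 'n) chart \<Rightarrow> real^'n \<Rightarrow> real^'n \<Rightarrow> real^'n \<Rightarrow> real^'n \<Rightarrow> real" where
  "metric_deriv c y h v w \<equiv> frechet_derivative (\<lambda>z. g c z v w) (at y) h"

lemma metric_deriv_sym: "in_chart c y \<Longrightarrow> metric_deriv c y h v w = metric_deriv c y h w v"
  using frechet_derivative_cong_open[OF open_img, of c y "\<lambda>z. g c z v w" "\<lambda>z. g c z w v"] metric_sym by auto

lemma metric_deriv_linear: "in_chart c y \<Longrightarrow> linear (\<lambda>w. metric_deriv c y h v w)"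
  by (rule linear_frechet_derivative_parameter[OF open_img])
    (auto intro: metric_linear2 smooth_on_differentiable[OF metric_smooth])

lemma metric_deriv_linear0: "in_chart c y \<Longrightarrow> linear (\<lambda>h. metric_deriv c y h v w)"
  using has_derivative_linear[OF smooth_on_has_derivative[OF metric_smooth]] by blast

lemma metric_multilinear:
  assumes "in_chart c z" shows "multilinear 2 (\<lambda>vs. g c z (vs ! 0) (vs ! 1))"
  unfolding multilinear_def
proof (intro allI impI)
  fix vs :: "(real^'n) list" and i :: nat assume "length vs = 2 \<and> i < 2"
  then show "linear (\<lambda>v. g c z (vs[i := v] ! 0) (vs[i := v] ! 1))"
    using metric_linear1[OF assms] metric_linear2[OF assms] by (auto simp: less_2_cases_iff)
qed

text \<open>The metric is a bilinear map depending on the base point, so this is the general product rule with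
  two slots.\<close>

lemma metric_has_derivative:
  assumes cy: "in_chart c (Y x)" and Y: "(Y has_derivative Y') (at x)"
    and V: "(V has_derivative V') (at x)" and W: "(W has_derivative W') (at x)"
  shows "((\<lambda>s. g c (Y s) (V s) (W s)) has_derivative
    (\<lambda>h. metric_deriv c (Y x) (Y' h) (V x) (W x) + g c (Y x) (V' h) (W x) + g c (Y x) (V x) (W' h))) (at x)"
proof -
  let ?T = "\<lambda>z vs. g c z (vs ! 0) (vs ! 1)"
  have "((\<lambda>s. ?T (Y s) (map (\<lambda>W. W s) [V, W])) has_derivative
    (\<lambda>h. frechet_derivative (\<lambda>z. ?T z (map (\<lambda>W. W x) [V, W])) (at (Y x)) (Y' h) +
      (\<Sum>i<2. ?T (Y x) ((map (\<lambda>W. W x) [V, W])[i := ([V', W'] ! i) h])))) (at x)"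
  proof (rule multilinear_has_derivative[where U="chart_img c"])
    show "multilinear 2 (?T z)" if "z \<in> chart_img c" for z
      using metric_multilinear that cy by blast
  qed (use assms open_img smooth_on_differentiable[OF metric_smooth] in auto)
  then show ?thesis by (simp add: numeral_2_eq_2 add.assoc)
qed

definition gradient :: "('a \<Rightarrow> real) \<Rightarrow> ('a, 'n) chart \<Rightarrow> real^'n \<Rightarrow> real^'n" where
  "gradient f c y = (THE X. \<forall>w. g c y X w = frechet_derivative (\<lambda>z. f (chart_inv c z)) (at y) w)"

text \<open>The contraction of \<open>\<phi>\<close> with the gradient of \<open>f\<close>, classically
  written \<open>d\<^sup>\<phi> f\<close>.\<close>

definition gradient_form :: "('a \<Rightarrow> real) \<Rightarrow> ('a, 'n) form" where
  "gradient_form f = (\<lambda>c y vs. if in_chart c y \<and> length vs = q then \<phi> c y (gradient f c y # vs) else 0)"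

context
  fixes f assumes f: "smooth_function A f"
begin

lemma f_has_derivative:
  "in_chart c y \<Longrightarrow> ((\<lambda>z. f (chart_inv c z)) has_derivative
     frechet_derivative (\<lambda>z. f (chart_inv c z)) (at y)) (at y)"
  using smooth_on_has_derivative[OF smooth_functionD[OF f]] by blast

lemma gradient: 
  assumes cy: "in_chart c y"
  shows "g c y (gradient f c y) w = frechet_derivative (\<lambda>z. f (chart_inv c z)) (at y) w"
  using theI'[OF inner_form_represent[OF metric_inner[OF cy] has_derivative_linear[OF f_has_derivative[OF cy]]]]
  unfolding gradient_def by blast

text \<open>An explicit formula for the gradient, from which its smoothness is read off.\<close>

lemma gradient_cramer:
  assumes cy: "in_chart c y"
  shows "gradient f c y = (\<chi> k. det (\<chi> i j. if j = k then frechet_derivative (\<lambda>z. f (chart_inv c z)) (at y) (axis i 1)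
       else g c y (axis i 1) (axis j 1)) / det (\<chi> i j. g c y (axis i 1) (axis j 1)))"
proof -
  let ?M = "(\<chi> i j. g c y (axis i 1) (axis j 1)) :: real^'n^'n"
  let ?b = "(\<chi> i. frechet_derivative (\<lambda>z. f (chart_inv c z)) (at y) (axis i 1)) :: real^'n"
  have "?M *v gradient f c y = ?b"
    using gradient[OF cy] metric_sym[OF cy] by (simp add: det_inner_form_nz(2)[OF metric_inner[OF cy]] vec_eq_iff)
  then have "gradient f c y = (\<chi> k. det (\<chi> i j. if j = k then ?b $ i else ?M $ i $ j) / det ?M)"
    using cramer[OF det_inner_form_nz(1)[OF metric_inner[OF cy]]] by blast
  then show ?thesis by (simp cong: if_cong)
qed

lemma smooth_gradient_component:
  assumes c: "c \<in> A" shows "smooth_on (\<lambda>y. gradient f c y $ k) (chart_img c)"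
proof -
  have "smooth_on (\<lambda>y. det (\<chi> i j. if j = k then frechet_derivative (\<lambda>z. f (chart_inv c z)) (at y) (axis i 1)
       else g c y (axis i 1) (axis j 1)) * inverse (det (\<chi> i j. g c y (axis i 1) (axis j 1)))) (chart_img c)"
  proof (intro smooth_on_mult smooth_on_inverse smooth_on_det open_img c)
    fix i j
    show "smooth_on (\<lambda>y. (\<chi> i j. if j = k then frechet_derivative (\<lambda>z. f (chart_inv c z)) (at y) (axis i 1)
       else g c y (axis i 1) (axis j 1)) $ i $ j) (chart_img c)"
      using smooth_on_frechet[OF smooth_functionD[OF f c]] metric_smooth[OF c] by (cases "j = k") auto
    show "smooth_on (\<lambda>y. (\<chi> i j. g c y (axis i 1) (axis j 1)) $ i $ j) (chart_img c)"
      using metric_smooth[OF c] by simp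
  qed (use det_inner_form_nz(1)[OF metric_inner] c in auto)
  then show ?thesis
    by (rule smooth_on_cong[OF open_img[OF c], rotated]) (simp add: gradient_cramer c divide_inverse)
qed

lemma smooth_gradient:
  assumes c: "c \<in> A" shows "smooth_on (gradient f c) (chart_img c)"
proof -
  have "smooth_on (\<lambda>y. \<Sum>k\<in>UNIV. (gradient f c y $ k) *\<^sub>R axis k 1) (chart_img c)"
    by (intro smooth_on_sum smooth_on_scaleR_const smooth_gradient_component open_img c)
  moreover have "(\<lambda>y. \<Sum>k\<in>UNIV. (gradient f c y $ k) *\<^sub>R axis k 1) = gradient f c"
    by (rule ext, subst (2) basis_expansion[symmetric]) (simp add: scalar_mult_eq_scaleR)
  ultimately show ?thesis by (rule back_subst[of "\<lambda>F. smooth_on F (chart_img c)"])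
qed

text \<open>Both sides represent the differential of \<open>f\<close>, and the differential of the coordinate
  change is onto.\<close>

lemma gradient_compat:
  assumes cd: "c \<in> A" "d \<in> A" and x: "x \<in> chart_dom c" "x \<in> chart_dom d"
  shows "transition_deriv c d x (gradient f c (chart_map c x)) = gradient f d (chart_map d x)"
proof (rule inner_form_unique)
  let ?T = "transition_deriv c d x" and ?y = "chart_map c x" and ?y' = "chart_map d x"
  have y: "in_chart c ?y" "in_chart d ?y'" using cd x by auto
  show "inner_form (g d ?y')" by (rule metric_inner[OF y(2)])
  fix w'
  obtain w where w: "w' = ?T w" using surj_transition_deriv[OF cd x] by (metis surjD)
  have "((\<lambda>z. f (chart_inv d (transition c d z))) has_derivative
      (\<lambda>h. frechet_derivative (\<lambda>z. f (chart_inv d z)) (at ?y') (?T h))) (at ?y)"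
    using has_derivative_compose[OF transition_deriv_has_derivative[OF cd x], of "\<lambda>z. f (chart_inv d z)"]
      f_has_derivative[OF y(2)] cd x by (simp add: transition_def)
  then have "((\<lambda>z. f (chart_inv c z)) has_derivative
      (\<lambda>h. frechet_derivative (\<lambda>z. f (chart_inv d z)) (at ?y') (?T h))) (at ?y)"
    by (rule has_derivative_transform_within_open[OF _ open_overlap[OF cd]])
      (use cd x transition_img[OF cd] in auto)
  from fun_cong[OF frechet_derivative_at[OF this], of w]
  have "frechet_derivative (\<lambda>z. f (chart_inv c z)) (at ?y) w = frechet_derivative (\<lambda>z. f (chart_inv d z)) (at ?y') w'"
    using w by simp
  then show "g d ?y' (?T (gradient f c ?y)) w' = g d ?y' (gradient f d ?y') w'"
    using metric_compat[OF cd x, of "gradient f c ?y" w] gradient[OF y(1)] gradient[OF y(2)] w by simp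
qed

lemma gradient_form_eq:
  "in_chart c y \<Longrightarrow> length vs = q \<Longrightarrow> gradient_form f c y vs = \<phi> c y (gradient f c y # vs)"
  by (simp add: gradient_form_def)

lemma gradient_form_forms: "gradient_form f \<in> forms A q"
proof (rule formsI)
  fix c y assume "c \<in> A" "y \<in> chart_img c"
  then have cy: "in_chart c y" by simp
  have "multilinear q (\<lambda>vs. \<phi> c y (gradient f c y # vs))" "alternating q (\<lambda>vs. \<phi> c y (gradient f c y # vs))"
    using multilinear_tail[OF formsD(2)[OF phi_form]] alternating_tail[OF formsD(3)[OF phi_form]] cy by auto
  then show "multilinear q (gradient_form f c y)" "alternating q (gradient_form f c y)"
    using cy unfolding multilinear_def alternating_def by (simp_all add: gradient_form_eq)
next
  fix c and vs :: "(real^'n) list" assume c: "c \<in> A" and vs: "length vs = q"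
  have "smooth_on (\<lambda>y. \<Sum>b\<in>Basis. (gradient f c y \<bullet> b) * \<phi> c y (b # vs)) (chart_img c)"
    using vs by (intro smooth_on_intros smooth_on_inner smooth_gradient open_img c formsD(4)[OF phi_form]) auto
  then show "smooth_on (\<lambda>y. gradient_form f c y vs) (chart_img c)"
  proof (rule smooth_on_cong[OF open_img[OF c], rotated])
    fix y assume "y \<in> chart_img c"
    then have cy: "in_chart c y" using c by simp
    show "(\<Sum>b\<in>Basis. (gradient f c y \<bullet> b) * \<phi> c y (b # vs)) = gradient_form f c y vs"
      using multilinear_head_expansion[OF formsD(2)[OF phi_form] vs, of c y "gradient f c y"] cy vs
      by (simp add: gradient_form_eq)
  qed
next
  fix c d x and vs :: "(real^'n) list"
  assume "c \<in> A" "d \<in> A" "x \<in> chart_dom c" "x \<in> chart_dom d" "length vs = q"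
  then show "gradient_form f c (chart_map c x) vs =
     gradient_form f d (chart_map d x) (map (transition_deriv c d x) vs)"
    using formsD(5)[OF phi_form, of c d x "gradient f c (chart_map c x) # vs"]
    by (simp add: gradient_form_eq gradient_compat)
qed (auto simp: gradient_form_def)

text \<open>Cartan's formula in coordinates. Closedness of \<open>\<phi>\<close>, evaluated on the gradient
  followed by \<open>vs\<close>, turns the terms in which the coefficients of \<open>\<phi>\<close>
  are differentiated into a single derivative along the gradient.\<close>

lemma ext_d_gradient_form:
  assumes cy: "in_chart c y" and vs: "length vs = Suc q"
  shows "ext_d A q (gradient_form f) c y vs =
    frechet_derivative (\<lambda>z. \<phi> c z vs) (at y) (gradient f c y) +
    (\<Sum>i<Suc q. \<phi> c y (vs[i := frechet_derivative (gradient f c) (at y) (vs ! i)]))"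
proof -
  let ?X = "gradient f c" and ?X' = "frechet_derivative (gradient f c) (at y)"
  have mul: "multilinear (Suc q) (\<phi> c z)" and alt: "alternating (Suc q) (\<phi> c z)" if "z \<in> chart_img c" for z
    using formsD(2,3)[OF phi_form] cy that by auto
  have dX: "(?X has_derivative ?X') (at y)"
    by (rule smooth_on_has_derivative[OF smooth_gradient]) (use cy in auto)
  have D: "frechet_derivative (\<lambda>z. gradient_form f c z ws) (at y) h =
      frechet_derivative (\<lambda>z. \<phi> c z (?X y # ws)) (at y) h + \<phi> c y (?X' h # ws)" if ws: "length ws = q" for ws h
  proof -
    let ?Ws = "?X # map (\<lambda>v z. v) ws" and ?Ws' = "?X' # map (\<lambda>v h. 0) ws"
    have "((\<lambda>z. \<phi> c z (map (\<lambda>W. W z) ?Ws)) has_derivative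
      (\<lambda>h. frechet_derivative (\<lambda>z. \<phi> c z (map (\<lambda>W. W y) ?Ws)) (at y) h +
        (\<Sum>i<Suc q. \<phi> c y ((map (\<lambda>W. W y) ?Ws)[i := (?Ws' ! i) h])))) (at y)"
    proof (rule multilinear_has_derivative[where U="chart_img c" and Y="\<lambda>z. z"])
      show "list_all2 (\<lambda>W W'. (W has_derivative W') (at y)) ?Ws ?Ws'"
        using dX by (auto simp: list_all2_conv_all_nth nth_Cons split: nat.split)
      show "(\<lambda>z. \<phi> c z ws) differentiable at y" if "length ws = Suc q" for ws
        using smooth_on_differentiable[OF formsD(4)[OF phi_form]] cy that by auto
    qed (use ws cy open_img mul in auto)
    then have "((\<lambda>z. gradient_form f c z ws) has_derivative
      (\<lambda>h. frechet_derivative (\<lambda>z. \<phi> c z (map (\<lambda>W. W y) ?Ws)) (at y) h +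
        (\<Sum>i<Suc q. \<phi> c y ((map (\<lambda>W. W y) ?Ws)[i := (?Ws' ! i) h])))) (at y)"
      by (rule has_derivative_transform_within_open[OF _ open_img[of c]])
        (use cy gradient_form_eq[OF _ ws] in \<open>auto simp: o_def\<close>)
    from fun_cong[OF frechet_derivative_at[OF this], of h]
    have "frechet_derivative (\<lambda>z. gradient_form f c z ws) (at y) h =
      frechet_derivative (\<lambda>z. \<phi> c z (?X y # ws)) (at y) h +
      (\<Sum>i<Suc q. \<phi> c y ((?X y # ws)[i := (?Ws' ! i) h]))" by (simp add: o_def)
    also have "(\<Sum>i<Suc q. \<phi> c y ((?X y # ws)[i := (?Ws' ! i) h])) =
       \<phi> c y (?X' h # ws) + (\<Sum>i<q. \<phi> c y ((?X y # ws)[Suc i := 0]))"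
      using ws by (simp add: sum.lessThan_Suc_shift del: sum.lessThan_Suc)
    also have "(\<Sum>i<q. \<phi> c y ((?X y # ws)[Suc i := 0])) = 0"
    proof (intro sum.neutral ballI)
      fix i assume "i \<in> {..<q}"
      then show "\<phi> c y ((?X y # ws)[Suc i := 0]) = 0"
        using linear_0[OF multilinearD[OF mul, of y "?X y # ws" "Suc i"]] ws cy by simp
    qed
    finally show ?thesis by simp
  qed
  have closed: "(\<Sum>i\<le>q. (-1) ^ i * frechet_derivative (\<lambda>z. \<phi> c z (?X y # del i vs)) (at y) (vs ! i)) =
      frechet_derivative (\<lambda>z. \<phi> c z vs) (at y) (?X y)"
  proof -
    have "0 = ext_d A (Suc q) \<phi> c y (?X y # vs)" by (simp add: phi_closed zero_form_def)
    also have "\<dots> = (\<Sum>i<Suc (Suc q). (-1) ^ i * frechet_derivative (\<lambda>z. \<phi> c z (del i (?X y # vs))) (at y) ((?X y # vs) ! i))"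
      using cy vs by (simp only: ext_d_eq length_Cons lessThan_Suc_atMost)
    also have "\<dots> = frechet_derivative (\<lambda>z. \<phi> c z vs) (at y) (?X y) -
        (\<Sum>i<Suc q. (-1) ^ i * frechet_derivative (\<lambda>z. \<phi> c z (?X y # del i vs)) (at y) (vs ! i))"
      by (subst sum.lessThan_Suc_shift) (simp add: sum_negf[symmetric] del: sum.lessThan_Suc)
    finally show ?thesis by (simp add: lessThan_Suc_atMost)
  qed
  have "ext_d A q (gradient_form f) c y vs = (\<Sum>i\<le>q. (-1) ^ i *
     (frechet_derivative (\<lambda>z. \<phi> c z (?X y # del i vs)) (at y) (vs ! i) + \<phi> c y (?X' (vs ! i) # del i vs)))"
    using cy vs by (simp add: ext_d_eq D)
  also have "\<dots> = frechet_derivative (\<lambda>z. \<phi> c z vs) (at y) (?X y) +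
      (\<Sum>i\<le>q. (-1) ^ i * \<phi> c y (?X' (vs ! i) # del i vs))"
    by (simp add: distrib_left sum.distrib closed)
  also have "(\<Sum>i\<le>q. (-1) ^ i * \<phi> c y (?X' (vs ! i) # del i vs)) = (\<Sum>i<Suc q. \<phi> c y (vs[i := ?X' (vs ! i)]))"
    unfolding lessThan_Suc_atMost
  proof (intro sum.cong refl)
    fix i assume "i \<in> {..q}"
    then show "(-1) ^ i * \<phi> c y (?X' (vs ! i) # del i vs) = \<phi> c y (vs[i := ?X' (vs ! i)])"
      using alternating_head_to_slot[OF mul alt vs, of y i] cy by (simp flip: mult.assoc power_mult_distrib)
  qed
  finally show ?thesis .
qed

end

section \<open>Calibrated planes and the first variation\<close>

lemma simple_norm_gram: "simple_norm g c y vs = sqrt (gram (g c y) vs vs)"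
  by (simp add: simple_norm_def gram_def)

lemma unit_simple_iff:
  "(c, y, vs) \<in> unit_simple A g (Suc q) \<longleftrightarrow> in_chart c y \<and> length vs = Suc q \<and> gram (g c y) vs vs = 1"
  by (auto simp: unit_simple_def simple_norm_gram)

lemma phi_planes_iff:
  "(c, y, vs) \<in> phi_planes A g (Suc q) \<phi> \<longleftrightarrow>
    in_chart c y \<and> length vs = Suc q \<and> gram (g c y) vs vs = 1 \<and> \<phi> c y vs = 1"
  by (auto simp: phi_planes_def unit_simple_iff)

lemma gram_orthonormal: "orthonormal G ws \<Longrightarrow> gram G ws ws = 1"
  by (subst gram_orthogonal) (auto simp: orthonormal_def)

text \<open>Forms cannot distinguish a \<open>\<phi>\<close>-plane from an orthonormal basis of it, so all
  estimates may be made on orthonormal bases.\<close>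

lemma orthonormal_plane:
  assumes "(c, y, vs) \<in> phi_planes A g (Suc q) \<phi>"
  obtains ws where "orthonormal (g c y) ws" "(c, y, ws) \<in> phi_planes A g (Suc q) \<phi>"
    "\<And>\<theta>. multilinear (Suc q) \<theta> \<Longrightarrow> alternating (Suc q) \<theta> \<Longrightarrow> \<theta> vs = \<theta> ws"
proof -
  from assms have a: "in_chart c y" "length vs = Suc q" "gram (g c y) vs vs = 1" "\<phi> c y vs = 1"
    by (auto simp: phi_planes_iff)
  obtain ws where ws: "length ws = Suc q" "orthonormal (g c y) ws"
    "\<And>\<theta>. multilinear (Suc q) \<theta> \<Longrightarrow> alternating (Suc q) \<theta> \<Longrightarrow> \<theta> vs = \<theta> ws"
    using orthonormalize[OF metric_inner[OF a(1)] a(3)] unfolding a(2) by metis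
  moreover have "\<phi> c y ws = 1" using ws(3)[of "\<phi> c y"] formsD(2,3)[OF phi_form] a by simp
  ultimately show thesis using that[of ws] a gram_orthonormal[OF ws(2)] by (auto simp: phi_planes_iff)
qed

text \<open>The comass inequality in homogeneous form, obtained by rescaling the first vector.\<close>

lemma comass_gram:
  assumes cy: "in_chart c y" and vs: "length vs = Suc q" and pos: "gram (g c y) vs vs > 0"
  shows "\<phi> c y vs \<le> sqrt (gram (g c y) vs vs)"
proof -
  obtain v ws where v: "vs = v # ws" "length ws = q" using vs by (cases vs) auto
  let ?N = "sqrt (gram (g c y) vs vs)" and ?G = "gram (g c y)"
  let ?u = "(1 / ?N) *\<^sub>R v # ws"
  have s: "?G (a *\<^sub>R v # ws) xs = a * ?G vs xs" for a xs
    using linear_cmul[OF multilinear_head[OF gram_multilinear[OF metric_inner[OF cy]] v(2)]] v by simp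
  have sym: "?G xs zs = ?G zs xs" if "length xs = length zs" for xs zs
    using gram_sym[of "g c y"] metric_sym[OF cy] that by simp
  have "?G ?u ?u = (1 / ?N) * ?G ?u vs" using s sym[of vs ?u] v by simp
  also have "\<dots> = (1 / ?N) * ((1 / ?N) * ?G vs vs)" using s by simp
  also have "\<dots> = 1" using pos by (simp add: divide_simps)
  finally have "(c, y, ?u) \<in> unit_simple A g (Suc q)" using cy v by (simp add: unit_simple_iff)
  then have "\<phi> c y ?u \<le> 1" by (rule comass)
  moreover have "\<phi> c y ?u = (1 / ?N) * \<phi> c y vs"
    using linear_cmul[OF multilinear_head[OF formsD(2)[OF phi_form] v(2)], of c y "1 / ?N" v] cy v by simp
  ultimately show ?thesis using pos by (simp add: divide_simps)
qed

text \<open>On a \<open>\<phi>\<close>-plane the comass inequality is an equality. Moving the base point in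
  the direction \<open>u\<close> and the vectors of an orthonormal basis in the directions
  \<open>L i\<close>, the difference of its two sides is therefore minimal at time zero, so both
  sides have the same derivative; for the Gram determinant this is a trace.\<close>

lemma first_variation:
  assumes cy: "in_chart c y" and on: "orthonormal (g c y) ws" and len: "length ws = Suc q" and one: "\<phi> c y ws = 1"
  shows "frechet_derivative (\<lambda>z. \<phi> c z ws) (at y) u + (\<Sum>i<Suc q. \<phi> c y (ws[i := L i])) =
    (\<Sum>i<Suc q. metric_deriv c y u (ws ! i) (ws ! i) / 2 + g c y (L i) (ws ! i))"
proof -
  define \<gamma> where "\<gamma> t = y + t *\<^sub>R u" for t :: real
  define W where "W i t = ws ! i + t *\<^sub>R L i" for i and t :: real
  define Ws where "Ws t = map (\<lambda>i. W i t) [0..<Suc q]" for t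
  define M where "M i j t = g c (\<gamma> t) (W i t) (W j t)" for i j t
  define \<psi> where "\<psi> t = \<phi> c (\<gamma> t) (Ws t)" for t
  define N where "N t = gram (g c (\<gamma> t)) (Ws t) (Ws t)" for t
  define \<psi>' where "\<psi>' = frechet_derivative (\<lambda>z. \<phi> c z ws) (at y) u + (\<Sum>i<Suc q. \<phi> c y (ws[i := L i]))"
  define m where "m i j = metric_deriv c y u (ws ! i) (ws ! j) + g c y (L i) (ws ! j) + g c y (ws ! i) (L j)" for i j
  have \<gamma>0: "\<gamma> 0 = y" and W0: "W i 0 = ws ! i" for i by (auto simp: \<gamma>_def W_def)
  have Ws0: "Ws 0 = ws" using len by (intro nth_equalityI) (auto simp: Ws_def W_def simp del: upt_Suc)
  have d\<gamma>: "(\<gamma> has_derivative (\<lambda>h. h *\<^sub>R u)) (at 0)"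
    unfolding \<gamma>_def[abs_def] by (auto intro!: derivative_eq_intros)
  have dW: "(W i has_derivative (\<lambda>h. h *\<^sub>R L i)) (at 0)" for i
    unfolding W_def[abs_def] by (auto intro!: derivative_eq_intros)
  have mul: "multilinear (Suc q) (\<phi> c z)" if "z \<in> chart_img c" for z
    using formsD(2)[OF phi_form] cy that by auto
  have d\<psi>: "(\<psi> has_real_derivative \<psi>') (at 0)"
  proof -
    let ?Vs = "map W [0..<Suc q]" and ?Vs' = "map (\<lambda>i h. h *\<^sub>R L i) [0..<Suc q]"
    have "((\<lambda>t. \<phi> c (\<gamma> t) (map (\<lambda>W. W t) ?Vs)) has_derivative
      (\<lambda>h. frechet_derivative (\<lambda>z. \<phi> c z (map (\<lambda>W. W 0) ?Vs)) (at (\<gamma> 0)) (h *\<^sub>R u) +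
        (\<Sum>i<Suc q. \<phi> c (\<gamma> 0) ((map (\<lambda>W. W 0) ?Vs)[i := (?Vs' ! i) h])))) (at 0)"
    proof (rule multilinear_has_derivative[where U="chart_img c"])
      show "list_all2 (\<lambda>W W'. (W has_derivative W') (at 0)) ?Vs ?Vs'"
        using dW by (auto simp: list_all2_conv_all_nth simp del: upt_Suc)
      show "(\<lambda>z. \<phi> c z ws) differentiable at (\<gamma> 0)" if "length ws = Suc q" for ws
        unfolding \<gamma>0 using smooth_on_differentiable[OF formsD(4)[OF phi_form]] cy that by auto
    qed (use cy open_img mul d\<gamma> \<gamma>0 in auto)
    moreover have Vs: "map (\<lambda>W. W t) ?Vs = Ws t" for t by (simp add: Ws_def o_def del: upt_Suc)
    moreover have "frechet_derivative (\<lambda>z. \<phi> c z ws) (at y) (h *\<^sub>R u) + (\<Sum>i<Suc q. \<phi> c y (ws[i := (?Vs' ! i) h])) = \<psi>' * h" for h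
    proof -
      have "frechet_derivative (\<lambda>z. \<phi> c z ws) (at y) (h *\<^sub>R u) = h * frechet_derivative (\<lambda>z. \<phi> c z ws) (at y) u"
        using linear_cmul[OF has_derivative_linear[OF form_has_derivative[OF phi_form]]] cy len by simp
      moreover have "(\<Sum>i<Suc q. \<phi> c y (ws[i := (?Vs' ! i) h])) = (\<Sum>i<Suc q. h * \<phi> c y (ws[i := L i]))"
      proof (intro sum.cong refl)
        fix i assume "i \<in> {..<Suc q}"
        then show "\<phi> c y (ws[i := (?Vs' ! i) h]) = h * \<phi> c y (ws[i := L i])"
          using linear_cmul[OF multilinearD[OF mul len, of y i]] cy by (simp del: upt_Suc)
      qed
      ultimately show ?thesis by (simp only: \<psi>'_def sum_distrib_left distrib_right mult.commute[of _ h] distrib_left)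
    qed
    ultimately show ?thesis unfolding has_field_derivative_def \<psi>_def[abs_def] by (simp only: Vs Ws0 \<gamma>0)
  qed
  have dM: "(M i j has_real_derivative m i j) (at 0)" for i j
  proof -
    have "(M i j has_derivative (\<lambda>h. metric_deriv c (\<gamma> 0) (h *\<^sub>R u) (W i 0) (W j 0) +
        g c (\<gamma> 0) (h *\<^sub>R L i) (W j 0) + g c (\<gamma> 0) (W i 0) (h *\<^sub>R L j))) (at 0)"
      unfolding M_def[abs_def] using cy by (intro metric_has_derivative d\<gamma> dW) (simp_all add: \<gamma>0)
    moreover have "metric_deriv c y (h *\<^sub>R u) v w = h * metric_deriv c y u v w"
      "g c y (h *\<^sub>R v) w = h * g c y v w" "g c y v (h *\<^sub>R w) = h * g c y v w" for h v w
      using linear_cmul[OF metric_deriv_linear0[OF cy]] linear_cmul[OF metric_linear1[OF cy]]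
        linear_cmul[OF metric_linear2[OF cy]] by simp_all
    ultimately show ?thesis
      unfolding has_field_derivative_def \<gamma>0 W0 m_def
      by (elim has_derivative_eq_rhs) (auto simp: fun_eq_iff algebra_simps)
  qed
  have N_eq: "N t = (\<Sum>\<sigma> | \<sigma> permutes {..<Suc q}. of_int (sign \<sigma>) * (\<Prod>i<Suc q. M i (\<sigma> i) t))" for t
  proof -
    have "Ws t ! i = W i t" if "i < Suc q" for i using that by (simp add: Ws_def del: upt_Suc)
    moreover have "length (Ws t) = Suc q" by (simp add: Ws_def)
    moreover have "\<sigma> i < Suc q" if "\<sigma> permutes {..<Suc q}" "i < Suc q" for \<sigma> i
      using permutes_in_image[OF that(1), of i] that(2) by simp
    ultimately show ?thesis
      unfolding N_def gram_def M_def by (intro sum.cong arg_cong2[of _ _ _ _ "(*)"] prod.cong) auto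
  qed
  have dN: "(N has_real_derivative (\<Sum>i<Suc q. m i i)) (at 0)"
    unfolding N_eq[abs_def]
    by (rule leibniz_derivative_at_identity[OF dM]) (use on len in \<open>auto simp: M_def \<gamma>0 W0 orthonormal_def\<close>)
  have N0: "N 0 = 1" by (simp add: N_def \<gamma>0 Ws0 gram_orthonormal[OF on])
  have \<psi>0: "\<psi> 0 = 1" by (simp add: \<psi>_def \<gamma>0 Ws0 one)
  have "\<forall>\<^sub>F t in nhds 0. \<gamma> t \<in> chart_img c"
  proof -
    have "isCont \<gamma> 0" unfolding \<gamma>_def[abs_def] by simp
    then have "\<forall>\<^sub>F t in at 0. \<gamma> t \<in> chart_img c"
      using open_img cy by (simp add: isCont_def \<gamma>0 topological_tendstoD)
    then show ?thesis using cy by (simp add: eventually_nhds_conv_at \<gamma>0)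
  qed
  moreover have "\<forall>\<^sub>F t in nhds 0. N t > 0"
  proof -
    have "isCont N 0" using dN by (rule DERIV_isCont)
    then have "\<forall>\<^sub>F t in at 0. N t > 0" by (simp add: isCont_def N0 order_tendstoD)
    then show ?thesis by (simp add: eventually_nhds_conv_at N0)
  qed
  ultimately have ev: "\<forall>\<^sub>F t in nhds 0. \<psi> t \<le> sqrt (N t)"
  proof eventually_elim
    case (elim t)
    then show ?case unfolding \<psi>_def N_def
      using comass_gram[of c "\<gamma> t" "Ws t"] cy by (simp add: Ws_def del: upt_Suc)
  qed
  \<comment> \<open>\<open>sqrt (N t) - \<psi> t\<close> is nonnegative near \<open>0\<close> and vanishes
    there\<close>
  have "((\<lambda>t. sqrt (N t) - \<psi> t) has_real_derivative (\<Sum>i<Suc q. m i i) / 2 - \<psi>') (at 0)"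
    using dN d\<psi> N0 by (auto intro!: derivative_eq_intros simp: divide_simps)
  moreover obtain \<delta> where "\<delta> > 0" "\<And>t. dist t 0 < \<delta> \<Longrightarrow> \<psi> t \<le> sqrt (N t)"
    using ev by (auto simp: eventually_nhds_metric)
  ultimately have "(\<Sum>i<Suc q. m i i) / 2 - \<psi>' = 0"
    by (elim DERIV_local_min) (auto simp: N0 \<psi>0 dist_real_def)
  then have "\<psi>' = (\<Sum>i<Suc q. m i i / 2)" by (simp only: sum_divide_distrib[symmetric])
  then show ?thesis
    unfolding \<psi>'_def m_def using metric_sym[OF cy]
    by (simp add: add_divide_distrib add.commute del: sum.lessThan_Suc)
qed

text \<open>The right-hand side is linear in \<open>u\<close>, hence represented by a unique vector.\<close>

lemma christoffel:
  assumes cy: "in_chart c y"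
  shows "2 * g c y (christoffel g c y v w) u =
    metric_deriv c y v w u + metric_deriv c y w v u - metric_deriv c y u v w"
proof -
  let ?l = "\<lambda>u. (metric_deriv c y v w u + metric_deriv c y w v u - metric_deriv c y u v w) / 2"
  have "linear ?l"
    using linear_compose_add[OF metric_deriv_linear[OF cy, of v w] metric_deriv_linear[OF cy, of w v]]
      metric_deriv_linear0[OF cy, of v w] by (auto simp: linear_iff algebra_simps divide_simps)
  from inner_form_represent[OF metric_inner[OF cy] this]
  have "\<exists>!z. \<forall>u. 2 * g c y z u = metric_deriv c y v w u + metric_deriv c y w v u - metric_deriv c y u v w"
    by (simp add: field_simps)
  from theI'[OF this] show ?thesis unfolding christoffel_def by blast
qed

text \<open>The Hessian endomorphism sends \<open>v\<close> to the covariant derivative of the gradient in the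
  direction \<open>v\<close>. The two Christoffel terms combine by the symmetry of the metric.\<close>

lemma hessian_endo_eq:
  assumes f: "smooth_function A f" and cy: "in_chart c y"
  shows "hessian_endo g f c y v = frechet_derivative (gradient f c) (at y) v + christoffel g c y v (gradient f c y)"
proof -
  let ?X = "gradient f c" and ?X' = "frechet_derivative (gradient f c) (at y)"
  let ?A = "?X' v + christoffel g c y v (?X y)"
  have "g c y ?A w = hessian g f c y v w" for w
  proof -
    have "((\<lambda>z. g c z (?X z) w) has_derivative (\<lambda>h. metric_deriv c y h (?X y) w + g c y (?X' h) w + g c y (?X y) 0)) (at y)"
      by (intro metric_has_derivative[where Y="\<lambda>z. z"] cy has_derivative_ident has_derivative_const
          smooth_on_has_derivative[OF smooth_gradient[OF f]]) (use cy in auto)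
    then have "((\<lambda>z. frechet_derivative (\<lambda>z. f (chart_inv c z)) (at z) w) has_derivative
        (\<lambda>h. metric_deriv c y h (?X y) w + g c y (?X' h) w + g c y (?X y) 0)) (at y)"
      by (rule has_derivative_transform_within_open[OF _ open_img[of c]]) (use cy in \<open>simp_all add: gradient[OF f]\<close>)
    from fun_cong[OF frechet_derivative_at[OF this], of v]
    have 1: "frechet_derivative (\<lambda>z. frechet_derivative (\<lambda>z. f (chart_inv c z)) (at z) w) (at y) v =
       metric_deriv c y v (?X y) w + g c y (?X' v) w"
      using linear_0[OF metric_linear2[OF cy]] by simp
    have 2: "frechet_derivative (\<lambda>z. f (chart_inv c z)) (at y) (christoffel g c y v w) =
       g c y (christoffel g c y v w) (?X y)"
      using gradient[OF f cy] metric_sym[OF cy] by metis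
    \<comment> \<open>the remaining terms of the two Koszul formulas cancel\<close>
    have "2 * g c y (christoffel g c y v w) (?X y) + 2 * g c y (christoffel g c y v (?X y)) w =
        2 * metric_deriv c y v (?X y) w"
      unfolding christoffel[OF cy] using metric_deriv_sym[OF cy] by simp
    then show ?thesis
      unfolding hessian_def Let_def 1 2 using linear_add[OF metric_linear1[OF cy]] by simp
  qed
  then show ?thesis
    unfolding hessian_endo_def
    by (intro the_equality) (auto intro: inner_form_unique[OF metric_inner[OF cy]])
qed

text \<open>The first variation is applied to the parallel transport of the plane along the gradient, that is
  with velocities given by minus the Christoffel symbols. Parallel transport preserves lengths to
  first order, so the covariant derivative of \<open>\<phi>\<close> along the gradient vanishes on
  the plane, and only the \<open>\<phi>\<close>-Hessian is left of Cartan's formula.\<close>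

lemma ext_d_gradient_form_plane:
  assumes f: "smooth_function A f" and P: "(c, y, ws) \<in> phi_planes A g (Suc q) \<phi>" and on: "orthonormal (g c y) ws"
  shows "ext_d A q (gradient_form f) c y ws = phi_hessian g \<phi> f c y ws"
proof -
  have cy: "in_chart c y" and len: "length ws = Suc q" and one: "\<phi> c y ws = 1"
    using P by (auto simp: phi_planes_iff)
  let ?X = "gradient f c y" and ?X' = "frechet_derivative (gradient f c) (at y)"
  let ?\<Gamma> = "\<lambda>i. christoffel g c y (ws ! i) ?X"
  have lin: "linear (\<lambda>v. \<phi> c y (ws[i := v]))" if "i < Suc q" for i
    using multilinearD[OF formsD(2)[OF phi_form] len that] cy by simp
  have "g c y (- ?\<Gamma> i) (ws ! i) = - metric_deriv c y ?X (ws ! i) (ws ! i) / 2" for i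
    using christoffel[OF cy, of "ws ! i" ?X "ws ! i"] metric_deriv_sym[OF cy, of "ws ! i" ?X "ws ! i"]
      linear_neg[OF metric_linear1[OF cy], of "?\<Gamma> i" "ws ! i"] by simp
  then have "frechet_derivative (\<lambda>z. \<phi> c z ws) (at y) ?X = - (\<Sum>i<Suc q. \<phi> c y (ws[i := - ?\<Gamma> i]))"
    using first_variation[OF cy on len one, of ?X "\<lambda>i. - ?\<Gamma> i"] by (simp del: sum.lessThan_Suc)
  also have "\<dots> = (\<Sum>i<Suc q. \<phi> c y (ws[i := ?\<Gamma> i]))"
    unfolding sum_negf[symmetric] using linear_neg[OF lin] by (intro sum.cong) auto
  finally have "ext_d A q (gradient_form f) c y ws =
     (\<Sum>i<Suc q. \<phi> c y (ws[i := ?\<Gamma> i]) + \<phi> c y (ws[i := ?X' (ws ! i)]))"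
    unfolding ext_d_gradient_form[OF f cy len] by (simp only: sum.distrib)
  also have "\<dots> = (\<Sum>i<Suc q. \<phi> c y (ws[i := hessian_endo g f c y (ws ! i)]))"
    unfolding hessian_endo_eq[OF f cy] using linear_add[OF lin] by (intro sum.cong) auto
  finally show ?thesis by (simp only: phi_hessian_def len)
qed

text \<open>The additional term is \<open>h'(f)\<close> times \<open>df\<close> wedge the contracted form.
  Here the first variation with fixed base point and velocities \<open>df(w) X\<close>, where
  \<open>X\<close> is the gradient, shows that it is the sum of the squares of \<open>df\<close> on
  the orthonormal basis.\<close>

lemma ext_d_weighted_gradient_form:
  assumes f: "smooth_function A f" and h: "smooth_on h UNIV" "mono h"
    and P: "(c, y, ws) \<in> phi_planes A g (Suc q) \<phi>" and on: "orthonormal (g c y) ws"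
  shows "ext_d A q (fun_times_form (\<lambda>x. h (f x)) (gradient_form f)) c y ws \<ge>
    h (f (chart_inv c y)) * phi_hessian g \<phi> f c y ws"
proof -
  have cy: "in_chart c y" and len: "length ws = Suc q" and one: "\<phi> c y ws = 1"
    using P by (auto simp: phi_planes_iff)
  let ?X = "gradient f c y" and ?F = "\<lambda>z. f (chart_inv c z)"
  let ?dF = "frechet_derivative ?F (at y)"
  obtain h' where h': "(h has_real_derivative h') (at (?F y))"
    using smooth_on_differentiable[OF h(1)] by (auto simp: real_differentiable_def)
  have "h' \<ge> 0"
    using h(2) by (intro mono_on_imp_deriv_nonneg[OF _ h', of UNIV]) (auto simp: mono_on_def mono_def)
  have "((\<lambda>z. h (?F z)) has_derivative (\<lambda>v. h' * ?dF v)) (at y)"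
    using has_derivative_compose[OF f_has_derivative[OF f cy]] h' by (simp add: has_field_derivative_def)
  from fun_cong[OF frechet_derivative_at[OF this, symmetric]]
  have dh: "frechet_derivative (\<lambda>z. h (?F z)) (at y) v = h' * ?dF v" for v by simp
  have mul: "multilinear (Suc q) (\<phi> c y)" and alt: "alternating (Suc q) (\<phi> c y)"
    using formsD(2,3)[OF phi_form] cy by auto
  have "(\<Sum>i\<le>q. (-1) ^ i * (h' * ?dF (ws ! i) * gradient_form f c y (del i ws))) =
     (\<Sum>i<Suc q. h' * \<phi> c y (ws[i := ?dF (ws ! i) *\<^sub>R ?X]))"
    unfolding lessThan_Suc_atMost
  proof (intro sum.cong refl)
    fix i assume "i \<in> {..q}"
    then have i: "i \<le> q" by simp
    have "gradient_form f c y (del i ws) = (-1) ^ i * \<phi> c y (ws[i := ?X])"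
      using gradient_form_eq[OF f cy length_del[OF i len]] alternating_head_to_slot[OF mul alt len] i by simp
    moreover have "\<phi> c y (ws[i := ?dF (ws ! i) *\<^sub>R ?X]) = ?dF (ws ! i) * \<phi> c y (ws[i := ?X])"
      using linear_cmul[OF multilinearD[OF mul len]] i by simp
    ultimately show "(-1) ^ i * (h' * ?dF (ws ! i) * gradient_form f c y (del i ws)) =
      h' * \<phi> c y (ws[i := ?dF (ws ! i) *\<^sub>R ?X])"
      by (simp flip: power_mult_distrib mult.assoc)
  qed
  also have "\<dots> = h' * (\<Sum>i<Suc q. g c y (?dF (ws ! i) *\<^sub>R ?X) (ws ! i))"
    using first_variation[OF cy on len one, of 0 "\<lambda>i. ?dF (ws ! i) *\<^sub>R ?X"]
      linear_0[OF has_derivative_linear[OF form_has_derivative[OF phi_form]], of c y ws]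
      linear_0[OF metric_deriv_linear0[OF cy]] cy len
    by (simp add: sum_distrib_left[symmetric] del: sum.lessThan_Suc)
  also have "(\<Sum>i<Suc q. g c y (?dF (ws ! i) *\<^sub>R ?X) (ws ! i)) = (\<Sum>i<Suc q. (?dF (ws ! i))\<^sup>2)"
    using linear_cmul[OF metric_linear1[OF cy]] gradient[OF f cy] by (simp add: power2_eq_square)
  finally have "(\<Sum>i\<le>q. (-1) ^ i * (h' * ?dF (ws ! i) * gradient_form f c y (del i ws))) \<ge> 0"
    using \<open>h' \<ge> 0\<close> by (simp add: sum_nonneg del: sum.lessThan_Suc)
  then show ?thesis
    unfolding ext_d_fun_times_form[OF smooth_function_compose[OF h(1) f] gradient_form_forms[OF f] conjunct1[OF cy] conjunct2[OF cy] len]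
      ext_d_gradient_form_plane[OF f P on] dh by simp
qed

end

section \<open>Compactness of the planes over a compact set\<close>

lemma bounded_family_subsequence:
  fixes W :: "nat \<Rightarrow> nat \<Rightarrow> 'e::euclidean_space"
  assumes "\<And>i n. i < k \<Longrightarrow> norm (W i n) \<le> R"
  shows "\<exists>r l. strict_mono (r::nat \<Rightarrow> nat) \<and> (\<forall>i<k. (\<lambda>n. W i (r n)) \<longlonglongrightarrow> l i)"
  using assms
proof (induction k)
  case 0
  then show ?case by (intro exI[of _ "\<lambda>n. n"]) (auto simp: strict_mono_def)
next
  case (Suc k)
  then obtain r l where r: "strict_mono r" "\<And>i. i < k \<Longrightarrow> (\<lambda>n. W i (r n)) \<longlonglongrightarrow> l i" by auto
  have "W k (r n) \<in> cball 0 R" for n using Suc.prems[of k "r n"] by simp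
  then have "\<forall>n. W k (r n) \<in> cball 0 R" by blast
  from seq_compactE[OF compact_imp_seq_compact[OF compact_cball] this]
  obtain l' s where s: "l' \<in> cball 0 R" "strict_mono s" "((\<lambda>n. W k (r n)) \<circ> s) \<longlonglongrightarrow> l'" .
  have "(\<lambda>n. W i (r (s n))) \<longlonglongrightarrow> (l(k := l')) i" if "i < Suc k" for i
  proof (cases "i = k")
    case True
    then show ?thesis using s(3) by (simp add: o_def)
  next
    case False
    then show ?thesis
      using LIMSEQ_subseq_LIMSEQ[OF r(2)[of i] s(2)] that by (simp add: o_def)
  qed
  then show ?case
    using strict_mono_o[OF r(1) s(2)] by (intro exI[of _ "r \<circ> s"] exI[of _ "l(k := l')"]) (simp add: o_def)
qed

lemma finite_uniform_positive:
  fixes P :: "'s \<Rightarrow> real \<Rightarrow> bool"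
  assumes "finite S" "\<And>s. s \<in> S \<Longrightarrow> \<exists>\<epsilon>>0. P s \<epsilon>" "\<And>s \<epsilon> \<delta>. P s \<epsilon> \<Longrightarrow> 0 < \<delta> \<Longrightarrow> \<delta> \<le> \<epsilon> \<Longrightarrow> P s \<delta>"
  shows "\<exists>\<epsilon>>0. \<forall>s\<in>S. P s \<epsilon>"
  using assms(1,2)
proof (induction S)
  case empty
  then show ?case by (intro exI[of _ 1]) auto
next
  case (insert s S)
  then obtain \<epsilon> where e: "\<epsilon> > 0" "\<forall>s\<in>S. P s \<epsilon>" by auto
  from insert obtain \<delta> where "\<delta> > 0" "P s \<delta>" by auto
  then have "P s (min \<epsilon> \<delta>)" "\<forall>s\<in>S. P s (min \<epsilon> \<delta>)" "min \<epsilon> \<delta> > 0"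
    using e assms(3)[of s \<delta> "min \<epsilon> \<delta>"] assms(3)[of _ \<epsilon> "min \<epsilon> \<delta>"] by auto
  then show ?case by (intro exI[of _ "min \<epsilon> \<delta>"]) simp
qed

context atlas
begin

lemma finite_compact_charts:
  assumes "compact K"
  shows "\<exists>\<K>. finite \<K> \<and> (\<forall>(c, L)\<in>\<K>. c \<in> A \<and> compact L \<and> L \<subseteq> chart_img c) \<and>
    (\<forall>x\<in>K. \<exists>(c, L)\<in>\<K>. x \<in> chart_dom c \<and> chart_map c x \<in> L)"
proof -
  have "\<exists>c e. c \<in> A \<and> x \<in> chart_dom c \<and> e > 0 \<and> cball (chart_map c x) e \<subseteq> chart_img c" for x
    using charts_cover[of x] open_img chart_map_img by (metis open_contains_cball)
  then obtain c e where ce: "\<And>x. c x \<in> A" "\<And>x. x \<in> chart_dom (c x)" "\<And>x. e x > (0::real)"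
    "\<And>x. cball (chart_map (c x) x) (e x) \<subseteq> chart_img (c x)" by metis
  define O' where "O' x = chart_dom (c x) \<inter> chart_map (c x) -` ball (chart_map (c x) x) (e x)" for x
  have "open (O' x)" for x
    unfolding O'_def by (rule continuous_open_preimage[OF cont_map open_dom open_ball]) (rule ce)+
  moreover have "x \<in> O' x" for x using ce by (simp add: O'_def)
  ultimately have "\<And>x. x \<in> K \<Longrightarrow> open (O' x)" "K \<subseteq> (\<Union>x\<in>K. O' x)" by auto
  from compactE_image[OF assms this]
  obtain F where F: "F \<subseteq> K" "finite F" "K \<subseteq> (\<Union>x\<in>F. O' x)" .
  let ?\<K> = "(\<lambda>x. (c x, cball (chart_map (c x) x) (e x))) ` F"
  show ?thesis
  proof (intro exI[of _ ?\<K>] conjI ballI)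
    fix x assume "x \<in> K"
    then obtain z where "z \<in> F" "x \<in> O' z" using F by blast
    then show "\<exists>(c, L)\<in>?\<K>. x \<in> chart_dom c \<and> chart_map c x \<in> L"
      by (auto simp: O'_def intro!: bexI[of _ z])
  next
    fix s assume "s \<in> ?\<K>"
    then obtain x where "x \<in> F" "s = (c x, cball (chart_map (c x) x) (e x))" by blast
    then show "case s of (d, L) \<Rightarrow> d \<in> A \<and> compact L \<and> L \<subseteq> chart_img d" using ce by simp
  qed (use F in simp)
qed

end

context calibrated
begin

abbreviation planes where "planes \<equiv> phi_planes A g (Suc q) \<phi>"

text \<open>Allows every plane over a compact set to be described in one of finitely many charts.\<close>

lemma plane_transfer:
  assumes P: "(c, y, vs) \<in> planes" and d: "d \<in> A" "chart_inv c y \<in> chart_dom d"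
  obtains ws where "(d, chart_map d (chart_inv c y), ws) \<in> planes"
    "\<And>\<beta>. \<beta> \<in> forms A (Suc q) \<Longrightarrow> \<beta> c y vs = \<beta> d (chart_map d (chart_inv c y)) ws"
proof -
  let ?x = "chart_inv c y"
  let ?T = "transition_deriv c d ?x"
  have a: "in_chart c y" "length vs = Suc q" "gram (g c y) vs vs = 1" "\<phi> c y vs = 1"
    using P by (auto simp: phi_planes_iff)
  have y: "chart_map c ?x = y" and x: "?x \<in> chart_dom c" using a by auto
  have eq: "\<beta> c y vs = \<beta> d (chart_map d ?x) (map ?T vs)" if "\<beta> \<in> forms A (Suc q)" for \<beta>
    using formsD(5)[OF that conjunct1[OF a(1)] d(1) x d(2) a(2)] y by simp
  have "gram (g d (chart_map d ?x)) (map ?T vs) (map ?T vs) = gram (g c y) vs vs"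
  proof -
    have "(\<Prod>i<length vs. g d (chart_map d ?x) (map ?T vs ! i) (map ?T vs ! \<sigma> i)) = (\<Prod>i<length vs. g c y (vs ! i) (vs ! \<sigma> i))"
      if "\<sigma> permutes {..<length vs}" for \<sigma>
    proof (intro prod.cong refl)
      fix i assume "i \<in> {..<length vs}"
      moreover from this have "\<sigma> i < length vs" using permutes_in_image[OF that, of i] by simp
      ultimately show "g d (chart_map d ?x) (map ?T vs ! i) (map ?T vs ! \<sigma> i) = g c y (vs ! i) (vs ! \<sigma> i)"
        using metric_compat[OF conjunct1[OF a(1)] d(1) x d(2)] y by simp
    qed
    then show ?thesis unfolding gram_def by (auto intro!: sum.cong)
  qed
  then have "(d, chart_map d ?x, map ?T vs) \<in> planes"
    using a d eq[OF phi_form] by (auto simp: phi_planes_iff)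
  then show thesis using that eq by blast
qed

lemma metric_tendsto:
  assumes c: "c \<in> A" and Y: "\<And>n::nat. Y n \<in> chart_img c" "y \<in> chart_img c" "Y \<longlonglongrightarrow> y"
    and "V \<longlonglongrightarrow> v" "W \<longlonglongrightarrow> w"
  shows "(\<lambda>n. g c (Y n) (V n) (W n)) \<longlonglongrightarrow> g c y v w"
proof -
  let ?T = "\<lambda>z vs. g c z (vs ! 0) (vs ! 1)"
  have "(\<lambda>n. ?T (Y n) (map (\<lambda>W. W n) [V, W])) \<longlonglongrightarrow> ?T y [v, w]"
  proof (rule multilinear_tendsto[where U="chart_img c"])
    show "multilinear 2 (?T z)" if "z \<in> chart_img c" for z
      using metric_multilinear that c by blast
    show "(\<lambda>n. ?T (Y n) vs) \<longlonglongrightarrow> ?T y vs" for vs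
      using continuous_on_tendsto_compose[OF smooth_on_continuous[OF metric_smooth[OF c]] Y(3,2)] Y(1)
      by simp
  qed (use assms in auto)
  then show ?thesis by simp
qed

lemma form_tendsto:
  assumes \<beta>: "\<beta> \<in> forms A k" and c: "c \<in> A" and Y: "\<And>n::nat. Y n \<in> chart_img c" "y \<in> chart_img c" "Y \<longlonglongrightarrow> y"
    and W: "\<And>n. length (W n) = k" "length l = k" "\<And>i. i < k \<Longrightarrow> (\<lambda>n. W n ! i) \<longlonglongrightarrow> l ! i"
  shows "(\<lambda>n. \<beta> c (Y n) (W n)) \<longlonglongrightarrow> \<beta> c y l"
proof -
  let ?Ws = "map (\<lambda>i n. W n ! i) [0..<k]"
  have "(\<lambda>n. \<beta> c (Y n) (map (\<lambda>W. W n) ?Ws)) \<longlonglongrightarrow> \<beta> c y l"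
  proof (rule multilinear_tendsto[where U="chart_img c"])
    show "list_all2 (\<lambda>W l. W \<longlonglongrightarrow> l) ?Ws l"
      using W by (auto simp: list_all2_conv_all_nth)
    show "(\<lambda>n. \<beta> c (Y n) vs) \<longlonglongrightarrow> \<beta> c y vs" if "length vs = k" for vs
      using continuous_on_tendsto_compose[OF smooth_on_continuous[OF formsD(4)[OF \<beta> c that]] Y(3,2)] Y(1)
      by simp
  qed (use Y formsD(2)[OF \<beta> c] in auto)
  moreover have "map (\<lambda>W. W n) ?Ws = W n" for n
    using W(1) by (auto intro!: nth_equalityI)
  ultimately show ?thesis by simp
qed

text \<open>Otherwise, normalizing longer and longer unit vectors of the metric in the Euclidean norm would
  produce in the limit a nonzero vector of length zero.\<close>

lemma unit_vectors_bounded: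
  assumes c: "c \<in> A" and L: "compact L" "L \<subseteq> chart_img c"
  obtains R where "R \<ge> 0" "\<And>y w. y \<in> L \<Longrightarrow> g c y w w = 1 \<Longrightarrow> norm w \<le> R"
proof (rule ccontr)
  assume no: "\<not> thesis"
  have "\<exists>y w. y \<in> L \<and> g c y w w = 1 \<and> norm w > real (Suc n)" for n
    using no that[of "real (Suc n)"] by (force simp: not_le)
  then obtain Y W where YW: "\<And>n. Y n \<in> L" "\<And>n. g c (Y n) (W n) (W n) = 1" "\<And>n. norm (W n) > real (Suc n)" by metis
  obtain y r where r: "y \<in> L" "strict_mono r" "(Y \<circ> r) \<longlonglongrightarrow> y"
    using L(1) YW(1) unfolding compact_def by blast
  define V where "V n = (1 / norm (W n)) *\<^sub>R W n" for n
  have pos: "norm (W n) > 0" for n using YW(3)[of n] of_nat_0_le_iff[of "Suc n"] by linarith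
  then have V1: "norm (V n) = 1" for n by (simp add: V_def)
  then have "V (r n) \<in> sphere 0 1" for n by simp
  then obtain v s where s: "v \<in> sphere 0 1" "strict_mono s" "((\<lambda>n. V (r n)) \<circ> s) \<longlonglongrightarrow> v"
    using compact_sphere[of "0::real^'n" 1] unfolding compact_def by metis
  have "(\<lambda>n. g c (Y (r (s n))) (V (r (s n))) (V (r (s n)))) \<longlonglongrightarrow> g c y v v"
    using L YW(1) r(1) s(3) LIMSEQ_subseq_LIMSEQ[OF r(3) s(2)]
    by (intro metric_tendsto c) (auto simp: o_def)
  moreover have "(\<lambda>n. g c (Y (r (s n))) (V (r (s n))) (V (r (s n)))) \<longlonglongrightarrow> 0"
  proof (rule Lim_null_comparison[OF _ LIMSEQ_Suc[OF lim_1_over_n]], rule eventuallyI)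
    fix n
    let ?k = "r (s n)"
    have k: "in_chart c (Y ?k)" using YW(1) L c by auto
    have "g c (Y ?k) (V ?k) (V ?k) = 1 / (norm (W ?k) * norm (W ?k))"
      unfolding V_def by (simp add: linear_cmul[OF metric_linear1[OF k]] linear_cmul[OF metric_linear2[OF k]] YW(2))
    moreover have "real (Suc n) \<le> norm (W ?k) * norm (W ?k)"
    proof -
      have "n \<le> ?k" using seq_suble[OF strict_mono_o[OF r(2) s(2)], of n] by simp
      then have n: "real (Suc n) \<le> norm (W ?k)" using YW(3)[of ?k] by simp
      have "real (Suc n) * 1 \<le> norm (W ?k) * norm (W ?k)"
        using n by (intro mult_mono) auto
      then show ?thesis by simp
    qed
    ultimately show "norm (g c (Y ?k) (V ?k) (V ?k)) \<le> 1 / real (Suc n)"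
      by (simp add: frac_le)
  qed
  ultimately have "g c y v v = 0" by (rule LIMSEQ_unique)
  moreover have "g c y v v > 0"
  proof -
    have "v \<noteq> 0" using s(1) by auto
    then show ?thesis using metric_inner[of c y] r(1) L c unfolding inner_form_def by blast
  qed
  ultimately show False by simp
qed

text \<open>Orthonormal bases of \<open>\<phi>\<close>-planes over a compact set form a compact set, on which
  a positive continuous function is bounded away from zero; the argument is carried out with
  sequences.\<close>

lemma plane_values_bounded_below:
  assumes c: "c \<in> A" and L: "compact L" "L \<subseteq> chart_img c" and \<beta>: "\<beta> \<in> forms A (Suc q)"
    and pos: "\<And>y ws. y \<in> L \<Longrightarrow> (c, y, ws) \<in> planes \<Longrightarrow> orthonormal (g c y) ws \<Longrightarrow> \<beta> c y ws > 0"
  shows "\<exists>\<epsilon>>0. \<forall>y ws. y \<in> L \<longrightarrow> (c, y, ws) \<in> planes \<longrightarrow> orthonormal (g c y) ws \<longrightarrow> \<beta> c y ws \<ge> \<epsilon>"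
proof (rule ccontr)
  assume "\<not> ?thesis"
  then have "\<exists>y ws. y \<in> L \<and> (c, y, ws) \<in> planes \<and> orthonormal (g c y) ws \<and> \<beta> c y ws < 1 / real (Suc n)" for n
    by (metis not_le of_nat_0_less_iff zero_less_Suc zero_less_divide_1_iff)
  then obtain Y W where YW: "\<And>n. Y n \<in> L" "\<And>n. (c, Y n, W n) \<in> planes"
    "\<And>n. orthonormal (g c (Y n)) (W n)" "\<And>n. \<beta> c (Y n) (W n) < 1 / real (Suc n)" by metis
  have len: "length (W n) = Suc q" and one: "\<phi> c (Y n) (W n) = 1" for n
    using YW(2) by (auto simp: phi_planes_iff)
  obtain R where "R \<ge> 0" and R: "\<And>y w. y \<in> L \<Longrightarrow> g c y w w = 1 \<Longrightarrow> norm w \<le> R"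
    by (rule unit_vectors_bounded[OF c L], rule that; blast)
  obtain y r where r: "y \<in> L" "strict_mono r" "(Y \<circ> r) \<longlonglongrightarrow> y"
    using L(1) YW(1) unfolding compact_def by blast
  have "norm (W (r n) ! i) \<le> R" if "i < Suc q" for i n
    using R[OF YW(1)[of "r n"]] YW(3)[of "r n"] len[of "r n"] that by (simp add: orthonormal_def)
  then obtain s l where s: "strict_mono s" "\<And>i. i < Suc q \<Longrightarrow> (\<lambda>n. W (r (s n)) ! i) \<longlonglongrightarrow> l i"
    using bounded_family_subsequence[of "Suc q" "\<lambda>i n. W (r n) ! i"] by blast
  let ?Y = "\<lambda>n. Y (r (s n))" and ?W = "\<lambda>n. W (r (s n))" and ?l = "map l [0..<Suc q]"
  have Y: "\<And>n. ?Y n \<in> chart_img c" "y \<in> chart_img c" "?Y \<longlonglongrightarrow> y"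
    using L YW(1) r(1) LIMSEQ_subseq_LIMSEQ[OF r(3) s(1)] by (auto simp: o_def)
  have W: "\<And>n. length (?W n) = Suc q" "length ?l = Suc q" "\<And>i. i < Suc q \<Longrightarrow> (\<lambda>n. ?W n ! i) \<longlonglongrightarrow> ?l ! i"
    using len s(2) by (auto simp del: upt_Suc)
  have on: "orthonormal (g c y) ?l"
    unfolding orthonormal_def
  proof (intro allI impI)
    fix i j assume ij: "i < length ?l" "j < length ?l"
    then have "(\<lambda>n. g c (?Y n) (?W n ! i) (?W n ! j)) \<longlonglongrightarrow> g c y (?l ! i) (?l ! j)"
      by (intro metric_tendsto c Y W) auto
    moreover have "g c (?Y n) (?W n ! i) (?W n ! j) = (if i = j then 1 else 0)" for n
      using YW(3)[of "r (s n)"] len ij by (simp add: orthonormal_def)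
    ultimately have "(\<lambda>n. if i = j then 1 else 0) \<longlonglongrightarrow> g c y (?l ! i) (?l ! j)" by (simp only:)
    then show "g c y (?l ! i) (?l ! j) = (if i = j then 1 else 0)"
      by (rule LIMSEQ_unique) (rule tendsto_const)
  qed
  have "\<phi> c y ?l = 1"
    using form_tendsto[OF phi_form c Y W] one LIMSEQ_unique[OF _ tendsto_const] by (simp del: upt_Suc)
  then have "(c, y, ?l) \<in> planes"
    using c Y(2) gram_orthonormal[OF on] by (simp add: phi_planes_iff del: upt_Suc)
  then have "\<beta> c y ?l > 0" using pos on r(1) by blast
  moreover have "\<beta> c y ?l \<le> 0"
  proof (rule LIMSEQ_le)
    show "(\<lambda>n. \<beta> c (?Y n) (?W n)) \<longlonglongrightarrow> \<beta> c y ?l" by (rule form_tendsto[OF \<beta> c Y W])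
    show "(\<lambda>n. 1 / real (Suc n)) \<longlonglongrightarrow> 0" by (rule LIMSEQ_Suc[OF lim_1_over_n])
    have "\<beta> c (?Y n) (?W n) \<le> 1 / real (Suc n)" for n
    proof -
      have "n \<le> r (s n)" using seq_suble[OF strict_mono_o[OF r(2) s(1)], of n] by simp
      then have "1 / real (Suc (r (s n))) \<le> 1 / real (Suc n)" by (simp add: frac_le)
      then show ?thesis using YW(4)[of "r (s n)"] by linarith
    qed
    then show "\<exists>N. \<forall>n\<ge>N. \<beta> c (?Y n) (?W n) \<le> 1 / real (Suc n)" by blast
  qed
  ultimately show False by simp
qed

end

section \<open>Domination by exact forms\<close>

locale convex_calibrated = calibrated A g q \<phi>
  for A :: "('a::{t2_space,second_countable_topology}, 'n::finite) chart set" and g q \<phi> +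
  fixes f :: "'a \<Rightarrow> real"
  assumes f_smooth: "smooth_function A f"
    and f_psh: "strictly_phi_psh A g (Suc q) \<phi> f"
    and f_proper: "compact {x. f x \<le> r}"
begin

lemma ext_d_gradient_form_bounded_below:
  "\<exists>\<epsilon>>0. \<forall>(c, y, vs)\<in>planes. f (chart_inv c y) \<le> r \<longrightarrow> \<epsilon> \<le> ext_d A q (gradient_form f) c y vs"
proof -
  let ?\<beta> = "ext_d A q (gradient_form f)"
  have \<beta>: "?\<beta> \<in> forms A (Suc q)" by (rule ext_d_forms[OF gradient_form_forms[OF f_smooth]])
  obtain \<K> where K': "finite \<K> \<and> (\<forall>(c, L)\<in>\<K>. c \<in> A \<and> compact L \<and> L \<subseteq> chart_img c) \<and>
    (\<forall>x\<in>{x. f x \<le> r}. \<exists>(c, L)\<in>\<K>. x \<in> chart_dom c \<and> chart_map c x \<in> L)"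
    using finite_compact_charts[OF f_proper[of r]] by (elim exE)
  have K: "finite \<K>" "(c, L) \<in> \<K> \<Longrightarrow> c \<in> A \<and> compact L \<and> L \<subseteq> chart_img c"
    "f x \<le> r \<Longrightarrow> \<exists>(c, L)\<in>\<K>. x \<in> chart_dom c \<and> chart_map c x \<in> L" for c L x
    using K' by auto
  have pos: "?\<beta> c y ws > 0" if "(c, y, ws) \<in> planes" "orthonormal (g c y) ws" for c y ws
    using ext_d_gradient_form_plane[OF f_smooth that] f_psh that(1) unfolding strictly_phi_psh_def by force
  have "\<exists>\<epsilon>>0. \<forall>s\<in>\<K>. \<forall>y ws. y \<in> snd s \<longrightarrow> (fst s, y, ws) \<in> planes \<longrightarrow> orthonormal (g (fst s) y) ws \<longrightarrow> ?\<beta> (fst s) y ws \<ge> \<epsilon>"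
  proof (rule finite_uniform_positive[OF K(1)])
    fix s assume "s \<in> \<K>"
    then show "\<exists>\<epsilon>>0. \<forall>y ws. y \<in> snd s \<longrightarrow> (fst s, y, ws) \<in> planes \<longrightarrow> orthonormal (g (fst s) y) ws \<longrightarrow> ?\<beta> (fst s) y ws \<ge> \<epsilon>"
      using K(2)[of "fst s" "snd s"] pos by (intro plane_values_bounded_below \<beta>) auto
  qed (meson order_trans)
  then obtain \<epsilon> where e: "\<epsilon> > 0" "\<And>c L y ws. (c, L) \<in> \<K> \<Longrightarrow> y \<in> L \<Longrightarrow> (c, y, ws) \<in> planes \<Longrightarrow>
      orthonormal (g c y) ws \<Longrightarrow> ?\<beta> c y ws \<ge> \<epsilon>" by fastforce
  have "\<epsilon> \<le> ?\<beta> c y vs" if P: "(c, y, vs) \<in> planes" and r: "f (chart_inv c y) \<le> r" for c y vs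
  proof -
    obtain d L where d: "(d, L) \<in> \<K>" "chart_inv c y \<in> chart_dom d" "chart_map d (chart_inv c y) \<in> L"
      using K(3)[OF r] by auto
    then have dA: "d \<in> A" using K(2) by blast
    obtain us where us: "(d, chart_map d (chart_inv c y), us) \<in> planes"
      "?\<beta> c y vs = ?\<beta> d (chart_map d (chart_inv c y)) us"
      using plane_transfer[OF P dA d(2)] \<beta> by metis
    obtain ws where ws: "orthonormal (g d (chart_map d (chart_inv c y))) ws"
      "(d, chart_map d (chart_inv c y), ws) \<in> planes"
      "?\<beta> d (chart_map d (chart_inv c y)) us = ?\<beta> d (chart_map d (chart_inv c y)) ws"
      using orthonormal_plane[OF us(1)] formsD(2,3)[OF \<beta> dA] us(1) unfolding phi_planes_iff by metis
    show ?thesis using e(2)[OF d(1,3) ws(2,1)] us(2) ws(3) by simp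
  qed
  then show ?thesis using e(1) by (intro exI[of _ \<epsilon>]) auto
qed

text \<open>Over \<open>{f \<le> m}\<close> the derivative of the contracted form is at least some
  \<open>\<epsilon> m > 0\<close> on planes, so the weight \<open>h(f)\<close> has to be at least
  \<open>C m / \<epsilon> m\<close> there. The level of a point is rounded up to a natural
  number, and all levels \<open>f \<le> 0\<close> are collected in \<open>m = 0\<close>.\<close>

lemma exact_domination:
  fixes C :: "nat \<Rightarrow> real"
  obtains \<alpha> where "\<alpha> \<in> forms A q"
    "\<And>c y vs. (c, y, vs) \<in> planes \<Longrightarrow> C (nat \<lceil>f (chart_inv c y)\<rceil>) \<le> ext_d A q \<alpha> c y vs"
proof -
  have "\<forall>m. \<exists>\<epsilon>. \<epsilon> > 0 \<and> (\<forall>(c, y, vs)\<in>planes. f (chart_inv c y) \<le> real m \<longrightarrow>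
      \<epsilon> \<le> ext_d A q (gradient_form f) c y vs)"
    using ext_d_gradient_form_bounded_below by (intro allI)
  from choice[OF this] obtain \<epsilon> where e': "\<forall>m. \<epsilon> m > 0 \<and> (\<forall>(c, y, vs)\<in>planes.
      f (chart_inv c y) \<le> real m \<longrightarrow> \<epsilon> m \<le> ext_d A q (gradient_form f) c y vs)" ..
  then have e: "\<epsilon> m > 0" "(c, y, vs) \<in> planes \<Longrightarrow> f (chart_inv c y) \<le> real m \<Longrightarrow>
      \<epsilon> m \<le> ext_d A q (gradient_form f) c y vs" for m c y vs
    by auto
  obtain h0 where h0: "smooth_on h0 UNIV" "\<And>x. 0 \<le> h0 x" "mono h0"
    "\<And>m x. real m \<le> x \<Longrightarrow> \<bar>C (Suc m)\<bar> / \<epsilon> (Suc m) \<le> h0 x"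
    using smooth_fast_increasing[of "\<lambda>m. \<bar>C (Suc m)\<bar> / \<epsilon> (Suc m)"] by metis
  \<comment> \<open>the constant takes care of all points with \<open>f \<le> 0\<close>, of which
    \<open>h0\<close> knows nothing\<close>
  define h where "h x = h0 x + \<bar>C 0\<bar> / \<epsilon> 0" for x
  have h: "smooth_on h UNIV" "mono h"
    unfolding h_def[abs_def] using h0 by (auto intro!: smooth_on_add simp: mono_def)
  have hC: "\<bar>C (nat \<lceil>t\<rceil>)\<bar> / \<epsilon> (nat \<lceil>t\<rceil>) \<le> h t" for t
  proof (cases "nat \<lceil>t\<rceil>")
    case 0
    then show ?thesis using h0(2)[of t] by (simp add: h_def)
  next
    case (Suc m)
    then have "real m \<le> t" by linarith
    then have "\<bar>C (Suc m)\<bar> / \<epsilon> (Suc m) \<le> h0 t" by (rule h0(4))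
    also have "\<dots> \<le> h t" using e(1)[of 0] by (simp add: h_def)
    finally show ?thesis by (simp add: Suc)
  qed
  let ?\<alpha> = "fun_times_form (\<lambda>x. h (f x)) (gradient_form f)"
  have \<alpha>: "?\<alpha> \<in> forms A q"
    by (rule fun_times_form_forms[OF smooth_function_compose[OF h(1) f_smooth] gradient_form_forms[OF f_smooth]])
  show thesis
  proof (rule that[OF \<alpha>])
    fix c y vs assume P: "(c, y, vs) \<in> planes"
    then have cy: "in_chart c y" by (simp add: phi_planes_iff)
    let ?m = "nat \<lceil>f (chart_inv c y)\<rceil>"
    obtain ws where ws: "orthonormal (g c y) ws" "(c, y, ws) \<in> planes"
      "ext_d A q ?\<alpha> c y vs = ext_d A q ?\<alpha> c y ws"
      using orthonormal_plane[OF P] formsD(2,3)[OF ext_d_forms[OF \<alpha>]] cy by metis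
    have "f (chart_inv c y) \<le> real ?m" by linarith
    then have "\<epsilon> ?m \<le> ext_d A q (gradient_form f) c y ws" by (rule e(2)[OF ws(2)])
    then have E: "\<epsilon> ?m \<le> phi_hessian g \<phi> f c y ws" by (simp add: ext_d_gradient_form_plane[OF f_smooth ws(2,1)])
    have "C ?m \<le> \<bar>C ?m\<bar> / \<epsilon> ?m * \<epsilon> ?m" using e(1)[of ?m] by simp
    also have "\<dots> \<le> h (f (chart_inv c y)) * phi_hessian g \<phi> f c y ws"
      using e(1)[of ?m] by (intro mult_mono hC E order_trans[OF _ hC]) auto
    also have "\<dots> \<le> ext_d A q ?\<alpha> c y ws"
      by (rule ext_d_weighted_gradient_form[OF f_smooth h ws(2,1)])
    finally show "C ?m \<le> ext_d A q ?\<alpha> c y vs" using ws(3) by simp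
  qed
qed

text \<open>Orthonormal bases over finitely many compact pieces of charts consist of bounded vectors, so
  \<open>multilinear_bound\<close> applies. Continuity of functionals needs the constants to be the
  same for all forms.\<close>

lemma plane_values_bound:
  "\<exists>F R. finite F \<and> R > 0 \<and>
    (\<forall>(c, L, bs)\<in>F. c \<in> A \<and> compact L \<and> L \<subseteq> chart_img c \<and> set bs \<subseteq> Basis \<and> length bs = Suc q) \<and>
    (\<forall>\<beta>\<in>forms A (Suc q). \<forall>B. 0 \<le> B \<longrightarrow> (\<forall>(c, L, bs)\<in>F. \<forall>y\<in>L. \<bar>\<beta> c y bs\<bar> \<le> B) \<longrightarrow>
      (\<forall>(c, y, vs)\<in>planes. f (chart_inv c y) \<le> r \<longrightarrow> \<bar>\<beta> c y vs\<bar> \<le> R * B))"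
proof -
  obtain \<K> where K': "finite \<K> \<and> (\<forall>(c, L)\<in>\<K>. c \<in> A \<and> compact L \<and> L \<subseteq> chart_img c) \<and>
    (\<forall>x\<in>{x. f x \<le> r}. \<exists>(c, L)\<in>\<K>. x \<in> chart_dom c \<and> chart_map c x \<in> L)"
    using finite_compact_charts[OF f_proper[of r]] by (elim exE)
  have K: "finite \<K>" "(c, L) \<in> \<K> \<Longrightarrow> c \<in> A \<and> compact L \<and> L \<subseteq> chart_img c"
    "f x \<le> r \<Longrightarrow> \<exists>(c, L)\<in>\<K>. x \<in> chart_dom c \<and> chart_map c x \<in> L" for c L x
    using K' by auto
  let ?B = "{bs::(real^'n) list. set bs \<subseteq> Basis \<and> length bs = Suc q}"
  have finB: "finite ?B" by (rule finite_lists_length_eq) simp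
  have "\<exists>\<epsilon>>0. \<forall>s\<in>\<K>. \<forall>y\<in>snd s. \<forall>w. g (fst s) y w w = 1 \<longrightarrow> norm w \<le> 1 / \<epsilon>"
  proof (rule finite_uniform_positive[OF K(1)])
    fix s assume "s \<in> \<K>"
    then obtain R where R: "R \<ge> 0" "\<And>y w. y \<in> snd s \<Longrightarrow> g (fst s) y w w = 1 \<Longrightarrow> norm w \<le> R"
      using K(2)[of "fst s" "snd s"] unit_vectors_bounded[of "fst s" "snd s"] by auto
    have "norm w \<le> 1 / (1 / (R + 1))" if "y \<in> snd s" "g (fst s) y w w = 1" for y w
      using R(2)[OF that] by simp
    then show "\<exists>\<epsilon>>0. \<forall>y\<in>snd s. \<forall>w. g (fst s) y w w = 1 \<longrightarrow> norm w \<le> 1 / \<epsilon>"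
      using R(1) by (intro exI[of _ "1 / (R + 1)"]) auto
  next
    fix s and \<epsilon> \<delta> :: real
    assume a: "\<forall>y\<in>snd s. \<forall>w. g (fst s) y w w = 1 \<longrightarrow> norm w \<le> 1 / \<epsilon>" and d: "0 < \<delta>" "\<delta> \<le> \<epsilon>"
    have "1 / \<epsilon> \<le> 1 / \<delta>" using d by (simp add: frac_le)
    then show "\<forall>y\<in>snd s. \<forall>w. g (fst s) y w w = 1 \<longrightarrow> norm w \<le> 1 / \<delta>"
      using a order_trans by blast
  qed
  then obtain \<epsilon> where e: "\<epsilon> > 0" "\<And>c L y w. (c, L) \<in> \<K> \<Longrightarrow> y \<in> L \<Longrightarrow> g c y w w = 1 \<Longrightarrow> norm w \<le> 1 / \<epsilon>"
    by fastforce
  let ?F = "(\<lambda>((c, L), bs). (c, L, bs)) ` (\<K> \<times> ?B)" and ?R = "(1 / \<epsilon>) ^ Suc q * (real (card ?B) + 1)"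
  show ?thesis
  proof (intro exI[of _ ?F] exI[of _ ?R] conjI ballI allI impI)
    show "finite ?F" using K(1) finB by simp
    show "?R > 0" using e(1) by simp
    show "case x of (c, L, bs) \<Rightarrow> c \<in> A \<and> compact L \<and> L \<subseteq> chart_img c \<and> set bs \<subseteq> Basis \<and> length bs = Suc q" if "x \<in> ?F" for x
      using that K(2) by auto
  next
    fix \<beta> B and x :: "('a, 'n) chart \<times> (real^'n) \<times> (real^'n) list"
    assume \<beta>: "\<beta> \<in> forms A (Suc q)" and B: "0 \<le> B"
      and bound: "\<forall>(c, L, bs)\<in>?F. \<forall>y\<in>L. \<bar>\<beta> c y bs\<bar> \<le> B" and x: "x \<in> planes"
    obtain c y vs where xe: "x = (c, y, vs)" by (cases x)
    have "\<bar>\<beta> c y vs\<bar> \<le> ?R * B" if r: "f (chart_inv c y) \<le> r"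
    proof -
      have P: "(c, y, vs) \<in> planes" using x xe by simp
      obtain d L where d: "(d, L) \<in> \<K>" "chart_inv c y \<in> chart_dom d" "chart_map d (chart_inv c y) \<in> L"
        using K(3)[OF r] by auto
      then have dA: "d \<in> A" using K(2) by blast
      let ?z = "chart_map d (chart_inv c y)"
      obtain us where us: "(d, ?z, us) \<in> planes" "\<beta> c y vs = \<beta> d ?z us"
        using plane_transfer[OF P dA d(2)] \<beta> by metis
      then have z: "in_chart d ?z" by (simp add: phi_planes_iff)
      obtain ws where ws: "orthonormal (g d ?z) ws" "(d, ?z, ws) \<in> planes" "\<beta> d ?z us = \<beta> d ?z ws"
        using orthonormal_plane[OF us(1)] formsD(2,3)[OF \<beta>] z by metis
      have len: "length ws = Suc q" using ws(2) by (simp add: phi_planes_iff)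
      have "norm w \<le> 1 / \<epsilon>" if "w \<in> set ws" for w
        using that ws(1) e(2)[OF d(1,3), of w] by (auto simp: in_set_conv_nth orthonormal_def)
      then have b: "\<bar>\<beta> d ?z ws\<bar> \<le> (1 / \<epsilon>) ^ Suc q * (\<Sum>bs\<in>?B. \<bar>\<beta> d ?z bs\<bar>)"
        using e(1) z by (intro multilinear_bound formsD(2)[OF \<beta>] len) auto
      have "(\<Sum>bs\<in>?B. \<bar>\<beta> d ?z bs\<bar>) \<le> (\<Sum>bs\<in>?B. B)"
        using bound d by (intro sum_mono) force
      also have "(\<Sum>bs\<in>?B. B) \<le> (real (card ?B) + 1) * B" using B by (simp add: algebra_simps)
      finally have "(1 / \<epsilon>) ^ Suc q * (\<Sum>bs\<in>?B. \<bar>\<beta> d ?z bs\<bar>) \<le> ?R * B"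
        unfolding mult.assoc using e(1) by (intro mult_left_mono) auto
      then show ?thesis using b us(2) ws(3) by linarith
    qed
    then show "case x of (c, y, vs) \<Rightarrow> f (chart_inv c y) \<le> r \<longrightarrow> \<bar>\<beta> c y vs\<bar> \<le> ?R * B"
      by (simp add: xe)
  qed
qed

end

section \<open>Positive extension of linear functionals\<close>

instantiation "fun" :: (type, real_vector) real_vector
begin

definition scaleR_fun :: "real \<Rightarrow> ('a \<Rightarrow> 'b) \<Rightarrow> 'a \<Rightarrow> 'b" where
  "scaleR_fun r u = (\<lambda>x. r *\<^sub>R u x)"

instance
  by standard (simp_all add: scaleR_fun_def fun_eq_iff algebra_simps)

end

lemma scaleR_fun_apply [simp]: "(r *\<^sub>R u) x = r *\<^sub>R u x"
  by (simp add: scaleR_fun_def)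

text \<open>M. Riesz' extension theorem. A partial extension is represented by its graph, a subspace of the
  product with the real line, so that extension is inclusion. Positivity already makes such a graph
  single valued, because the pairs \<open>(0, r)\<close> in it satisfy both
  \<open>0 \<le> r\<close> and \<open>0 \<le> - r\<close>. A maximal graph is defined
  everywhere, since the value at a further point can be chosen between the values forced from below
  and from above; domination makes both kinds of constraints nonempty.\<close>

lemma positive_extension:
  fixes V P :: "'v::real_vector set" and G0 :: "('v \<times> real) set"
  assumes V: "subspace V" and G0: "subspace G0" "fst ` G0 \<subseteq> V"
    and P: "0 \<in> P" "\<And>x y. x \<in> P \<Longrightarrow> y \<in> P \<Longrightarrow> x + y \<in> P" "\<And>x t. x \<in> P \<Longrightarrow> 0 < t \<Longrightarrow> t *\<^sub>R x \<in> P"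
    and pos: "\<And>v r. (v, r) \<in> G0 \<Longrightarrow> v \<in> P \<Longrightarrow> 0 \<le> r"
    and dom: "\<And>x. x \<in> V \<Longrightarrow> \<exists>(v, r)\<in>G0. v - x \<in> P"
  shows "\<exists>T. (\<forall>x\<in>V. \<forall>y\<in>V. \<forall>a b. T (a *\<^sub>R x + b *\<^sub>R y) = a * T x + b * T y) \<and>
    (\<forall>x\<in>V. x \<in> P \<longrightarrow> 0 \<le> T x) \<and> (\<forall>(v, r)\<in>G0. T v = r)"
proof -
  let ?\<G> = "{G. subspace G \<and> G0 \<subseteq> G \<and> fst ` G \<subseteq> V \<and> (\<forall>(v, r)\<in>G. v \<in> P \<longrightarrow> 0 \<le> r)}"
  have "\<exists>M\<in>?\<G>. \<forall>X\<in>?\<G>. M \<subseteq> X \<longrightarrow> X = M"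
  proof (rule subset_Zorn_nonempty)
    have "G0 \<in> ?\<G>" using G0 pos by auto
    then show "?\<G> \<noteq> {}" by blast
    fix \<C> assume ne: "\<C> \<noteq> {}" and ch: "subset.chain ?\<G> \<C>"
    then have mem: "G \<in> ?\<G>" if "G \<in> \<C>" for G using that by (auto simp: subset_chain_def)
    have "subspace (\<Union>\<C>)"
      unfolding subspace_def
    proof (intro conjI ballI allI)
      obtain G where "G \<in> \<C>" using ne by blast
      then show "0 \<in> \<Union>\<C>" using mem[of G] subspace_0[of G] by blast
    next
      fix x y assume "x \<in> \<Union>\<C>" "y \<in> \<Union>\<C>"
      then obtain G H where GH: "G \<in> \<C>" "x \<in> G" "H \<in> \<C>" "y \<in> H" by blast
      then have "G \<subseteq> H \<or> H \<subseteq> G" using ch by (auto simp: subset_chain_def)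
      then obtain K where "K \<in> \<C>" "x \<in> K" "y \<in> K" using GH by blast
      then show "x + y \<in> \<Union>\<C>" using mem[of K] subspace_add[of K x y] by blast
    next
      fix x t assume "x \<in> \<Union>\<C>"
      then obtain G where "G \<in> \<C>" "x \<in> G" by blast
      then show "t *\<^sub>R x \<in> \<Union>\<C>" using mem[of G] subspace_scale[of G x t] by blast
    qed
    moreover have "G0 \<subseteq> \<Union>\<C>"
    proof -
      obtain G where "G \<in> \<C>" using ne by blast
      then show ?thesis using mem[of G] by blast
    qed
    moreover have "fst ` \<Union>\<C> \<subseteq> V"
    proof
      fix x assume "x \<in> fst ` \<Union>\<C>"
      then obtain G where "G \<in> \<C>" "x \<in> fst ` G" by blast
      then show "x \<in> V" using mem[of G] by blast
    qed
    moreover have "\<forall>(v, r)\<in>\<Union>\<C>. v \<in> P \<longrightarrow> 0 \<le> r"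
    proof clarify
      fix v r G assume "G \<in> \<C>" "(v, r) \<in> G" "v \<in> P"
      then show "0 \<le> r" using mem[of G] by blast
    qed
    ultimately show "\<Union>\<C> \<in> ?\<G>" by (intro CollectI conjI)
  qed
  then obtain G where G': "G \<in> ?\<G>" "\<forall>X\<in>?\<G>. G \<subseteq> X \<longrightarrow> X = G" ..
  then have G: "subspace G" "G0 \<subseteq> G" "fst ` G \<subseteq> V" "(v, r) \<in> G \<Longrightarrow> v \<in> P \<Longrightarrow> 0 \<le> r" for v r by auto
  have max: "X = G" if "X \<in> ?\<G>" "G \<subseteq> X" for X using bspec[OF G'(2) that(1)] that(2) by (rule mp)
  have lin: "(a *\<^sub>R v + b *\<^sub>R w, a * r + b * s) \<in> G" if "(v, r) \<in> G" "(w, s) \<in> G" for a b v w r s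
    using subspace_add[OF G(1) subspace_scale[OF G(1) that(1), of a] subspace_scale[OF G(1) that(2), of b]] by simp
  have uniq: "r = s" if "(v, r) \<in> G" "(v, s) \<in> G" for v r s
  proof -
    have "0 \<le> r - s" "0 \<le> s - r"
      using G(4)[OF _ P(1), of "r - s"] G(4)[OF _ P(1), of "s - r"]
        lin[OF that, of 1 "-1"] lin[OF that, of "-1" 1] by simp_all
    then show ?thesis by simp
  qed
  have total: "x \<in> fst ` G" if x: "x \<in> V" for x
  proof -
    \<comment> \<open>the lower and upper constraints that positivity puts on the value at \<open>x\<close>\<close>
    define Lo where "Lo = {r. \<exists>v. (v, r) \<in> G \<and> x - v \<in> P}"
    define Hi where "Hi = {r. \<exists>v. (v, r) \<in> G \<and> v - x \<in> P}"
    have le: "r \<le> s" if rs: "r \<in> Lo" "s \<in> Hi" for r s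
    proof -
      obtain v w where v: "(v, r) \<in> G" "x - v \<in> P" and w: "(w, s) \<in> G" "w - x \<in> P"
        using rs by (auto simp: Lo_def Hi_def)
      have "w - v \<in> P" using P(2)[OF w(2) v(2)] by simp
      moreover have "(w - v, s - r) \<in> G" using lin[OF w(1) v(1), of 1 "-1"] by simp
      ultimately have "0 \<le> s - r" using G(4) by blast
      then show ?thesis by simp
    qed
    obtain s where s: "s \<in> Hi" using dom[OF x] G(2) by (auto simp: Hi_def)
    obtain v r where "(v, r) \<in> G0" "v - (- x) \<in> P" using dom[OF subspace_neg[OF V x]] by auto
    then have "(- v, - r) \<in> G \<and> x - (- v) \<in> P"
      using subspace_neg[OF G(1), of "(v, r)"] G(2) by (auto simp: add.commute)
    then have Lo: "- r \<in> Lo" unfolding Lo_def by blast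
    define c where "c = Sup Lo"
    have c_lo: "r \<le> c" if "r \<in> Lo" for r
      unfolding c_def using that le[OF _ s] by (intro cSup_upper) (auto simp: bdd_above_def)
    have c_hi: "c \<le> s" if "s \<in> Hi" for s
      unfolding c_def using Lo le[OF _ that] by (intro cSup_least) auto
    let ?X = "{u + t *\<^sub>R (x, c) | u t. u \<in> G}"
    have "?X \<in> ?\<G>"
    proof (intro CollectI conjI)
      show "subspace ?X"
        unfolding subspace_def
      proof (intro conjI ballI allI)
        show "0 \<in> ?X" using subspace_0[OF G(1)]
          by (intro CollectI exI[of _ 0]) (auto simp: zero_prod_def)
      next
        fix y z assume "y \<in> ?X" "z \<in> ?X"
        then obtain u v s t where "y = u + s *\<^sub>R (x, c)" "z = v + t *\<^sub>R (x, c)" "u \<in> G" "v \<in> G" by blast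
        then show "y + z \<in> ?X"
          using subspace_add[OF G(1), of u v]
          by (intro CollectI exI[of _ "u + v"] exI[of _ "s + t"]) (simp add: algebra_simps)
      next
        fix y a assume "y \<in> ?X"
        then obtain u s where "y = u + s *\<^sub>R (x, c)" "u \<in> G" by blast
        then show "a *\<^sub>R y \<in> ?X"
          using subspace_scale[OF G(1), of u a]
          by (intro CollectI exI[of _ "a *\<^sub>R u"] exI[of _ "a * s"]) (simp add: algebra_simps)
      qed
      show "G0 \<subseteq> ?X"
      proof
        fix u assume "u \<in> G0"
        then show "u \<in> ?X" using G(2) by (intro CollectI exI[of _ u] exI[of _ 0]) (auto simp: zero_prod_def)
      qed
      show "fst ` ?X \<subseteq> V"
        using G(3) x subspace_add[OF V] subspace_scale[OF V x] by fastforce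
      show "\<forall>(v, r)\<in>?X. v \<in> P \<longrightarrow> 0 \<le> r"
      proof (rule ballI)
        fix z assume "z \<in> ?X"
        then obtain u t where z: "z = u + t *\<^sub>R (x, c)" "u \<in> G" by blast
        obtain w b where u: "u = (w, b)" by (cases u)
        have G': "(w, b) \<in> G" using z u by simp
        have "0 \<le> b + t * c" if w: "w + t *\<^sub>R x \<in> P"
        proof -
          consider "t = 0" | "t > 0" | "t < 0" by linarith
          then show ?thesis
          proof cases
            case 1
            then show ?thesis using w G(4)[OF G'] by simp
          next
            case 2
            have "x - (- (1 / t)) *\<^sub>R w = (1 / t) *\<^sub>R (w + t *\<^sub>R x)" using 2 by (simp add: algebra_simps)
            then have "x - (- (1 / t)) *\<^sub>R w \<in> P" using P(3)[OF w, of "1 / t"] 2 by simp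
            moreover have "((- (1 / t)) *\<^sub>R w, (- (1 / t)) * b) \<in> G" using lin[OF G' G', of "- (1 / t)" 0] by simp
            ultimately have "(- (1 / t)) * b \<in> Lo" unfolding Lo_def by blast
            then have "(- (1 / t)) * b \<le> c" by (rule c_lo)
            then show ?thesis using 2 by (simp add: field_simps)
          next
            case 3
            have "(- (1 / t)) *\<^sub>R w - x = (- (1 / t)) *\<^sub>R (w + t *\<^sub>R x)" using 3 by (simp add: algebra_simps)
            then have "(- (1 / t)) *\<^sub>R w - x \<in> P" using P(3)[OF w, of "- (1 / t)"] 3 by simp
            moreover have "((- (1 / t)) *\<^sub>R w, (- (1 / t)) * b) \<in> G" using lin[OF G' G', of "- (1 / t)" 0] by simp
            ultimately have "(- (1 / t)) * b \<in> Hi" unfolding Hi_def by blast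
            then have "c \<le> (- (1 / t)) * b" by (rule c_hi)
            then show ?thesis using 3 by (simp add: field_simps)
          qed
        qed
        then show "case z of (v, r) \<Rightarrow> v \<in> P \<longrightarrow> 0 \<le> r" by (simp add: z u)
      qed
    qed
    moreover have "G \<subseteq> ?X"
    proof
      fix u assume "u \<in> G"
      then show "u \<in> ?X" by (intro CollectI exI[of _ u] exI[of _ 0]) (auto simp: zero_prod_def)
    qed
    ultimately have "?X = G" by (rule max)
    moreover have "(x, c) \<in> ?X"
      using subspace_0[OF G(1)] by (intro CollectI exI[of _ 0] exI[of _ 1]) (auto simp: zero_prod_def)
    ultimately show ?thesis by force
  qed
  define T where "T x = (THE r. (x, r) \<in> G)" for x
  have T: "T v = r" if "(v, r) \<in> G" for v r
    unfolding T_def using that uniq by blast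
  have TG: "(x, T x) \<in> G" if "x \<in> V" for x
    using total[OF that] T by fastforce
  show ?thesis
  proof (intro exI[of _ T] conjI ballI allI impI)
    fix x y a b assume "x \<in> V" "y \<in> V"
    then show "T (a *\<^sub>R x + b *\<^sub>R y) = a * T x + b * T y" by (intro T lin TG)
  next
    fix x assume "x \<in> V" "x \<in> P"
    then show "0 \<le> T x" using TG G(4) by blast
  next
    fix u assume "u \<in> G0"
    then show "case u of (v, r) \<Rightarrow> T v = r" using T G(2) by auto
  qed
qed

section \<open>Currents with compact support\<close>

lemma iter_deriv_cong_open:
  fixes U :: "'e::real_normed_vector set"
  assumes "open U" "y \<in> U" "\<And>z. z \<in> U \<Longrightarrow> u z = v z"
  shows "iter_deriv us u y = iter_deriv us v y"
  using assms(3)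
proof (induction us arbitrary: u v)
  case Nil
  then show ?case using assms(2) by simp
next
  case (Cons w us)
  have "iter_deriv us (\<lambda>y. frechet_derivative u (at y) w) y = iter_deriv us (\<lambda>y. frechet_derivative v (at y) w) y"
    using frechet_derivative_cong_open[OF assms(1) _ Cons.prems] by (intro Cons.IH) simp
  then show ?case by simp
qed

lemma current_linear:
  assumes "T \<in> currents A k" "\<omega> \<in> forms A k" "\<eta> \<in> forms A k"
  shows "T (\<lambda>c y vs. a * \<omega> c y vs + b * \<eta> c y vs) = a * T \<omega> + b * T \<eta>"
  using assms unfolding currents_def by blast

context atlas
begin

text \<open>A neighbourhood given by the empty compact set imposes no condition.\<close>

lemma topspace_form_topology: "topspace (form_topology A k) = forms A k"
proof -
  obtain c where c: "c \<in> A" using charts_cover by blast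
  obtain b where b: "b \<in> (Basis :: (real^'n) set)" using nonempty_Basis by blast
  have "\<omega> \<in> form_nbhd A k c {} [] (replicate k b) \<omega> 1" if "\<omega> \<in> forms A k" for \<omega>
    using that by (simp add: form_nbhd_def)
  moreover have "form_nbhd A k c {} [] (replicate k b) \<omega> 1 \<in>
      {form_nbhd A k c K us vs \<omega> e | c K us vs \<omega> e.
        c \<in> A \<and> compact K \<and> K \<subseteq> chart_img c \<and> set us \<subseteq> Basis \<and> set vs \<subseteq> Basis \<and> length vs = k \<and>
        \<omega> \<in> forms A k \<and> e > 0}" if "\<omega> \<in> forms A k" for \<omega>
    using that c b by (intro CollectI exI conjI) auto
  ultimately have "forms A k \<subseteq> topspace (form_topology A k)"
    unfolding form_topology_def topology_generated_by_topspace by (intro subsetI UnionI)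
  moreover have "topspace (form_topology A k) \<subseteq> forms A k"
    unfolding form_topology_def topology_generated_by_topspace by (auto simp: form_nbhd_def)
  ultimately show ?thesis by blast
qed

lemma openin_form_nbhd:
  assumes "c \<in> A" "compact K" "K \<subseteq> chart_img c" "set us \<subseteq> Basis" "set vs \<subseteq> Basis" "length vs = k"
    "\<omega> \<in> forms A k" "e > 0"
  shows "openin (form_topology A k) (form_nbhd A k c K us vs \<omega> e)"
  unfolding form_topology_def using assms by (intro topology_generated_by_Basis) blast

lemma zero_form_forms: "zero_form \<in> forms A k"
  by (rule formsI) (auto simp: zero_form_def multilinear_def alternating_def linear_iff open_img)

lemma subspace_forms: "subspace (forms A k)"
proof -
  have "(0 :: ('a, 'n) form) = zero_form" by (simp add: zero_form_def fun_eq_iff)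
  moreover have "x + y \<in> forms A k" if "x \<in> forms A k" "y \<in> forms A k" for x y
  proof -
    have "x + y = (\<lambda>c y' vs. 1 * x c y' vs + 1 * y c y' vs)" by (simp add: fun_eq_iff)
    then show ?thesis using forms_combination[OF that, of 1 1] by simp
  qed
  moreover have "t *\<^sub>R x \<in> forms A k" if "x \<in> forms A k" for x t
  proof -
    have "t *\<^sub>R x = (\<lambda>c y' vs. t * x c y' vs + 0 * x c y' vs)" by (simp add: fun_eq_iff)
    then show ?thesis using forms_combination[OF that that, of t 0] by simp
  qed
  ultimately show ?thesis using zero_form_forms by (simp add: subspace_def)
qed

text \<open>A neighbourhood of zero only restricts a form on finitely many compact sets, on each of which
  \<open>f\<close> is bounded. Subbasic neighbourhoods need not be centred at zero, which is
  harmless as the derivatives of \<open>\<eta> - \<omega>\<close> are those of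
  \<open>- \<omega>\<close> wherever \<open>\<eta>\<close> vanishes identically nearby.\<close>

lemma open_set_contains_small_forms:
  fixes f :: "'a \<Rightarrow> real"
  assumes f: "smooth_function A f" and U: "openin (form_topology A k) U" and 0: "zero_form \<in> U"
  shows "\<exists>r. \<forall>\<eta>\<in>forms A k. (\<forall>c\<in>A. \<forall>y\<in>chart_img c. f (chart_inv c y) < r \<longrightarrow> (\<forall>vs. \<eta> c y vs = 0)) \<longrightarrow> \<eta> \<in> U"
proof -
  have "generate_topology_on {form_nbhd A k c K us vs \<omega> e | c K us vs \<omega> e.
        c \<in> A \<and> compact K \<and> K \<subseteq> chart_img c \<and> set us \<subseteq> Basis \<and> set vs \<subseteq> Basis \<and> length vs = k \<and>
        \<omega> \<in> forms A k \<and> e > 0} U"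
    using U unfolding form_topology_def by (rule openin_topology_generated_by)
  then show ?thesis using 0
  proof (induction rule: generate_topology_on.induct)
    case Empty
    then show ?case by simp
  next
    case (Int a b)
    then obtain r s where
      "\<forall>\<eta>\<in>forms A k. (\<forall>c\<in>A. \<forall>y\<in>chart_img c. f (chart_inv c y) < r \<longrightarrow> (\<forall>vs. \<eta> c y vs = 0)) \<longrightarrow> \<eta> \<in> a"
      "\<forall>\<eta>\<in>forms A k. (\<forall>c\<in>A. \<forall>y\<in>chart_img c. f (chart_inv c y) < s \<longrightarrow> (\<forall>vs. \<eta> c y vs = 0)) \<longrightarrow> \<eta> \<in> b"
      by auto
    then show ?case by (intro exI[of _ "max r s"]) (auto simp: less_max_iff_disj)
  next
    case (UN K)
    then obtain a where a: "a \<in> K" "zero_form \<in> a" by blast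
    from UN.IH[OF this] show ?case using a(1) by (meson UnionI)
  next
    case (Basis U)
    then obtain c K us vs \<omega> e where U: "U = form_nbhd A k c K us vs \<omega> e"
      and K: "c \<in> A" "compact K" "K \<subseteq> chart_img c" by blast
    have cont: "continuous_on (chart_img c) (\<lambda>y. f (chart_inv c y))"
      by (rule smooth_on_continuous[OF smooth_functionD[OF f K(1)]])
    have "compact ((\<lambda>y. f (chart_inv c y)) ` K)"
      by (rule compact_continuous_image[OF continuous_on_subset[OF cont K(3)] K(2)])
    then obtain B where B: "\<And>y. y \<in> K \<Longrightarrow> f (chart_inv c y) \<le> B"
      using compact_imp_bounded bounded_imp_bdd_above by (metis (no_types, lifting) bdd_above.unfold imageI)
    let ?V = "chart_img c \<inter> (\<lambda>y. f (chart_inv c y)) -` {..<B + 1}"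
    have V: "open ?V"
      by (rule continuous_open_preimage[OF cont open_img[OF K(1)] open_lessThan])
    show ?case
    proof (intro exI[of _ "B + 1"] ballI impI)
      fix \<eta> assume \<eta>: "\<eta> \<in> forms A k"
        and z: "\<forall>c\<in>A. \<forall>y\<in>chart_img c. f (chart_inv c y) < B + 1 \<longrightarrow> (\<forall>vs. \<eta> c y vs = 0)"
      have "iter_deriv us (\<lambda>z. \<eta> c z vs - \<omega> c z vs) y = iter_deriv us (\<lambda>z. zero_form c z vs - \<omega> c z vs) y"
        if y: "y \<in> K" for y
        by (rule iter_deriv_cong_open[OF V]) (use y B[OF y] K z in \<open>auto simp: zero_form_def\<close>)
      then show "\<eta> \<in> U" using Basis.prems \<eta> unfolding U form_nbhd_def by simp
    qed
  qed
qed

text \<open>Compactness of the support. All multiples of a form that lives far out lie in the neighbourhood of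
  zero on which the current is smaller than one in absolute value.\<close>

lemma current_vanishes_far_out:
  fixes f :: "'a \<Rightarrow> real"
  assumes f: "smooth_function A f" and T: "T \<in> currents A k"
  obtains r where "\<And>\<eta>. \<eta> \<in> forms A k \<Longrightarrow>
    (\<And>c y vs. c \<in> A \<Longrightarrow> y \<in> chart_img c \<Longrightarrow> f (chart_inv c y) < r \<Longrightarrow> \<eta> c y vs = 0) \<Longrightarrow> T \<eta> = 0"
proof -
  have T0: "T zero_form = 0"
    using current_linear[OF T zero_form_forms zero_form_forms, of 0 0] by (simp add: zero_form_def)
  let ?U = "{\<omega> \<in> topspace (form_topology A k). T \<omega> \<in> {-1<..<1}}"
  have "continuous_map (form_topology A k) euclideanreal T" using T by (simp add: currents_def)
  then have "openin (form_topology A k) ?U"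
    by (rule openin_continuous_map_preimage) (simp add: open_openin[symmetric])
  moreover have "zero_form \<in> ?U" using T0 zero_form_forms by (simp add: topspace_form_topology)
  ultimately obtain r where r: "\<forall>\<eta>\<in>forms A k.
      (\<forall>c\<in>A. \<forall>y\<in>chart_img c. f (chart_inv c y) < r \<longrightarrow> (\<forall>vs. \<eta> c y vs = 0)) \<longrightarrow> \<eta> \<in> ?U"
    using open_set_contains_small_forms[OF f] by meson
  show thesis
  proof (rule that[of r])
    fix \<eta> assume \<eta>: "\<eta> \<in> forms A k"
      and z: "\<And>c y vs. c \<in> A \<Longrightarrow> y \<in> chart_img c \<Longrightarrow> f (chart_inv c y) < r \<Longrightarrow> \<eta> c y vs = 0"
    show "T \<eta> = 0"
    proof (rule ccontr)
      assume n: "T \<eta> \<noteq> 0"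
      let ?\<eta> = "\<lambda>c y vs. (1 / T \<eta>) * \<eta> c y vs + 0 * \<eta> c y vs"
      have "?\<eta> \<in> ?U" by (rule r[rule_format, OF forms_combination[OF \<eta> \<eta>]]) (use z in auto)
      moreover have "T ?\<eta> = 1" using current_linear[OF T \<eta> \<eta>, of "1 / T \<eta>" 0] n by simp
      ultimately show False by simp
    qed
  qed
qed

end

context convex_calibrated
begin

text \<open>Far out the current vanishes, so the form may be multiplied by a cutoff function of
  \<open>f\<close>, which has compact support because the sublevel sets of \<open>f\<close> are
  compact.\<close>

lemma positive_current_nonneg:
  assumes T: "T \<in> currents A (Suc q)" "positive_current A g (Suc q) \<phi> T"
    and \<beta>: "\<beta> \<in> forms A (Suc q)" "positive_form A g (Suc q) \<phi> \<beta>"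
  shows "0 \<le> T \<beta>"
proof -
  obtain r where r: "\<And>\<eta>. \<eta> \<in> forms A (Suc q) \<Longrightarrow>
    (\<And>c y vs. c \<in> A \<Longrightarrow> y \<in> chart_img c \<Longrightarrow> f (chart_inv c y) < r \<Longrightarrow> \<eta> c y vs = 0) \<Longrightarrow> T \<eta> = 0"
    using current_vanishes_far_out[OF f_smooth T(1)] by metis
  have "\<exists>s::real\<Rightarrow>real. smooth_on s UNIV \<and> (\<forall>x. 0 \<le> s x) \<and> (\<forall>x. x \<le> r \<longrightarrow> s x = 1) \<and> (\<forall>x. r + 1 \<le> x \<longrightarrow> s x = 0)"
    by (rule smooth_cutoff[of r]) blast
  then obtain s :: "real \<Rightarrow> real" where "smooth_on s UNIV \<and> (\<forall>x. 0 \<le> s x) \<and> (\<forall>x. x \<le> r \<longrightarrow> s x = 1) \<and>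
    (\<forall>x. r + 1 \<le> x \<longrightarrow> s x = 0)" ..
  then have s: "smooth_on s UNIV" "0 \<le> s x" "x \<le> r \<Longrightarrow> s x = 1" "r + 1 \<le> x \<Longrightarrow> s x = 0" for x by auto
  let ?\<beta> = "fun_times_form (\<lambda>x. s (f x)) \<beta>"
  have f': "?\<beta> \<in> forms A (Suc q)"
    by (rule fun_times_form_forms[OF smooth_function_compose[OF s(1) f_smooth] \<beta>(1)])
  have "T (\<lambda>c y vs. 1 * \<beta> c y vs + (-1) * ?\<beta> c y vs) = 0"
    by (rule r[OF forms_combination[OF \<beta>(1) f']]) (use s(3) in \<open>simp add: fun_times_form_def\<close>)
  then have "T \<beta> = T ?\<beta>" unfolding current_linear[OF T(1) \<beta>(1) f'] by simp
  moreover have "positive_form A g (Suc q) \<phi> ?\<beta>"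
    using \<beta>(2) s(2) unfolding positive_form_def fun_times_form_def by (auto intro!: mult_nonneg_nonneg)
  moreover have "compact (form_support A ?\<beta>)"
  proof -
    have "form_support A ?\<beta> \<subseteq> {x. f x \<le> r + 1}"
      unfolding form_support_def
    proof (rule closure_minimal)
      show "closed {x. f x \<le> r + 1}" by (rule compact_imp_closed[OF f_proper])
      show "{x. \<exists>c\<in>A. x \<in> chart_dom c \<and> (\<exists>vs. ?\<beta> c (chart_map c x) vs \<noteq> 0)} \<subseteq> {x. f x \<le> r + 1}"
      proof clarify
        fix x c vs assume "c \<in> A" "x \<in> chart_dom c" "?\<beta> c (chart_map c x) vs \<noteq> 0"
        then have "s (f x) \<noteq> 0" by (simp add: fun_times_form_def)
        then show "f x \<le> r + 1" using s(4)[of "f x"] by linarith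
      qed
    qed
    moreover have "closed (form_support A ?\<beta>)" by (simp add: form_support_def)
    ultimately show ?thesis using compact_Int_closed[OF f_proper] by (metis inf.absorb_iff2 inf_commute)
  qed
  ultimately show ?thesis using T(2) f' unfolding positive_current_def by auto
qed

section \<open>Continuity of positive functionals\<close>

text \<open>The seminorm given by the values on the \<open>\<phi>\<close>-planes over a sublevel set, as a
  relation: the supremum would need a separate treatment when there are no planes.\<close>

definition plane_bound :: "real \<Rightarrow> real \<Rightarrow> ('a, 'n) form \<Rightarrow> bool" where
  "plane_bound r B \<beta> \<longleftrightarrow> (\<forall>(c, y, vs)\<in>planes. f (chart_inv c y) \<le> r \<longrightarrow> \<bar>\<beta> c y vs\<bar> \<le> B)"

lemma plane_bound_exists:
  assumes \<beta>: "\<beta> \<in> forms A (Suc q)"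
  shows "\<exists>B. plane_bound r B \<beta>"
proof -
  obtain F R where F: "finite F" "R > 0"
    "\<forall>(c, L, bs)\<in>F. c \<in> A \<and> compact L \<and> L \<subseteq> chart_img c \<and> set bs \<subseteq> Basis \<and> length bs = Suc q"
    "\<forall>\<beta>\<in>forms A (Suc q). \<forall>B. 0 \<le> B \<longrightarrow> (\<forall>(c, L, bs)\<in>F. \<forall>y\<in>L. \<bar>\<beta> c y bs\<bar> \<le> B) \<longrightarrow>
      (\<forall>(c, y, vs)\<in>planes. f (chart_inv c y) \<le> r \<longrightarrow> \<bar>\<beta> c y vs\<bar> \<le> R * B)"
    using plane_values_bound[of r] by (elim exE conjE)
  have "\<exists>B. \<forall>y\<in>L. \<bar>\<beta> c y bs\<bar> \<le> B" if "(c, L, bs) \<in> F" for c L bs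
  proof -
    have c: "c \<in> A" "compact L" "L \<subseteq> chart_img c" "length bs = Suc q" using F(3) that by auto
    have "compact ((\<lambda>y. \<beta> c y bs) ` L)"
      by (rule compact_continuous_image[OF continuous_on_subset[OF smooth_on_continuous[OF formsD(4)[OF \<beta> c(1,4)]] c(3)] c(2)])
    then show ?thesis using compact_imp_bounded by (fastforce simp: bounded_iff)
  qed
  then have "\<forall>s\<in>F. \<exists>B. \<forall>y\<in>fst (snd s). \<bar>\<beta> (fst s) y (snd (snd s))\<bar> \<le> B" by force
  then obtain B where B: "\<forall>s\<in>F. \<forall>y\<in>fst (snd s). \<bar>\<beta> (fst s) y (snd (snd s))\<bar> \<le> B s" by metis
  have "\<forall>(c, L, bs)\<in>F. \<forall>y\<in>L. \<bar>\<beta> c y bs\<bar> \<le> (\<Sum>s\<in>F. \<bar>B s\<bar>)"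
  proof clarify
    fix c L bs y assume s: "(c, L, bs) \<in> F" "y \<in> L"
    then have "\<bar>\<beta> c y bs\<bar> \<le> \<bar>B (c, L, bs)\<bar>" using B by fastforce
    also have "\<dots> \<le> (\<Sum>s\<in>F. \<bar>B s\<bar>)" using F(1) s(1) by (intro member_le_sum) auto
    finally show "\<bar>\<beta> c y bs\<bar> \<le> (\<Sum>s\<in>F. \<bar>B s\<bar>)" .
  qed
  then have "plane_bound r (R * (\<Sum>s\<in>F. \<bar>B s\<bar>)) \<beta>"
    using F(4) \<beta> unfolding plane_bound_def by (simp add: sum_nonneg)
  then show ?thesis by blast
qed

context
  fixes T :: "('a, 'n) form \<Rightarrow> real"
  assumes T_linear: "\<And>\<omega> \<eta> a b. \<omega> \<in> forms A (Suc q) \<Longrightarrow> \<eta> \<in> forms A (Suc q) \<Longrightarrow> T (a *\<^sub>R \<omega> + b *\<^sub>R \<eta>) = a * T \<omega> + b * T \<eta>"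
    and T_pos: "\<And>\<beta>. \<beta> \<in> forms A (Suc q) \<Longrightarrow> positive_form A g (Suc q) \<phi> \<beta> \<Longrightarrow> 0 \<le> T \<beta>"
begin

text \<open>Automatic continuity. Suppose that the bound fails for every \<open>m\<close>. Rescaled
  counterexamples \<open>\<gamma> m\<close> have \<open>T (\<gamma> m) \<ge> 1\<close> and are
  at most \<open>1 / 2 ^ m\<close> on the planes over \<open>{f \<le> m}\<close>. Over a fixed
  sublevel set all their partial sums have a common bound, hence one exact form dominates all
  partial sums, and its value under \<open>T\<close> exceeds every natural number.\<close>

lemma positive_functional_bounded_above:
  "\<exists>m::nat. \<forall>\<beta>\<in>forms A (Suc q). plane_bound m 1 \<beta> \<longrightarrow> T \<beta> \<le> 2 ^ m"
proof (rule ccontr)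
  assume "\<not> ?thesis"
  then have "\<forall>m. \<exists>\<beta>. \<beta> \<in> forms A (Suc q) \<and> plane_bound (real m) 1 \<beta> \<and> 2 ^ m < T \<beta>" by (auto simp: not_le)
  from choice[OF this] obtain \<beta> where \<beta>: "\<And>m. \<beta> m \<in> forms A (Suc q)" "\<And>m. plane_bound (real m) 1 (\<beta> m)" "\<And>m. 2 ^ m < T (\<beta> m)"
    by auto
  \<comment> \<open>scaled so that \<open>T\<close> stays at least one while the bounds on planes become summable\<close>
  define \<gamma> where "\<gamma> m = (1 / 2 ^ m) *\<^sub>R \<beta> m" for m
  note sub = subspace_forms[of "Suc q"]
  have \<gamma>: "\<gamma> m \<in> forms A (Suc q)" for m unfolding \<gamma>_def by (rule subspace_scale[OF sub \<beta>(1)])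
  have T\<gamma>: "1 \<le> T (\<gamma> m)" for m
  proof -
    have "T (\<gamma> m) = (1 / 2 ^ m) * T (\<beta> m)"
      using T_linear[OF \<beta>(1) \<beta>(1), of "1 / 2 ^ m" m 0 m] by (simp add: \<gamma>_def)
    then show ?thesis using \<beta>(3)[of m] by simp
  qed
  have small: "\<bar>\<gamma> m c y vs\<bar> \<le> (1 / 2) ^ m" if "(c, y, vs) \<in> planes" "f (chart_inv c y) \<le> real m" for m c y vs
    using \<beta>(2)[of m] that unfolding plane_bound_def by (auto simp: \<gamma>_def abs_mult field_simps power_divide)
  have "\<forall>M m. \<exists>C. plane_bound (real M) C (\<gamma> m)" using plane_bound_exists[OF \<gamma>] by blast
  then obtain C where C: "\<And>M m. plane_bound (real M) (C M m) (\<gamma> m)" by metis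
  obtain \<alpha> where \<alpha>: "\<alpha> \<in> forms A q" and dom: "\<And>c y vs. (c, y, vs) \<in> planes \<Longrightarrow>
      (\<lambda>M. (\<Sum>m<M. \<bar>C M m\<bar>) + 2) (nat \<lceil>f (chart_inv c y)\<rceil>) \<le> ext_d A q \<alpha> c y vs"
    using exact_domination[of "\<lambda>M. (\<Sum>m<M. \<bar>C M m\<bar>) + 2"] by metis
  have d\<alpha>: "ext_d A q \<alpha> \<in> forms A (Suc q)" by (rule ext_d_forms[OF \<alpha>])
  have sums: "(\<Sum>m<N. \<gamma> m) \<in> forms A (Suc q) \<and> T (\<Sum>m<N. \<gamma> m) = (\<Sum>m<N. T (\<gamma> m)) \<and>
      (\<forall>c y vs. (\<Sum>m<N. \<gamma> m) c y vs = (\<Sum>m<N. \<gamma> m c y vs))" for N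
  proof (induction N)
    case 0
    have "T 0 = 0" using T_linear[OF subspace_0[OF sub] subspace_0[OF sub], of 0 0] by simp
    then show ?case using subspace_0[OF sub] by (simp add: zero_fun_def)
  next
    case (Suc N)
    then show ?case
      using subspace_add[OF sub _ \<gamma>] T_linear[OF _ \<gamma>, of _ 1 1] by (simp add: plus_fun_def)
  qed
  have "real N \<le> T (ext_d A q \<alpha>)" for N
  proof -
    let ?\<delta> = "1 *\<^sub>R ext_d A q \<alpha> + (-1) *\<^sub>R (\<Sum>m<N. \<gamma> m)"
    have "?\<delta> \<in> forms A (Suc q)"
      by (intro subspace_add[OF sub] subspace_scale[OF sub] d\<alpha> conjunct1[OF sums])
    moreover have "positive_form A g (Suc q) \<phi> ?\<delta>"
      unfolding positive_form_def
    proof clarify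
      fix c y vs assume P: "(c, y, vs) \<in> planes"
      define M where "M = nat \<lceil>f (chart_inv c y)\<rceil>"
      have fM: "f (chart_inv c y) \<le> real M" unfolding M_def by linarith
      have "(\<Sum>m<N. \<gamma> m c y vs) \<le> (\<Sum>m<N. (if m < M then \<bar>C M m\<bar> else 0) + (1 / 2) ^ m)"
      proof (rule sum_mono)
        fix m
        show "\<gamma> m c y vs \<le> (if m < M then \<bar>C M m\<bar> else 0) + (1 / 2) ^ m"
        proof (cases "m < M")
          case True
          have "\<bar>\<gamma> m c y vs\<bar> \<le> C M m" using C[of M m] P fM unfolding plane_bound_def by auto
          then show ?thesis using True by (simp add: add_increasing2)
        next
          case False
          then show ?thesis using small[OF P, of m] fM by simp
        qed
      qed
      also have "\<dots> = (\<Sum>m<N. if m < M then \<bar>C M m\<bar> else 0) + (\<Sum>m<N. (1 / 2) ^ m)"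
        by (rule sum.distrib)
      also have "(\<Sum>m<N. if m < M then \<bar>C M m\<bar> else 0) \<le> (\<Sum>m<M. \<bar>C M m\<bar>)"
        by (simp add: sum.If_cases) (intro sum_mono2; auto)
      also have "(\<Sum>m<N. (1 / 2) ^ m) \<le> (2::real)"
        by (simp add: sum_gp_strict)
      finally have "(\<Sum>m<N. \<gamma> m c y vs) \<le> (\<Sum>m<M. \<bar>C M m\<bar>) + 2" by simp
      also have "\<dots> \<le> ext_d A q \<alpha> c y vs" using dom[OF P] by (simp add: M_def)
      finally show "0 \<le> ?\<delta> c y vs"
        using conjunct2[OF conjunct2[OF sums[of N]], rule_format, of c y vs] by simp
    qed
    ultimately have "0 \<le> T ?\<delta>" by (rule T_pos)
    also have "T ?\<delta> = T (ext_d A q \<alpha>) - (\<Sum>m<N. T (\<gamma> m))"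
      using T_linear[OF d\<alpha> conjunct1[OF sums[of N]], of 1 "-1"] sums[of N] by simp
    finally have "(\<Sum>m<N. T (\<gamma> m)) \<le> T (ext_d A q \<alpha>)" by simp
    moreover have "(\<Sum>m<N. 1) \<le> (\<Sum>m<N. T (\<gamma> m))" by (intro sum_mono T\<gamma>)
    ultimately show ?thesis by simp
  qed
  then show False using reals_Archimedean2[of "T (ext_d A q \<alpha>)"] by (meson not_le)
qed

lemma positive_functional_bounded:
  "\<exists>m::nat. \<forall>\<beta>\<in>forms A (Suc q). \<forall>s>0. plane_bound m s \<beta> \<longrightarrow> \<bar>T \<beta>\<bar> \<le> 2 ^ m * s"
proof -
  obtain m :: nat where m: "\<forall>\<beta>\<in>forms A (Suc q). plane_bound m 1 \<beta> \<longrightarrow> T \<beta> \<le> 2 ^ m"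
    using positive_functional_bounded_above by blast
  have "a * T \<beta> \<le> 2 ^ m" if \<beta>: "\<beta> \<in> forms A (Suc q)" "plane_bound m s \<beta>" and a: "\<bar>a\<bar> * s \<le> 1" for \<beta> s a
  proof -
    have "plane_bound m 1 (a *\<^sub>R \<beta>)"
      unfolding plane_bound_def
    proof clarify
      fix c y vs assume "(c, y, vs) \<in> planes" "f (chart_inv c y) \<le> real m"
      then have "\<bar>\<beta> c y vs\<bar> \<le> s" using \<beta>(2) unfolding plane_bound_def by auto
      then have "\<bar>a\<bar> * \<bar>\<beta> c y vs\<bar> \<le> \<bar>a\<bar> * s" by (rule mult_left_mono) simp
      then show "\<bar>(a *\<^sub>R \<beta>) c y vs\<bar> \<le> 1" using a by (simp add: abs_mult)
    qed
    then have "T (a *\<^sub>R \<beta>) \<le> 2 ^ m" using m subspace_scale[OF subspace_forms \<beta>(1)] by blast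
    then show ?thesis using T_linear[OF \<beta>(1) \<beta>(1), of a 0] by simp
  qed note * = this
  have "\<bar>T \<beta>\<bar> \<le> 2 ^ m * s" if "\<beta> \<in> forms A (Suc q)" "s > 0" "plane_bound m s \<beta>" for \<beta> s
    using *[OF that(1,3), of "1 / s"] *[OF that(1,3), of "- (1 / s)"] that(2) by (auto simp: field_simps abs_le_iff)
  then show ?thesis by blast
qed

text \<open>Over the relevant sublevel set the planes are controlled by finitely many seminorms of order zero.\<close>

lemma positive_functional_continuous:
  "continuous_map (form_topology A (Suc q)) euclideanreal T"
  unfolding continuous_map_def
proof (intro conjI allI impI)
  show "T \<in> topspace (form_topology A (Suc q)) \<rightarrow> topspace euclideanreal" by simp
  fix U :: "real set" assume "openin euclideanreal U"
  then have U: "open U" by simp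
  obtain m :: nat where m: "\<And>\<beta> s. \<beta> \<in> forms A (Suc q) \<Longrightarrow> s > 0 \<Longrightarrow> plane_bound m s \<beta> \<Longrightarrow> \<bar>T \<beta>\<bar> \<le> 2 ^ m * s"
    using positive_functional_bounded by blast
  obtain F R where F: "finite F" "R > 0"
    "\<forall>(c, L, bs)\<in>F. c \<in> A \<and> compact L \<and> L \<subseteq> chart_img c \<and> set bs \<subseteq> Basis \<and> length bs = Suc q"
    "\<forall>\<beta>\<in>forms A (Suc q). \<forall>B. 0 \<le> B \<longrightarrow> (\<forall>(c, L, bs)\<in>F. \<forall>y\<in>L. \<bar>\<beta> c y bs\<bar> \<le> B) \<longrightarrow>
      (\<forall>(c, y, vs)\<in>planes. f (chart_inv c y) \<le> real m \<longrightarrow> \<bar>\<beta> c y vs\<bar> \<le> R * B)"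
    using plane_values_bound[of "real m"] by (elim exE conjE)
  let ?W = "{\<omega> \<in> topspace (form_topology A (Suc q)). T \<omega> \<in> U}"
  show "openin (form_topology A (Suc q)) ?W"
  proof (subst openin_subopen, intro ballI)
    fix \<omega> assume "\<omega> \<in> ?W"
    then have \<omega>: "\<omega> \<in> forms A (Suc q)" "T \<omega> \<in> U" by (auto simp: topspace_form_topology)
    obtain e where e: "e > 0" "\<And>t. \<bar>t - T \<omega>\<bar> < e \<Longrightarrow> t \<in> U"
      using U \<omega>(2) by (metis open_real)
    \<comment> \<open>a perturbation below \<open>\<delta>\<close> in the chosen seminorms is at most
      \<open>R * \<delta>\<close> on planes and changes \<open>T\<close> by at most
      \<open>e / 2\<close>\<close>
    define \<delta> where "\<delta> = e / (2 ^ m * R * 2)"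
    have \<delta>: "\<delta> > 0" using e F(2) by (simp add: \<delta>_def)
    let ?N = "\<lambda>s. form_nbhd A (Suc q) (fst s) (fst (snd s)) [] (snd (snd s)) \<omega> \<delta>"
    let ?V = "topspace (form_topology A (Suc q)) \<inter> \<Inter> (?N ` F)"
    have "openin (form_topology A (Suc q)) (?N s)" if "s \<in> F" for s
    proof -
      obtain c L bs where s: "s = (c, L, bs)" by (cases s)
      then have "c \<in> A" "compact L" "L \<subseteq> chart_img c" "set bs \<subseteq> Basis" "length bs = Suc q"
        using F(3) that by auto
      then show ?thesis unfolding s using \<omega> \<delta> by (auto intro!: openin_form_nbhd)
    qed
    then have "openin (form_topology A (Suc q)) ?V"
      using F(1) by (intro openin_Int_Inter) auto
    moreover have "\<omega> \<in> ?V" using \<omega> \<delta> by (simp add: topspace_form_topology form_nbhd_def)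
    moreover have "?V \<subseteq> ?W"
    proof
      fix \<eta> assume \<eta>V: "\<eta> \<in> ?V"
      then have \<eta>: "\<eta> \<in> forms A (Suc q)" by (simp add: topspace_form_topology)
      let ?\<beta> = "1 *\<^sub>R \<eta> + (-1) *\<^sub>R \<omega>"
      have \<beta>: "?\<beta> \<in> forms A (Suc q)"
        by (intro subspace_add[OF subspace_forms] subspace_scale[OF subspace_forms] \<eta> \<omega>)
      have "\<forall>(c, L, bs)\<in>F. \<forall>y\<in>L. \<bar>?\<beta> c y bs\<bar> \<le> \<delta>"
      proof clarify
        fix c L bs y assume s: "(c, L, bs) \<in> F" "y \<in> L"
        then have "\<eta> \<in> ?N (c, L, bs)" using \<eta>V by blast
        then show "\<bar>?\<beta> c y bs\<bar> \<le> \<delta>" using s(2) by (auto simp: form_nbhd_def)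
      qed
      then have "plane_bound m (R * \<delta>) ?\<beta>"
        using F(4) \<beta> \<delta> unfolding plane_bound_def by (meson less_imp_le)
      then have "\<bar>T ?\<beta>\<bar> \<le> 2 ^ m * (R * \<delta>)" using m[OF \<beta>] F(2) \<delta> by simp
      also have "\<dots> < e" using e F(2) by (simp add: \<delta>_def)
      finally have "T \<eta> \<in> U" using e(2)[of "T \<eta>"] T_linear[OF \<eta> \<omega>(1), of 1 "-1"] by simp
      then show "\<eta> \<in> ?W" using \<eta> by (simp add: topspace_form_topology)
    qed
    ultimately show "\<exists>V. openin (form_topology A (Suc q)) V \<and> \<omega> \<in> V \<and> V \<subseteq> ?W" by blast
  qed
qed

end

section \<open>Filling by positive currents\<close>

text \<open>The positive functional to be extended is
  \<open>ext_d A q \<alpha> \<mapsto> S \<alpha>\<close>, given by its graph, so that its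
  being well defined need not be checked beforehand.\<close>

lemma positive_filling_exists:
  assumes S: "S \<in> currents A q"
    and pos: "\<And>\<alpha>. \<alpha> \<in> forms A q \<Longrightarrow> positive_form A g (Suc q) \<phi> (ext_d A q \<alpha>) \<Longrightarrow> 0 \<le> S \<alpha>"
  shows "\<exists>T\<in>currents A (Suc q). positive_current A g (Suc q) \<phi> T \<and> S = boundary A (Suc q) T"
proof -
  let ?V = "forms A (Suc q)"
  let ?P = "{\<beta> :: ('a, 'n) form. positive_form A g (Suc q) \<phi> \<beta>}" and ?G0 = "{(ext_d A q \<alpha>, S \<alpha>) | \<alpha>. \<alpha> \<in> forms A q}"
  have comb: "(\<lambda>c y vs. a * \<omega> c y vs + b * \<eta> c y vs) = a *\<^sub>R \<omega> + b *\<^sub>R \<eta>" for a b and \<omega> \<eta> :: "('a, 'n) form"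
    by (simp add: fun_eq_iff)
  have dlin: "ext_d A q (a *\<^sub>R \<omega> + b *\<^sub>R \<eta>) = a *\<^sub>R ext_d A q \<omega> + b *\<^sub>R ext_d A q \<eta>"
    and Slin: "S (a *\<^sub>R \<omega> + b *\<^sub>R \<eta>) = a * S \<omega> + b * S \<eta>" if "\<omega> \<in> forms A q" "\<eta> \<in> forms A q" for a b \<omega> \<eta>
    using ext_d_combination[OF that] current_linear[OF S that] by (simp_all add: comb)
  have fq: "a *\<^sub>R \<omega> + b *\<^sub>R \<eta> \<in> forms A q" if "\<omega> \<in> forms A q" "\<eta> \<in> forms A q" for a b \<omega> \<eta>
    using forms_combination[OF that] by (simp add: comb)
  have "\<exists>T. (\<forall>x\<in>?V. \<forall>y\<in>?V. \<forall>a b. T (a *\<^sub>R x + b *\<^sub>R y) = a * T x + b * T y) \<and>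
    (\<forall>x\<in>?V. x \<in> ?P \<longrightarrow> 0 \<le> T x) \<and> (\<forall>(v, r)\<in>?G0. T v = r)"
  proof (rule positive_extension[OF subspace_forms])
    show "subspace ?G0"
      unfolding subspace_def
    proof (intro conjI ballI allI)
      have 0: "0 \<in> forms A q" by (rule subspace_0[OF subspace_forms])
      then have "ext_d A q 0 = 0" "S 0 = 0" using dlin[OF 0 0, of 0 0] Slin[OF 0 0, of 0 0] by simp_all
      then show "0 \<in> ?G0" using 0 by (intro CollectI exI[of _ 0]) (simp add: zero_prod_def)
    next
      fix x y assume "x \<in> ?G0" "y \<in> ?G0"
      then obtain \<alpha> \<beta> where ab: "x = (ext_d A q \<alpha>, S \<alpha>)" "y = (ext_d A q \<beta>, S \<beta>)" "\<alpha> \<in> forms A q" "\<beta> \<in> forms A q"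
        by blast
      then show "x + y \<in> ?G0"
        using dlin[OF ab(3,4), of 1 1] Slin[OF ab(3,4), of 1 1] fq[OF ab(3,4), of 1 1]
        by (intro CollectI exI[of _ "\<alpha> + \<beta>"]) simp
    next
      fix x t assume "x \<in> ?G0"
      then obtain \<alpha> where a: "x = (ext_d A q \<alpha>, S \<alpha>)" "\<alpha> \<in> forms A q" by blast
      then show "t *\<^sub>R x \<in> ?G0"
        using dlin[OF a(2,2), of t 0] Slin[OF a(2,2), of t 0] fq[OF a(2,2), of t 0]
        by (intro CollectI exI[of _ "t *\<^sub>R \<alpha>"]) simp
    qed
    show "fst ` ?G0 \<subseteq> ?V" using ext_d_forms by auto
    show "0 \<in> ?P" by (auto simp: positive_form_def)
    show "x + y \<in> ?P" if "x \<in> ?P" "y \<in> ?P" for x y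
      using that by (auto simp: positive_form_def intro!: add_nonneg_nonneg)
    show "t *\<^sub>R x \<in> ?P" if "x \<in> ?P" "0 < t" for x t
      using that by (auto simp: positive_form_def intro!: mult_nonneg_nonneg)
    show "0 \<le> r" if "(v, r) \<in> ?G0" "v \<in> ?P" for v r
      using that pos by auto
    show "\<exists>(v, r)\<in>?G0. v - x \<in> ?P" if x: "x \<in> ?V" for x
    proof -
      have "\<forall>m::nat. \<exists>B. plane_bound (real m) B x" using plane_bound_exists[OF x] by blast
      then obtain C where C: "\<And>m::nat. plane_bound (real m) (C m) x" by metis
      obtain \<alpha> where \<alpha>: "\<alpha> \<in> forms A q" and dom: "\<And>c y vs. (c, y, vs) \<in> planes \<Longrightarrow>
          C (nat \<lceil>f (chart_inv c y)\<rceil>) \<le> ext_d A q \<alpha> c y vs"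
        using exact_domination[of C] by metis
      have "ext_d A q \<alpha> - x \<in> ?P"
        unfolding positive_form_def
      proof clarify
        fix c y vs assume P: "(c, y, vs) \<in> planes"
        have "f (chart_inv c y) \<le> real (nat \<lceil>f (chart_inv c y)\<rceil>)" by linarith
        then have "\<bar>x c y vs\<bar> \<le> C (nat \<lceil>f (chart_inv c y)\<rceil>)"
          using C P unfolding plane_bound_def by blast
        then show "0 \<le> (ext_d A q \<alpha> - x) c y vs" using dom[OF P] by simp
      qed
      then show ?thesis using \<alpha> by blast
    qed
  qed
  then obtain T where "(\<forall>x\<in>?V. \<forall>y\<in>?V. \<forall>a b. T (a *\<^sub>R x + b *\<^sub>R y) = a * T x + b * T y) \<and>
    (\<forall>x\<in>?V. x \<in> ?P \<longrightarrow> 0 \<le> T x) \<and> (\<forall>(v, r)\<in>?G0. T v = r)" ..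
  note T_V = this[THEN conjunct1] and T_P = this[THEN conjunct2, THEN conjunct1]
    and T_G0 = this[THEN conjunct2, THEN conjunct2]
  have T3: "T (ext_d A q \<alpha>) = S \<alpha>" if "\<alpha> \<in> forms A q" for \<alpha>
  proof -
    have "(ext_d A q \<alpha>, S \<alpha>) \<in> ?G0" using that by blast
    from bspec[OF T_G0 this] show ?thesis by simp
  qed
  have T: "\<And>x y a b. x \<in> ?V \<Longrightarrow> y \<in> ?V \<Longrightarrow> T (a *\<^sub>R x + b *\<^sub>R y) = a * T x + b * T y"
    "\<And>x. x \<in> ?V \<Longrightarrow> positive_form A g (Suc q) \<phi> x \<Longrightarrow> 0 \<le> T x" "\<And>\<alpha>. \<alpha> \<in> forms A q \<Longrightarrow> T (ext_d A q \<alpha>) = S \<alpha>"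
    using T_V T_P T3 by simp_all
  have cont: "continuous_map (form_topology A (Suc q)) euclideanreal T"
    by (rule positive_functional_continuous[OF T(1,2)])
  let ?T = "restrict T ?V"
  have "continuous_map (form_topology A (Suc q)) euclideanreal ?T"
    by (rule continuous_map_eq[OF cont]) (simp add: topspace_form_topology)
  moreover have "?T (\<lambda>c y vs. a * \<omega> c y vs + b * \<eta> c y vs) = a * ?T \<omega> + b * ?T \<eta>"
    if "\<omega> \<in> ?V" "\<eta> \<in> ?V" for a b \<omega> \<eta>
    using T(1)[OF that] forms_combination[OF that] that by (simp add: comb)
  ultimately have "?T \<in> currents A (Suc q)" unfolding currents_def by blast
  moreover have "positive_current A g (Suc q) \<phi> ?T"
    using T(2) by (simp add: positive_current_def)
  moreover have "S = boundary A (Suc q) ?T"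
  proof (rule extensionalityI)
    show "S \<in> extensional (forms A q)" using S by (simp add: currents_def)
    show "boundary A (Suc q) ?T \<in> extensional (forms A q)" by (simp add: boundary_def)
    show "S \<alpha> = boundary A (Suc q) ?T \<alpha>" if "\<alpha> \<in> forms A q" for \<alpha>
      using that T(3) ext_d_forms[OF that] by (simp add: boundary_def)
  qed
  ultimately show ?thesis by blast
qed

lemma boundary_of_positive_current_nonneg:
  assumes "T \<in> currents A (Suc q)" "positive_current A g (Suc q) \<phi> T"
    and "\<alpha> \<in> forms A q" "positive_form A g (Suc q) \<phi> (ext_d A q \<alpha>)"
  shows "0 \<le> boundary A (Suc q) T \<alpha>"
  using positive_current_nonneg[OF assms(1,2) ext_d_forms[OF assms(3)] assms(4)] assms(3)
  by (simp add: boundary_def)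

end

theorem theorem4p1:
  fixes A :: "('a::{t2_space,second_countable_topology}, 'n::finite) chart set"
    and g :: "('a, 'n) metric"
    and p :: nat
    and \<phi> :: "('a, 'n) form"
    and S :: "('a, 'n) current"
  assumes "1 \<le> p"
    and "calibrated_manifold A g p \<phi>"
    and "\<not> compact (UNIV :: 'a set)"
    and "strictly_phi_convex A g p \<phi>"
    and "exact_form A p \<phi>"
    and "S \<in> currents A (p - 1)"
  shows "(\<exists>T\<in>currents A p. positive_current A g p \<phi> T \<and> S = boundary A p T) \<longleftrightarrow>
         (\<forall>\<alpha>\<in>forms A (p - 1). positive_form A g p \<phi> (ext_d A (p - 1) \<alpha>) \<longrightarrow> S \<alpha> \<ge> 0)"
proof -
  obtain q where p: "p = Suc q" using assms(1) by (cases p) auto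
  obtain f where f: "smooth_function A f" "strictly_phi_psh A g p \<phi> f" "\<And>r. compact {x. f x \<le> r}"
    using assms(4) unfolding strictly_phi_convex_def by blast
  interpret convex_calibrated A g q \<phi> f
  proof
    show "oriented_atlas A" using assms(2) by (simp add: calibrated_manifold_def)
    show "calibrated_manifold A g (Suc q) \<phi>" using assms(2) by (simp add: p)
  qed (use f in \<open>simp_all add: p\<close>)
  show ?thesis
    using positive_filling_exists[of S] boundary_of_positive_current_nonneg assms(6)
    by (auto simp: p)
qed

end
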